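(* There exists an algorithm for the order selection prophet inequality problem that guarantees a competitive ratio of at least $\Gamma^*=0.7258$ on every instance; that is, on every instance, $\mathbb{E}[\mathrm{ALG}]\ge 0.7258\cdot \mathbb{E}[\max_i v_i]$.
   Context: Order selection prophet inequality: an instance consists of $n>1$ items with independent non-negative values $v_1,\dots,v_n$, $v_i\sim D_i$, where the distributions $D_1,\dots,D_n$ are known to the algorithm. The algorithm first chooses the order in which the items arrive (possibly at random, and it may be adaptive to the realized values as they arrive). When an item arrives its value is revealed, and the algorithm must irrevocably either accept it (receiving its value as reward and stopping) or reject it and continue. $\mathrm{ALG}$ denotes the value of the accepted item (0 if none). An algorithm is $\Gamma$-competitive if $\mathbb{E}[\mathrm{ALG}]\ge \Gamma\,\mathbb{E}[\max_i v_i]$ for every instance. *)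

theory Defs
  imports "HOL-Probability.Probability"
begin

text \<open>An instance with \<open>n\<close> items \<open>0, \<dots>, n - 1\<close>; only \<open>D i\<close> with \<open>i < n\<close> matters.
  The expectations need not be finite.\<close>

definition os_instance :: "nat \<Rightarrow> (nat \<Rightarrow> real measure) \<Rightarrow> bool" where
  "os_instance n D \<longleftrightarrow> 1 < n \<and>
     (\<forall>i<n. prob_space (D i) \<and> sets (D i) = sets borel \<and> (AE x in D i. 0 \<le> x))"

text \<open>The joint law of the independent values.\<close>

definition values_measure :: "nat \<Rightarrow> (nat \<Rightarrow> real measure) \<Rightarrow> (nat \<Rightarrow> real) measure" where
  "values_measure n D = (\<Pi>\<^sub>M i\<in>{..<n}. D i)"

text \<open>The internal randomness of an algorithm: a sequence of independent uniform numbers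
  in \<open>[0, 1]\<close>, independent of the values of the items.\<close>

type_synonym coins = "nat \<Rightarrow> real"

definition coin_measure :: "coins measure" where
  "coin_measure = (\<Pi>\<^sub>M k\<in>UNIV. uniform_measure lborel {0..1})"

text \<open>A history lists the items that have arrived so far, with their values, in order of
  arrival. The next item to arrive is determined by \<open>pick\<close> from the history of the rejected
  items, and \<open>accept\<close> decides about the last item of the history it is given. Hence
  neither has access to values that have not been revealed yet.\<close>

type_synonym history = "(nat \<times> real) list"

definition history_of :: "nat list \<Rightarrow> (nat \<Rightarrow> real) \<Rightarrow> history" where
  "history_of is v = map (\<lambda>i. (i, v i)) is"

record policy =
  pick :: "coins \<Rightarrow> history \<Rightarrow> nat"
  accept :: "coins \<Rightarrow> history \<Rightarrow> bool"

text \<open>Each picked item is one that has not arrived yet. Measurability in the coins and the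
  revealed values is required for every fixed sequence of arrived items.\<close>

definition valid_policy :: "nat \<Rightarrow> policy \<Rightarrow> bool" where
  "valid_policy n P \<longleftrightarrow>
     (\<forall>is. distinct is \<and> set is \<subset> {..<n} \<longrightarrow>
        (\<forall>s v. pick P s (history_of is v) \<in> {..<n} - set is) \<and>
        (\<lambda>(s, v). pick P s (history_of is v))
          \<in> measurable (coin_measure \<Otimes>\<^sub>M (\<Pi>\<^sub>M i\<in>{..<n}. borel)) (count_space UNIV)) \<and>
     (\<forall>is. distinct is \<and> set is \<subseteq> {..<n} \<and> is \<noteq> [] \<longrightarrow>
        (\<lambda>(s, v). accept P s (history_of is v))
          \<in> measurable (coin_measure \<Otimes>\<^sub>M (\<Pi>\<^sub>M i\<in>{..<n}. borel)) (count_space UNIV))"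

text \<open>\<open>run P s v k h\<close> is the reward obtained from history \<open>h\<close> (all of whose items were
  rejected) when \<open>k\<close> items have yet to arrive.\<close>

primrec run :: "policy \<Rightarrow> coins \<Rightarrow> (nat \<Rightarrow> real) \<Rightarrow> nat \<Rightarrow> history \<Rightarrow> real" where
  "run P s v 0 h = 0"
| "run P s v (Suc k) h =
     (let i = pick P s h; h' = h @ [(i, v i)]
      in if accept P s h' then v i else run P s v k h')"

definition ALG :: "nat \<Rightarrow> policy \<Rightarrow> coins \<Rightarrow> (nat \<Rightarrow> real) \<Rightarrow> real" where
  "ALG n P s v = run P s v n []"

definition expected_ALG :: "nat \<Rightarrow> (nat \<Rightarrow> real measure) \<Rightarrow> policy \<Rightarrow> ennreal" where
  "expected_ALG n D P =
     (\<integral>\<^sup>+ (s, v). ennreal (ALG n P s v) \<partial>(coin_measure \<Otimes>\<^sub>M values_measure n D))"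

definition expected_max :: "nat \<Rightarrow> (nat \<Rightarrow> real measure) \<Rightarrow> ennreal" where
  "expected_max n D = (\<integral>\<^sup>+ v. ennreal (Max (v ` {..<n})) \<partial>values_measure n D)"

text \<open>An algorithm knows the instance, so it is a map from instances to policies.\<close>

type_synonym algorithm = "nat \<Rightarrow> (nat \<Rightarrow> real measure) \<Rightarrow> policy"

definition os_algorithm :: "algorithm \<Rightarrow> bool" where
  "os_algorithm A \<longleftrightarrow> (\<forall>n D. os_instance n D \<longrightarrow> valid_policy n (A n D))"

definition competitive :: "real \<Rightarrow> algorithm \<Rightarrow> bool" where
  "competitive \<Gamma> A \<longleftrightarrow>
     (\<forall>n D. os_instance n D \<longrightarrow> expected_ALG n D (A n D) \<ge> ennreal \<Gamma> * expected_max n D)"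

end

theory Submission
  imports Defs
begin

text \<open>Accept an item with the backward-induction threshold along a fixed order; then only the
  order matters. A random order is obtained by letting every item draw an arrival time and a
  time-dependent acceptance probability, and by averaging some fixed order does as well as the
  random one. After rounding the values to a grid, the acceptance probabilities of the items form
  a path $q_i(t)$ from 0 to 1 along which the threshold decreases. In the limit of fine time steps it suffices
  that for every level the chance of selling above it is at least $\Gamma$ times the probability
  that some value is above it. If item $i$ arrives with the density that makes the sale rate
  proportional to $-\frac{d}{dt}\prod_{l\ne i}(1-q_l(t))$, this holds with equality; the density of
  item $i$ has total mass at most one unless, as potential function arguments show, $q_i$ follows a
  very specific course. An item $j$ of that kind arrives at the very beginning with a fixed
  probability and at the very end otherwise, and the others are run with the larger rate
  $0.757$ up to the time when $\prod_{l\ne j}(1-q_l) = 0.197$.\<close>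

section \<open>From arrival times to a fixed order\<close>

text \<open>With the densities described, the chance that nothing has been sold by level t is
  exactly S = 1 - G * Pr(at least two values above level t). For one item let y be its own q and z
  the product of 1 - q over the others; S is bounded below in terms of y and z, and the mass obeys
  an equation in z, y and S. The extreme cases y = 0 and y = 1 have explicit potentials that bound
  the mass still to come. One is used for large z, the other for small z, and they meet at z =
  0.2105, where the first is only known to be at least 0.356109 while the second is about 0.3578.
  This defect, below 0.002, is the obstacle. It matters only if y is tiny until z nears 0.21 and
  large by z = 0.12; any other course yields a gain that covers it. Offering such an item at two
  fixed levels only loses little, and the difference between 0.757 and 0.7258 pays for the
  loss.\<close>

lemma weighted_exists_ge:
  fixes w v :: "'a \<Rightarrow> real"
  assumes "finite A" and w: "\<And>x. x \<in> A \<Longrightarrow> 0 \<le> w x" and s: "sum w A = 1"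
  shows "\<exists>x\<in>A. (\<Sum>x\<in>A. w x * v x) \<le> v x"
proof (rule ccontr)
  define m where "m = (\<Sum>x\<in>A. w x * v x)"
  assume "\<not> ?thesis"
  then have lt: "v x < m" if "x \<in> A" for x using that by (auto simp: m_def not_le)
  obtain y where y: "y \<in> A" "w y > 0"
  proof (rule ccontr)
    assume "\<not> thesis"
    then have "\<And>x. x \<in> A \<Longrightarrow> w x = 0" using w that by force
    then show False using s by simp
  qed
  have "(\<Sum>x\<in>A. w x * v x) < (\<Sum>x\<in>A. w x * m)"
  proof (rule sum_strict_mono_ex1[OF assms(1)])
    show "\<forall>x\<in>A. w x * v x \<le> w x * m"
      using lt w by (auto intro!: mult_left_mono simp: less_imp_le)
    show "\<exists>x\<in>A. w x * v x < w x * m"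
      using y lt[OF y(1)] by (intro bexI[of _ y] mult_strict_left_mono) auto
  qed
  also have "\<dots> = m" using s by (simp flip: sum_distrib_right)
  finally show False by (simp add: m_def)
qed

text \<open>The slots \<open>T i\<close> are drawn independently with law \<open>p i\<close>, and
  the left side is the mean of the right side. The condition \<open>T l \<le> T i\<close> counts
  every tie against item i: this is a lower bound however ties are ordered, and it makes the mean
  factorise into one term per item.\<close>

lemma averaging:
  fixes p r Q :: "nat \<Rightarrow> nat \<Rightarrow> real"
  assumes p: "\<And>i \<tau>. i < n \<Longrightarrow> 0 \<le> p i \<tau>" and p1: "\<And>i. i < n \<Longrightarrow> (\<Sum>\<tau><N. p i \<tau>) = 1"
  shows "\<exists>T. (\<forall>i<n. T i < N) \<and>
    (\<Sum>i<n. \<Sum>\<tau><N. p i \<tau> * r i \<tau> * (\<Prod>l\<in>{..<n}-{i}. 1 - (\<Sum>\<tau>'\<in>{..\<tau>}. p l \<tau>' * Q l \<tau>')))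
    \<le> (\<Sum>i<n. r i (T i) * (\<Prod>l\<in>{..<n}-{i}. if T l \<le> T i then 1 - Q l (T l) else 1))"
proof -
  define A where "A = PiE {..<n} (\<lambda>_. {..<N})"
  define w where "w T = (\<Prod>i<n. p i (T i))" for T
  define v where "v T = (\<Sum>i<n. r i (T i) * (\<Prod>l\<in>{..<n}-{i}. if T l \<le> T i then 1 - Q l (T l) else 1))" for T
  have fin: "finite A" unfolding A_def by (intro finite_PiE) auto
  have w0: "0 \<le> w T" if "T \<in> A" for T unfolding w_def using p by (intro prod_nonneg) auto
  have w1: "sum w A = 1"
  proof -
    have "sum w A = (\<Prod>i<n. \<Sum>\<tau><N. p i \<tau>)" unfolding w_def A_def by (subst prod_sum_PiE) auto
    then show ?thesis using p1 by simp
  qed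
  have tm: "(\<Sum>T\<in>A. w T * (r i (T i) * (\<Prod>l\<in>{..<n}-{i}. if T l \<le> T i then 1 - Q l (T l) else 1)))
    = (\<Sum>\<tau><N. p i \<tau> * r i \<tau> * (\<Prod>l\<in>{..<n}-{i}. 1 - (\<Sum>\<tau>'\<in>{..\<tau>}. p l \<tau>' * Q l \<tau>')))" if i: "i < n" for i
  proof -
    \<comment> \<open>The factor of item i carries the event that its slot is \<tau>. This turns the
      summand into a single product over all items, so that \<open>prod_sum_PiE\<close> can exchange
      product and sum.\<close>
    define h where "h \<tau> l t = (if l = i then (if t = \<tau> then p i \<tau> * r i \<tau> else 0) 
      else p l t * (if t \<le> \<tau> then 1 - Q l t else 1))" for \<tau> l t
    have "w T * (r i (T i) * (\<Prod>l\<in>{..<n}-{i}. if T l \<le> T i then 1 - Q l (T l) else 1)) 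
      = (\<Sum>\<tau><N. \<Prod>l<n. h \<tau> l (T l))" if T: "T \<in> A" for T
    proof -
      have Ti: "T i < N" using T i by (auto simp: A_def)
      have e: "(\<Prod>l<n. h \<tau> l (T l)) = h \<tau> i (T i) * (\<Prod>l\<in>{..<n}-{i}. h \<tau> l (T l))" for \<tau>
        using i by (intro prod.remove) auto
      have wi: "w T = p i (T i) * (\<Prod>l\<in>{..<n}-{i}. p l (T l))"
        unfolding w_def using i by (intro prod.remove) auto
      have "(\<Sum>\<tau><N. \<Prod>l<n. h \<tau> l (T l)) = (\<Prod>l<n. h (T i) l (T l))"
      proof (subst sum.remove[of _ "T i"])
        show "(\<Prod>l<n. h (T i) l (T l)) + (\<Sum>\<tau>\<in>{..<N}-{T i}. \<Prod>l<n. h \<tau> l (T l)) = (\<Prod>l<n. h (T i) l (T l))"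
          unfolding e by (simp add: h_def)
      qed (use Ti in auto)
      also have "\<dots> = p i (T i) * r i (T i) * (\<Prod>l\<in>{..<n}-{i}. p l (T l) * (if T l \<le> T i then 1 - Q l (T l) else 1))"
        unfolding e by (intro arg_cong2[where f = "(*)"] prod.cong refl) (auto simp: h_def)
      also have "\<dots> = w T * (r i (T i) * (\<Prod>l\<in>{..<n}-{i}. if T l \<le> T i then 1 - Q l (T l) else 1))"
        unfolding wi prod.distrib by (simp only: mult_ac)
      finally show ?thesis by (rule sym)
    qed
    then have "(\<Sum>T\<in>A. w T * (r i (T i) * (\<Prod>l\<in>{..<n}-{i}. if T l \<le> T i then 1 - Q l (T l) else 1)))
      = (\<Sum>T\<in>A. \<Sum>\<tau><N. \<Prod>l<n. h \<tau> l (T l))" by (rule sum.cong[OF refl])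
    also have "\<dots> = (\<Sum>\<tau><N. \<Sum>T\<in>A. \<Prod>l<n. h \<tau> l (T l))" by (rule sum.swap)
    also have "\<dots> = (\<Sum>\<tau><N. \<Prod>l<n. \<Sum>t<N. h \<tau> l t)" unfolding A_def
      by (rule sum.cong[OF refl], rule prod_sum_PiE[symmetric]) auto
    also have "\<dots> = (\<Sum>\<tau><N. p i \<tau> * r i \<tau> * (\<Prod>l\<in>{..<n}-{i}. 1 - (\<Sum>\<tau>'\<in>{..\<tau>}. p l \<tau>' * Q l \<tau>')))"
    proof (rule sum.cong[OF refl])
      fix \<tau> assume \<tau>: "\<tau> \<in> {..<N}"
      have "(\<Sum>t<N. h \<tau> i t) = p i \<tau> * r i \<tau>" using \<tau> by (simp add: h_def sum.delta)
      moreover have "(\<Sum>t<N. h \<tau> l t) = 1 - (\<Sum>\<tau>'\<in>{..\<tau>}. p l \<tau>' * Q l \<tau>')" if l: "l \<in> {..<n}-{i}" for l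
      proof -
        have "(\<Sum>t<N. h \<tau> l t) = (\<Sum>t<N. p l t - (if t \<le> \<tau> then p l t * Q l t else 0))"
          using l by (intro sum.cong) (auto simp: h_def algebra_simps)
        also have "\<dots> = 1 - (\<Sum>t<N. if t \<le> \<tau> then p l t * Q l t else 0)"
          using l p1[of l] by (simp add: sum_subtractf)
        also have "(\<Sum>t<N. if t \<le> \<tau> then p l t * Q l t else 0) = (\<Sum>\<tau>'\<in>{..\<tau>}. p l \<tau>' * Q l \<tau>')"
          using \<tau> by (intro sum.mono_neutral_cong_right) auto
        finally show ?thesis .
      qed
      ultimately show "(\<Prod>l<n. \<Sum>t<N. h \<tau> l t) = p i \<tau> * r i \<tau> * (\<Prod>l\<in>{..<n}-{i}. 1 - (\<Sum>\<tau>'\<in>{..\<tau>}. p l \<tau>' * Q l \<tau>'))"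
        using i by (subst prod.remove[of "{..<n}" i]) (simp_all only: finite_lessThan lessThan_iff cong: prod.cong)
    qed
    finally show ?thesis .
  qed
  have "(\<Sum>T\<in>A. w T * v T) = (\<Sum>i<n. \<Sum>T\<in>A. w T * (r i (T i) * (\<Prod>l\<in>{..<n}-{i}. if T l \<le> T i then 1 - Q l (T l) else 1)))"
    unfolding v_def sum_distrib_left by (rule sum.swap)
  also have "\<dots> = (\<Sum>i<n. \<Sum>\<tau><N. p i \<tau> * r i \<tau> * (\<Prod>l\<in>{..<n}-{i}. 1 - (\<Sum>\<tau>'\<in>{..\<tau>}. p l \<tau>' * Q l \<tau>')))"
    by (rule sum.cong[OF refl]) (simp add: tm)
  finally have e: "(\<Sum>T\<in>A. w T * v T) = \<dots>" .
  from weighted_exists_ge[OF fin w0 w1, of v] obtain T where T: "T \<in> A" "(\<Sum>T\<in>A. w T * v T) \<le> v T" by blast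
  have "\<forall>i<n. T i < N" using T(1) by (auto simp: A_def)
  moreover note T(2)[unfolded e, unfolded v_def]
  ultimately show ?thesis by blast
qed

section \<open>The backward-induction value of a fixed order\<close>

definition oval :: "(nat \<Rightarrow> real measure) \<Rightarrow> nat list \<Rightarrow> real" where
  "oval D is = foldr (\<lambda>i r. \<integral>x. max x r \<partial>D i) is 0"

lemma oval_simps [simp]: "oval D [] = 0" "oval D (i # is) = (\<integral>x. max x (oval D is) \<partial>D i)"
  by (simp_all add: oval_def)

text \<open>Optimal stopping beats the rule that accepts value x of item i with probability
  \<open>\<alpha> i x\<close>, since \<alpha> * x + (1 - \<alpha>) * w \<le> max x w at every stage.
  The sum undervalues that rule: items in the slot of i count as obstacles to i even when they come
  after it.\<close>

lemma oval_sorted_ge: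
  fixes T :: "nat \<Rightarrow> nat" and \<alpha> :: "nat \<Rightarrow> real \<Rightarrow> real"
  assumes D: "\<And>i. i \<in> set is \<Longrightarrow> prob_space (D i) \<and> sets (D i) = sets borel \<and> integrable (D i) (\<lambda>x. x) \<and> (AE x in D i. 0 \<le> x)"
    and \<alpha>: "\<And>i. i \<in> set is \<Longrightarrow> \<alpha> i \<in> borel_measurable borel" "\<And>i x. i \<in> set is \<Longrightarrow> 0 \<le> \<alpha> i x \<and> \<alpha> i x \<le> 1"
    and d: "distinct is" "sorted (map T is)"
  shows "(\<Sum>i\<in>set is. (\<integral>x. \<alpha> i x * x \<partial>D i) * (\<Prod>l\<in>set is - {i}. if T l \<le> T i then 1 - (\<integral>x. \<alpha> l x \<partial>D l) else 1)) \<le> oval D is"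
  using assms
proof (induction "is")
  case (Cons a ys)
  interpret Da: prob_space "D a" using Cons.prems(1)[of a] by auto
  have m: "\<alpha> a \<in> borel_measurable (D a)" "(\<lambda>x. x) \<in> borel_measurable (D a)" 
    using Cons.prems(1)[of a] Cons.prems(2)[of a] by (auto cong: measurable_cong_sets)
  have int: "integrable (D a) (\<lambda>x. x)" and nn: "AE x in D a. 0 \<le> x" using Cons.prems(1)[of a] by auto
  have i\<alpha>: "integrable (D a) (\<alpha> a)"
    using Cons.prems(3)[of a] m by (intro Da.integrable_const_bound[of _ 1]) auto
  have i\<alpha>x: "integrable (D a) (\<lambda>x. \<alpha> a x * x)"
    by (rule Bochner_Integration.integrable_bound[OF int]) 
       (use m Cons.prems(3)[of a] in \<open>auto simp: abs_mult intro!: mult_left_le_one_le\<close>)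
  define q where "q i = (\<integral>x. \<alpha> i x \<partial>D i)" for i
  define r where "r i = (\<integral>x. \<alpha> i x * x \<partial>D i)" for i
  have q01: "0 \<le> q i \<and> q i \<le> 1" and r0: "0 \<le> r i" if i: "i \<in> set (a # ys)" for i
  proof -
    interpret Di: prob_space "D i" using Cons.prems(1)[OF i] by auto
    have mi: "\<alpha> i \<in> borel_measurable (D i)" 
      using Cons.prems(1)[OF i] Cons.prems(2)[OF i] by (auto cong: measurable_cong_sets)
    have ii: "integrable (D i) (\<alpha> i)"
      using Cons.prems(3)[OF i] mi by (intro Di.integrable_const_bound[of _ 1]) auto
    have "q i \<le> (\<integral>x. 1 \<partial>D i)" unfolding q_def using Cons.prems(3)[OF i] ii by (intro integral_mono) auto
    then show "0 \<le> q i \<and> q i \<le> 1" using Cons.prems(3)[OF i] by (auto simp: q_def Di.prob_space)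
    show "0 \<le> r i" unfolding r_def using Cons.prems(1)[OF i] Cons.prems(3)[OF i] by (intro integral_nonneg_AE) auto
  qed
  define w where "w = oval D ys"
  have IH: "(\<Sum>i\<in>set ys. r i * (\<Prod>l\<in>set ys - {i}. if T l \<le> T i then 1 - q l else 1)) \<le> w"
    unfolding w_def r_def q_def using Cons.prems by (intro Cons.IH) auto
  have a: "a \<notin> set ys" and Ta: "\<And>i. i \<in> set ys \<Longrightarrow> T a \<le> T i" using Cons.prems by auto
  define X where "X = r a * (\<Prod>l\<in>set (a # ys) - {a}. if T l \<le> T a then 1 - q l else 1)"
  define Y where "Y = (\<Sum>i\<in>set ys. r i * (\<Prod>l\<in>set (a # ys) - {i}. if T l \<le> T i then 1 - q l else 1))"
  have sum: "(\<Sum>i\<in>set (a # ys). r i * (\<Prod>l\<in>set (a # ys) - {i}. if T l \<le> T i then 1 - q l else 1)) = X + Y"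
    using a by (simp add: X_def Y_def)
  \<comment> \<open>The head of the list has no predecessor; the factors of later items sharing its
    slot are bounded by 1.\<close>
  have X: "X \<le> r a * 1" unfolding X_def
    using q01 r0[of a] by (intro mult_left_mono prod_le_1) auto
  have "Y = (\<Sum>i\<in>set ys. (1 - q a) * (r i * (\<Prod>l\<in>set ys - {i}. if T l \<le> T i then 1 - q l else 1)))"
    unfolding Y_def
  proof (rule sum.cong[OF refl])
    fix i assume i: "i \<in> set ys"
    have "set (a # ys) - {i} = insert a (set ys - {i})" using a i by auto
    then show "r i * (\<Prod>l\<in>set (a # ys) - {i}. if T l \<le> T i then 1 - q l else 1)
      = (1 - q a) * (r i * (\<Prod>l\<in>set ys - {i}. if T l \<le> T i then 1 - q l else 1))"
      using a Ta[OF i] by simp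
  qed
  also have "\<dots> = (1 - q a) * (\<Sum>i\<in>set ys. r i * (\<Prod>l\<in>set ys - {i}. if T l \<le> T i then 1 - q l else 1))"
    by (rule sum_distrib_left[symmetric])
  also have "\<dots> \<le> (1 - q a) * w" using IH q01[of a] by (intro mult_left_mono) auto
  finally have "X + Y \<le> r a * 1 + (1 - q a) * w" using X by simp
  also have "r a * 1 + (1 - q a) * w = (\<integral>x. \<alpha> a x * x + (1 - \<alpha> a x) * w \<partial>D a)"
    unfolding r_def q_def using i\<alpha> i\<alpha>x by (simp add: Da.prob_space)
  also have "\<dots> \<le> (\<integral>x. max x w \<partial>D a)"
  proof (rule integral_mono)
    show "integrable (D a) (\<lambda>x. max x w)" using int by (intro Bochner_Integration.integrable_max) auto
    show "integrable (D a) (\<lambda>x. \<alpha> a x * x + (1 - \<alpha> a x) * w)" using i\<alpha> i\<alpha>x by auto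
    fix x
    have "\<alpha> a x * x \<le> \<alpha> a x * max x w" "(1 - \<alpha> a x) * w \<le> (1 - \<alpha> a x) * max x w"
      using Cons.prems(3)[of a x] by (auto intro!: mult_left_mono)
    then show "\<alpha> a x * x + (1 - \<alpha> a x) * w \<le> max x w" by (simp add: algebra_simps)
  qed
  finally show ?case unfolding sum[symmetric] w_def oval_simps unfolding r_def q_def .
qed simp

text \<open>Combines the averaging argument with optimal stopping along the sorted order, for slot
  masses that may add up to less than 1.\<close>

lemma order_exists:
  fixes p :: "nat \<Rightarrow> nat \<Rightarrow> real" and \<alpha> :: "nat \<Rightarrow> nat \<Rightarrow> real \<Rightarrow> real"
  assumes D: "\<And>i. i < n \<Longrightarrow> prob_space (D i) \<and> sets (D i) = sets borel \<and> integrable (D i) (\<lambda>x. x) \<and> (AE x in D i. 0 \<le> x)"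
    and \<alpha>: "\<And>i \<tau>. i < n \<Longrightarrow> \<alpha> i \<tau> \<in> borel_measurable borel" "\<And>i \<tau> x. i < n \<Longrightarrow> 0 \<le> \<alpha> i \<tau> x \<and> \<alpha> i \<tau> x \<le> 1"
    and p: "\<And>i \<tau>. i < n \<Longrightarrow> 0 \<le> p i \<tau>" and p1: "\<And>i. i < n \<Longrightarrow> (\<Sum>\<tau><N. p i \<tau>) \<le> 1"
  shows "\<exists>\<pi>. distinct \<pi> \<and> set \<pi> = {..<n} \<and>
    (\<Sum>i<n. \<Sum>\<tau><N. p i \<tau> * (\<integral>x. \<alpha> i \<tau> x * x \<partial>D i) * (\<Prod>l\<in>{..<n}-{i}. 1 - (\<Sum>\<tau>'\<in>{..\<tau>}. p l \<tau>' * (\<integral>x. \<alpha> l \<tau>' x \<partial>D l)))) \<le> oval D \<pi>"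
proof -
  \<comment> \<open>An additional last slot N takes the missing mass and accepts nothing. It
    contributes no reward and lies after all other slots, so it does not enter their
    products.\<close>
  define p' where "p' i \<tau> = (if \<tau> < N then p i \<tau> else 1 - (\<Sum>\<tau><N. p i \<tau>))" for i \<tau>
  define \<alpha>' where "\<alpha>' i \<tau> = (if \<tau> < N then \<alpha> i \<tau> else (\<lambda>_. 0))" for i \<tau>
  define r where "r i \<tau> = (\<integral>x. \<alpha> i \<tau> x * x \<partial>D i)" for i \<tau>
  define Q where "Q i \<tau> = (\<integral>x. \<alpha> i \<tau> x \<partial>D i)" for i \<tau>
  define r' where "r' i \<tau> = (\<integral>x. \<alpha>' i \<tau> x * x \<partial>D i)" for i \<tau>
  define Q' where "Q' i \<tau> = (\<integral>x. \<alpha>' i \<tau> x \<partial>D i)" for i \<tau>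
  have p': "0 \<le> p' i \<tau>" if "i < n" for i \<tau> using p[OF that] p1[OF that] by (simp add: p'_def)
  have p1': "(\<Sum>\<tau><Suc N. p' i \<tau>) = 1" for i by (simp add: p'_def)
  from averaging[of n p' "Suc N" r' Q', OF p' p1'] obtain T where 
    T: "(\<Sum>i<n. \<Sum>\<tau><Suc N. p' i \<tau> * r' i \<tau> * (\<Prod>l\<in>{..<n}-{i}. 1 - (\<Sum>\<tau>'\<in>{..\<tau>}. p' l \<tau>' * Q' l \<tau>')))
    \<le> (\<Sum>i<n. r' i (T i) * (\<Prod>l\<in>{..<n}-{i}. if T l \<le> T i then 1 - Q' l (T l) else 1))"
    by blast
  define \<pi> where "\<pi> = sort_key T [0..<n]"
  have \<pi>: "distinct \<pi>" "set \<pi> = {..<n}" "sorted (map T \<pi>)" by (auto simp: \<pi>_def)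
  have \<alpha>'m: "i < n \<Longrightarrow> \<alpha>' i \<tau> \<in> borel_measurable borel" "i < n \<Longrightarrow> 0 \<le> \<alpha>' i \<tau> x \<and> \<alpha>' i \<tau> x \<le> 1" for i \<tau> x
    using \<alpha> by (simp_all add: \<alpha>'_def)
  have "(\<Sum>i\<in>set \<pi>. r' i (T i) * (\<Prod>l\<in>set \<pi> - {i}. if T l \<le> T i then 1 - Q' l (T l) else 1)) \<le> oval D \<pi>"
    unfolding r'_def Q'_def
    by (rule oval_sorted_ge[where \<alpha> = "\<lambda>i. \<alpha>' i (T i)", OF D \<alpha>'m \<pi>(1,3)]) (simp_all add: \<pi>(2))
  moreover have "(\<Sum>\<tau><Suc N. p' i \<tau> * r' i \<tau> * (\<Prod>l\<in>{..<n}-{i}. 1 - (\<Sum>\<tau>'\<in>{..\<tau>}. p' l \<tau>' * Q' l \<tau>')))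
    = (\<Sum>\<tau><N. p i \<tau> * r i \<tau> * (\<Prod>l\<in>{..<n}-{i}. 1 - (\<Sum>\<tau>'\<in>{..\<tau>}. p l \<tau>' * Q l \<tau>')))" for i
  proof -
    have lt: "p' l \<tau> = p l \<tau>" "r' l \<tau> = r l \<tau>" "Q' l \<tau> = Q l \<tau>" if "\<tau> < N" for l \<tau>
      using that by (simp_all add: p'_def r'_def Q'_def r_def Q_def \<alpha>'_def)
    have "(\<Sum>\<tau>'\<in>{..\<tau>}. p' l \<tau>' * Q' l \<tau>') = (\<Sum>\<tau>'\<in>{..\<tau>}. p l \<tau>' * Q l \<tau>')" if "\<tau> < N" for \<tau> l
      using that by (intro sum.cong) (simp_all add: lt)
    moreover have "r' i N = 0" by (simp add: r'_def \<alpha>'_def)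
    ultimately show ?thesis by (simp add: lt)
  qed
  ultimately have "(\<Sum>i<n. \<Sum>\<tau><N. p i \<tau> * r i \<tau> * (\<Prod>l\<in>{..<n}-{i}. 1 - (\<Sum>\<tau>'\<in>{..\<tau>}. p l \<tau>' * Q l \<tau>'))) \<le> oval D \<pi>"
    using T by (simp only: \<pi>(2))
  then show ?thesis using \<pi>(1,2) unfolding r_def Q_def by blast
qed

section \<open>Policies with a fixed order\<close>

text \<open>The threshold is a function of the list of items still to come. The history given to
  \<open>accept\<close> already contains the current item, so the filtered list is exactly this
  tail; with \<open>th = oval D\<close> the policy is backward induction.\<close>

definition static_policy :: "nat list \<Rightarrow> (nat list \<Rightarrow> real) \<Rightarrow> policy" where
  "static_policy \<pi> th = \<lparr>pick = \<lambda>s h. hd (filter (\<lambda>i. i \<notin> fst ` set h) \<pi>),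
     accept = \<lambda>s h. th (filter (\<lambda>i. i \<notin> fst ` set h) \<pi>) \<le> snd (last h)\<rparr>"

primrec run_list :: "(nat list \<Rightarrow> real) \<Rightarrow> (nat \<Rightarrow> real) \<Rightarrow> nat list \<Rightarrow> real" where
  "run_list th v [] = 0"
| "run_list th v (i # is) = (if th is \<le> v i then v i else run_list th v is)"

lemma fst_history_of: "fst ` set (history_of is v) = set is"
  by (force simp: history_of_def)

lemma run_static_policy:
  assumes "distinct (pre @ is)" "fst ` set h = set pre" "length is = k"
  shows "run (static_policy (pre @ is) th) s v k h = run_list th v is"
  using assms
proof (induction "is" arbitrary: pre h k)
  case (Cons i "is")
  have f: "filter (\<lambda>i. i \<notin> set pre) (pre @ i # is) = i # is"
    using Cons.prems by (auto simp: filter_empty_conv intro!: filter_True)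
  have f': "filter (\<lambda>j. j \<notin> insert i (set pre)) (pre @ i # is) = is"
    using Cons.prems by (auto simp: filter_empty_conv intro!: filter_True)
  obtain k' where k: "k = Suc k'" "length is = k'" using Cons.prems by auto
  have IH: "run (static_policy (pre @ i # is) th) s v k' (h @ [(i, v i)]) = run_list th v is"
    using Cons.IH[of "pre @ [i]" "h @ [(i, v i)]" k'] Cons.prems k by simp
  have "pick (static_policy (pre @ i # is) th) s h = i"
    by (simp only: static_policy_def policy.simps f Cons.prems(2) list.sel)
  moreover have "accept (static_policy (pre @ i # is) th) s (h @ [(i, v i)]) \<longleftrightarrow> th is \<le> v i"
  proof -
    have "fst ` set (h @ [(i, v i)]) = insert i (set pre)" using Cons.prems(2) by simp
    then show ?thesis by (simp only: static_policy_def policy.simps f' last_snoc snd_conv)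
  qed
  ultimately show ?case using IH by (simp add: k Let_def)
qed simp

lemma ALG_static_policy:
  assumes "distinct \<pi>" "set \<pi> = {..<n}"
  shows "ALG n (static_policy \<pi> th) s v = run_list th v \<pi>"
proof -
  have "length \<pi> = n" using distinct_card[OF assms(1)] assms(2) by simp
  then show ?thesis unfolding ALG_def using run_static_policy[of "[]" \<pi> "[]" n] assms by simp
qed

lemma valid_static_policy:
  assumes \<pi>: "distinct \<pi>" "set \<pi> = {..<n}"
  shows "valid_policy n (static_policy \<pi> th)"
  unfolding valid_policy_def
proof (intro conjI allI impI; elim conjE)
  fix "is" :: "nat list" and s v
  assume "set is \<subset> {..<n}"
  then have "filter (\<lambda>i. i \<notin> set is) \<pi> \<noteq> []" using \<pi> by (auto simp: filter_empty_conv)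
  then have "hd (filter (\<lambda>i. i \<notin> set is) \<pi>) \<in> set (filter (\<lambda>i. i \<notin> set is) \<pi>)" by (rule hd_in_set)
  then show "pick (static_policy \<pi> th) s (history_of is v) \<in> {..<n} - set is"
    using \<pi> by (auto simp: static_policy_def fst_history_of)
next
  fix "is" :: "nat list"
  show "(\<lambda>(s, v). pick (static_policy \<pi> th) s (history_of is v))
    \<in> measurable (coin_measure \<Otimes>\<^sub>M (\<Pi>\<^sub>M i\<in>{..<n}. borel)) (count_space UNIV)"
    by (simp add: static_policy_def fst_history_of)
next
  fix "is" :: "nat list"
  assume "set is \<subseteq> {..<n}" "is \<noteq> []"
  then have [measurable]: "last is \<in> {..<n}" using last_in_set by blast
  have "snd (last (history_of is v)) = v (last is)" for v :: "nat \<Rightarrow> real"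
    using \<open>is \<noteq> []\<close> by (simp add: history_of_def last_map)
  then show "(\<lambda>(s, v). accept (static_policy \<pi> th) s (history_of is v))
    \<in> measurable (coin_measure \<Otimes>\<^sub>M (\<Pi>\<^sub>M i\<in>{..<n}. borel)) (count_space UNIV)"
    by (simp add: static_policy_def fst_history_of) measurable
qed

section \<open>Expectations over the product of the value laws\<close>

lemma prob_space_coin_measure: "prob_space coin_measure"
  unfolding coin_measure_def by (intro prob_space_PiM prob_space_uniform_measure) auto

text \<open>The laws of all indices are probability measures here, as the product theory quantifies
  over every index. An instance is padded with point masses at 0 from index n on.\<close>

locale borel_family =
  fixes D :: "nat \<Rightarrow> real measure"
  assumes prob: "\<And>i. prob_space (D i)" and sets_D [simp, measurable_cong]: "\<And>i. sets (D i) = sets borel"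
begin

sublocale product_sigma_finite D
  by (intro product_sigma_finite.intro prob_space_imp_sigma_finite prob)

lemma run_list_measurable [measurable]:
  "set is \<subseteq> I \<Longrightarrow> (\<lambda>v. run_list th v is) \<in> borel_measurable (PiM I D)"
proof (induction "is")
  case (Cons i "is")
  then have [measurable]: "i \<in> I" "(\<lambda>v. run_list th v is) \<in> borel_measurable (PiM I D)" by auto
  show ?case by simp
qed simp

lemma expected_ALG_static_policy:
  assumes "distinct \<pi>" "set \<pi> = {..<n}"
  shows "expected_ALG n D (static_policy \<pi> th) = (\<integral>\<^sup>+ v. ennreal (run_list th v \<pi>) \<partial>PiM {..<n} D)"
proof -
  interpret C: prob_space coin_measure by (rule prob_space_coin_measure)
  interpret V: prob_space "PiM {..<n} D" by (intro prob_space_PiM prob)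
  have [measurable]: "(\<lambda>v. run_list th v \<pi>) \<in> borel_measurable (PiM {..<n} D)"
    by (rule run_list_measurable) (simp add: assms)
  have "(\<integral>\<^sup>+ s. \<integral>\<^sup>+ v. (case (s, v) of (s, v) \<Rightarrow> ennreal (run_list th v \<pi>)) \<partial>PiM {..<n} D \<partial>coin_measure)
    = (\<integral>\<^sup>+ (s, v). ennreal (run_list th v \<pi>) \<partial>(coin_measure \<Otimes>\<^sub>M PiM {..<n} D))"
    by (rule V.nn_integral_fst) measurable
  then show ?thesis
    unfolding expected_ALG_def values_measure_def ALG_static_policy[OF assms] by (simp add: C.emeasure_space_1)
qed

lemma nn_integral_component:
  assumes "i \<in> I" "f \<in> borel_measurable borel"
  shows "(\<integral>\<^sup>+ v. f (v i) \<partial>PiM I D) = (\<integral>\<^sup>+ x. f x \<partial>D i)"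
proof -
  have "(\<integral>\<^sup>+ x. f x \<partial>D i) = (\<integral>\<^sup>+ x. f x \<partial>distr (PiM I D) (D i) (\<lambda>\<omega>. \<omega> i))"
    using assms by (subst distr_PiM_component) (auto intro: prob)
  also have "\<dots> = (\<integral>\<^sup>+ v. f (v i) \<partial>PiM I D)"
    using assms by (intro nn_integral_distr) auto
  finally show ?thesis by simp
qed

lemma oval_nonneg:
  assumes "\<And>i. i \<in> set is \<Longrightarrow> AE x in D i. 0 \<le> x"
  shows "0 \<le> oval D is"
proof (cases "is")
  case (Cons i js)
  have "AE x in D i. 0 \<le> max x (oval D js)" using assms[of i] Cons by (auto simp: le_max_iff_disj)
  then show ?thesis unfolding Cons oval_simps by (rule integral_nonneg_AE)
qed simp

text \<open>Integrate the value y of the head last: if it reaches the threshold w it is taken,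
  otherwise the tail yields at least w on average by induction. Either way the inner integral is at
  least max y w.\<close>

lemma run_list_oval:
  assumes "distinct is" "\<And>i. i \<in> set is \<Longrightarrow> integrable (D i) (\<lambda>x. x)" "\<And>i. i \<in> set is \<Longrightarrow> AE x in D i. 0 \<le> x"
  shows "ennreal (oval D is) \<le> (\<integral>\<^sup>+ v. ennreal (run_list (oval D) v is) \<partial>PiM (set is) D)"
  using assms
proof (induction "is")
  case (Cons i "is")
  interpret I: prob_space "PiM (set is) D" by (intro prob_space_PiM prob)
  interpret Di: prob_space "D i" by (rule prob)
  define w where "w = oval D is"
  have w: "0 \<le> w" unfolding w_def by (rule oval_nonneg) (use Cons.prems in auto)
  have IH: "ennreal w \<le> (\<integral>\<^sup>+ v. ennreal (run_list (oval D) v is) \<partial>PiM (set is) D)"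
    unfolding w_def using Cons by auto
  have upd: "set js \<subseteq> set is \<Longrightarrow> run_list (oval D) (x(i := y)) js = run_list (oval D) x js" for x y js
    using Cons.prems(1) by (induction js) auto
  have int: "integrable (D i) (\<lambda>x. max x w)" 
    using Cons.prems by (intro Bochner_Integration.integrable_max) auto
  have "ennreal (oval D (i # is)) = (\<integral>\<^sup>+ y. ennreal (max y w) \<partial>D i)"
    unfolding oval_simps w_def[symmetric] using w
    by (intro nn_integral_eq_integral[symmetric] int) auto
  also have "\<dots> \<le> (\<integral>\<^sup>+ y. \<integral>\<^sup>+ x. ennreal (run_list (oval D) (x(i := y)) (i # is)) \<partial>PiM (set is) D \<partial>D i)"
  proof (rule nn_integral_mono)
    fix y
    show "ennreal (max y w) \<le> (\<integral>\<^sup>+ x. ennreal (run_list (oval D) (x(i := y)) (i # is)) \<partial>PiM (set is) D)"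
      using IH by (cases "w \<le> y") (simp_all add: w_def[symmetric] upd I.emeasure_space_1 max_def)
  qed
  also have "\<dots> = (\<integral>\<^sup>+ v. ennreal (run_list (oval D) v (i # is)) \<partial>PiM (insert i (set is)) D)"
    using Cons.prems(1) by (intro product_nn_integral_insert_rev[symmetric] measurable_compose[OF run_list_measurable measurable_ennreal]) auto
  finally show ?case by simp
qed simp

text \<open>Layer-cake estimate on a grid of width h: the maximum is at most h, plus h for every
  grid point k * h with k \<le> M that it reaches, plus its overflow beyond M * h, which is at most
  the sum of the overflows of all items. \<open>E k\<close> is the event that some value reaches k *
  h.\<close>

lemma expected_max_le:
  assumes h: "0 < h" and n: "0 < n"
    and D: "\<And>i. i < n \<Longrightarrow> integrable (D i) (\<lambda>x. x)"
  shows "expected_max n D \<le> ennreal (h + (\<Sum>k\<in>{1..M}. h * (1 - (\<Prod>i<n. 1 - measure (D i) {real k * h..})))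
    + (\<Sum>i<n. \<integral>x. max (x - real M * h) 0 \<partial>D i))"
proof -
  interpret V: prob_space "PiM {..<n} D" by (intro prob_space_PiM prob)
  define E where "E k = space (PiM {..<n} D) - (\<Pi>\<^sub>E i\<in>{..<n}. {..<real k * h})" for k
  have Em: "(\<Pi>\<^sub>E i\<in>{..<n}. {..<real k * h}) \<in> sets (PiM {..<n} D)" for k
    by (intro sets_PiM_I_finite) auto
  have [measurable]: "E k \<in> sets (PiM {..<n} D)" for k unfolding E_def using Em by auto
  have Eprob: "emeasure (PiM {..<n} D) (E k) = ennreal (1 - (\<Prod>i<n. 1 - measure (D i) {real k * h..}))" for k
  proof -
    have "measure (D i) {..<c} = 1 - measure (D i) {c..}" for i c
    proof -
      interpret Di: prob_space "D i" by (rule prob)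
      have "{..<c} = space (D i) - {c..}" using sets_eq_imp_space_eq[OF sets_D] by auto
      then show ?thesis using Di.prob_compl[of "{c..}"] by simp
    qed
    moreover have "emeasure (PiM {..<n} D) (\<Pi>\<^sub>E i\<in>{..<n}. {..<real k * h}) = (\<Prod>i<n. emeasure (D i) {..<real k * h})"
      by (rule emeasure_PiM) auto
    moreover have "emeasure (D i) {..<real k * h} = ennreal (measure (D i) {..<real k * h})" for i
    proof -
      interpret Di: prob_space "D i" by (rule prob)
      show ?thesis by (rule Di.emeasure_eq_measure)
    qed
    ultimately have "measure (PiM {..<n} D) (\<Pi>\<^sub>E i\<in>{..<n}. {..<real k * h}) = (\<Prod>i<n. 1 - measure (D i) {real k * h..})"
      by (simp add: V.emeasure_eq_measure prod_ennreal prob_space.prob_le_1[OF prob] prod_nonneg)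
    then show ?thesis unfolding E_def V.emeasure_eq_measure using V.prob_compl[OF Em] by simp
  qed
  \<comment> \<open>Rounding down to the grid loses at most h below M * h; above, the overshoot is
    kept in full.\<close>
  have steps: "m \<le> (\<Sum>k\<in>{1..M}. if real k * h \<le> m then h else 0) + max (m - real M * h) h" for m M
  proof (induction M)
    case (Suc M)
    have "(real M + 1) * h = real M * h + h" by (simp add: algebra_simps)
    then show ?case using Suc h by (auto simp: max_def algebra_simps split: if_splits)
  qed simp
  have pw: "ennreal (Max (v ` {..<n})) \<le> ennreal h + (\<Sum>k\<in>{1..M}. ennreal h * indicator (E k) v)
      + (\<Sum>i<n. ennreal (max (v i - real M * h) 0))" if v: "v \<in> space (PiM {..<n} D)" for v
  proof -
    have "v ` {..<n} \<noteq> {}" using n by auto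
    then have "Max (v ` {..<n}) \<in> v ` {..<n}" by (intro Max_in) auto
    then obtain i where i: "i < n" "Max (v ` {..<n}) = v i" by auto
    have ind: "(if real k * h \<le> v i then h else 0) \<le> h * indicator (E k) v" for k
      using v i h by (auto simp: E_def PiE_iff indicator_def not_less[symmetric])
    have "v i \<le> (\<Sum>k\<in>{1..M}. if real k * h \<le> v i then h else 0) + max (v i - real M * h) h" by (rule steps)
    also have "\<dots> \<le> (\<Sum>k\<in>{1..M}. h * indicator (E k) v) + (h + max (v i - real M * h) 0)"
      using h by (intro add_mono sum_mono ind) auto
    also have "max (v i - real M * h) 0 \<le> (\<Sum>i<n. max (v i - real M * h) 0)"
      using i by (intro member_le_sum) auto
    finally have "v i \<le> h + (\<Sum>k\<in>{1..M}. h * indicator (E k) v) + (\<Sum>i<n. max (v i - real M * h) 0)" by simp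
    then have "ennreal (v i) \<le> ennreal (h + (\<Sum>k\<in>{1..M}. h * indicator (E k) v) + (\<Sum>i<n. max (v i - real M * h) 0))"
      by (rule ennreal_leI)
    also have "\<dots> = ennreal h + (\<Sum>k\<in>{1..M}. ennreal h * indicator (E k) v) + (\<Sum>i<n. ennreal (max (v i - real M * h) 0))"
    proof -
      have "ennreal (\<Sum>k\<in>{1..M}. h * indicator (E k) v) = (\<Sum>k\<in>{1..M}. ennreal (h * indicator (E k) v))"
        using h by (intro sum_ennreal[symmetric]) auto
      also have "\<dots> = (\<Sum>k\<in>{1..M}. ennreal h * indicator (E k) v)"
        using h by (intro sum.cong refl) (simp add: ennreal_mult ennreal_indicator)
      finally have e: "ennreal (\<Sum>k\<in>{1..M}. h * indicator (E k) v) = (\<Sum>k\<in>{1..M}. ennreal h * indicator (E k) v)" .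
      have nn: "0 \<le> (\<Sum>k\<in>{1..M}. h * indicator (E k) v)" "0 \<le> (\<Sum>i<n. max (v i - real M * h) 0)"
        using h by (auto intro!: sum_nonneg simp: indicator_def)
      have "(\<Sum>i<n. ennreal (max (v i - real M * h) 0)) = ennreal (\<Sum>i<n. max (v i - real M * h) 0)"
        by (rule sum_ennreal) auto
      then show ?thesis unfolding e[symmetric] using nn h by (simp only: ennreal_plus add_nonneg_nonneg less_imp_le)
    qed
    finally show ?thesis unfolding i .
  qed
  have A: "expected_max n D \<le> (\<integral>\<^sup>+ v. ennreal h + (\<Sum>k\<in>{1..M}. ennreal h * indicator (E k) v)
      + (\<Sum>i<n. ennreal (max (v i - real M * h) 0)) \<partial>PiM {..<n} D)"
    unfolding expected_max_def values_measure_def by (intro nn_integral_mono pw)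
  have B: "(\<integral>\<^sup>+ v. ennreal h + (\<Sum>k\<in>{1..M}. ennreal h * indicator (E k) v)
      + (\<Sum>i<n. ennreal (max (v i - real M * h) 0)) \<partial>PiM {..<n} D) = ennreal h + (\<Sum>k\<in>{1..M}. ennreal h * emeasure (PiM {..<n} D) (E k))
      + (\<Sum>i<n. \<integral>\<^sup>+ v. ennreal (max (v i - real M * h) 0) \<partial>PiM {..<n} D)"
  proof -
    have "(\<integral>\<^sup>+ v. (\<Sum>k\<in>{1..M}. ennreal h * indicator (E k) v) \<partial>PiM {..<n} D) = (\<Sum>k\<in>{1..M}. ennreal h * emeasure (PiM {..<n} D) (E k))"
      by (subst nn_integral_sum, measurable) (intro sum.cong refl nn_integral_cmult_indicator, measurable)
    moreover have "(\<integral>\<^sup>+ v. (\<Sum>i<n. ennreal (max (v i - real M * h) 0)) \<partial>PiM {..<n} D) = (\<Sum>i<n. \<integral>\<^sup>+ v. ennreal (max (v i - real M * h) 0) \<partial>PiM {..<n} D)"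
      by (rule nn_integral_sum) measurable
    moreover have "(\<integral>\<^sup>+ v. ennreal h \<partial>PiM {..<n} D) = ennreal h" by (simp add: V.emeasure_space_1)
    moreover have "(\<lambda>v. \<Sum>k\<in>{1..M}. ennreal h * indicator (E k) v) \<in> borel_measurable (PiM {..<n} D)"
      "(\<lambda>v. \<Sum>i<n. ennreal (max (v i - real M * h) 0)) \<in> borel_measurable (PiM {..<n} D)" by measurable
    ultimately show ?thesis by (simp only: nn_integral_add borel_measurable_const borel_measurable_add)
  qed
  have C: "(\<Sum>i<n. \<integral>\<^sup>+ v. ennreal (max (v i - real M * h) 0) \<partial>PiM {..<n} D)
    = (\<Sum>i<n. ennreal (\<integral>x. max (x - real M * h) 0 \<partial>D i))"
  proof (rule sum.cong[OF refl])
    fix i assume i: "i \<in> {..<n}"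
    interpret Di: prob_space "D i" by (rule prob)
    have "(\<integral>\<^sup>+ v. ennreal (max (v i - real M * h) 0) \<partial>PiM {..<n} D) = (\<integral>\<^sup>+ x. ennreal (max (x - real M * h) 0) \<partial>D i)"
      using i by (intro nn_integral_component) auto
    also have "\<dots> = ennreal (\<integral>x. max (x - real M * h) 0 \<partial>D i)"
      using D i by (intro nn_integral_eq_integral) auto
    finally show "(\<integral>\<^sup>+ v. ennreal (max (v i - real M * h) 0) \<partial>PiM {..<n} D) = ennreal (\<integral>x. max (x - real M * h) 0 \<partial>D i)" .
  qed
  have F: "ennreal h + (\<Sum>k\<in>{1..M}. ennreal h * emeasure (PiM {..<n} D) (E k)) + (\<Sum>i<n. ennreal (\<integral>x. max (x - real M * h) 0 \<partial>D i))
    = ennreal (h + (\<Sum>k\<in>{1..M}. h * (1 - (\<Prod>i<n. 1 - measure (D i) {real k * h..}))) + (\<Sum>i<n. \<integral>x. max (x - real M * h) 0 \<partial>D i))"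
  proof -
    have p: "0 \<le> 1 - (\<Prod>i<n. 1 - measure (D i) {real k * h..})" for k
      by (simp add: prod_le_1 prob_space.prob_le_1[OF prob])
    have "0 \<le> (\<integral>x. max (x - real M * h) 0 \<partial>D i)" for i by (intro integral_nonneg_AE) auto
    then have b: "(\<Sum>i<n. ennreal (\<integral>x. max (x - real M * h) 0 \<partial>D i)) = ennreal (\<Sum>i<n. \<integral>x. max (x - real M * h) 0 \<partial>D i)"
      and nn: "0 \<le> (\<Sum>i<n. \<integral>x. max (x - real M * h) 0 \<partial>D i)"
      by (auto intro: sum_ennreal sum_nonneg)
    have e: "ennreal h * emeasure (PiM {..<n} D) (E k) = ennreal (h * (1 - (\<Prod>i<n. 1 - measure (D i) {real k * h..})))" for k
      unfolding Eprob using h p[of k] by (intro ennreal_mult[symmetric]) auto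
    have hp: "0 \<le> h * (1 - (\<Prod>i<n. 1 - measure (D i) {real k * h..}))" for k
      using h p[of k] by (intro mult_nonneg_nonneg) auto
    have c: "(\<Sum>k\<in>{1..M}. ennreal h * emeasure (PiM {..<n} D) (E k)) = ennreal (\<Sum>k\<in>{1..M}. h * (1 - (\<Prod>i<n. 1 - measure (D i) {real k * h..})))"
      unfolding e using hp by (rule sum_ennreal)
    have "0 \<le> (\<Sum>k\<in>{1..M}. h * (1 - (\<Prod>i<n. 1 - measure (D i) {real k * h..})))" using hp by (rule sum_nonneg)
    then show ?thesis unfolding b c using nn h by (simp only: ennreal_plus add_nonneg_nonneg less_imp_le)
  qed
  show ?thesis using A unfolding B C F .
qed

end

text \<open>There are finitely many orders, so a loss of arbitrarily small \<epsilon> is no loss: if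
  every order fell short, the least of their gaps would contradict the assumption. Infinite means
  are treated apart, because then a single item already gives infinite reward.\<close>

theorem competitiveI:
  assumes *: "\<And>n D \<epsilon>. os_instance n D \<Longrightarrow> (\<And>i. i < n \<Longrightarrow> integrable (D i) (\<lambda>x. x)) \<Longrightarrow> 0 < \<epsilon> \<Longrightarrow>
    \<exists>\<pi>. distinct \<pi> \<and> set \<pi> = {..<n} \<and> ennreal \<Gamma> * expected_max n D \<le> ennreal (oval D \<pi> + \<epsilon>)"
    and \<Gamma>: "0 \<le> \<Gamma>"
  shows "\<exists>A. os_algorithm A \<and> competitive \<Gamma> A"
proof -
  have "\<exists>P. valid_policy n P \<and> ennreal \<Gamma> * expected_max n D \<le> expected_ALG n D P" if nD: "os_instance n D" for n D
  proof -
    define D' where "D' i = (if i < n then D i else return borel 0)" for i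
    have D: "prob_space (D i)" "sets (D i) = sets borel" "AE x in D i. 0 \<le> x" if "i < n" for i
      using nD that by (auto simp: os_instance_def)
    interpret borel_family D'
    proof (rule borel_family.intro)
      show "prob_space (D' i)" for i by (cases "i < n") (simp_all add: D'_def D prob_space_return)
      show "sets (D' i) = sets borel" for i by (cases "i < n") (simp_all add: D'_def D)
    qed
    have v: "values_measure n D = values_measure n D'"
      unfolding values_measure_def by (rule PiM_cong) (simp_all add: D'_def)
    have a: "expected_ALG n D P = expected_ALG n D' P" for P by (simp add: expected_ALG_def v)
    show ?thesis
    proof (cases "\<forall>i<n. integrable (D i) (\<lambda>x. x)")
      case True
      have "\<exists>\<pi>. distinct \<pi> \<and> set \<pi> = {..<n} \<and> ennreal \<Gamma> * expected_max n D \<le> ennreal (oval D \<pi>)"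
      proof (rule ccontr)
        assume N: "\<not> ?thesis"
        define orders where "orders = {\<pi>. distinct \<pi> \<and> set \<pi> = {..<n}}"
        have "finite {\<pi>. set \<pi> \<subseteq> {..<n} \<and> length \<pi> \<le> n}" by (rule finite_lists_length_le) simp
        moreover have "length \<pi> \<le> n" if "distinct \<pi>" "set \<pi> = {..<n}" for \<pi>
          using distinct_card[OF that(1)] that(2) by simp
        ultimately have fin: "finite orders" unfolding orders_def by - (erule rev_finite_subset, auto)
        have lt: "ennreal (oval D \<pi>) < ennreal \<Gamma> * expected_max n D" if "\<pi> \<in> orders" for \<pi>
          using N that by (auto simp: orders_def not_le)
        have "\<exists>\<delta>>0. ennreal (oval D \<pi> + \<delta>) < ennreal \<Gamma> * expected_max n D" if "\<pi> \<in> orders" for \<pi>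
        proof -
          have "((\<lambda>\<delta>. ennreal (oval D \<pi> + \<delta>)) \<longlongrightarrow> ennreal (oval D \<pi> + 0)) (at_right 0)"
            by (intro tendsto_ennrealI tendsto_intros)
          then have "\<forall>\<^sub>F \<delta> in at_right 0. ennreal (oval D \<pi> + \<delta>) < ennreal \<Gamma> * expected_max n D"
            by (rule order_tendstoD(2)) (use lt[OF that] in simp)
          then have "\<forall>\<^sub>F \<delta> in at_right (0::real). 0 < \<delta> \<and> ennreal (oval D \<pi> + \<delta>) < ennreal \<Gamma> * expected_max n D"
            using eventually_at_right_less by (rule eventually_conj[rotated])
          then show ?thesis using eventually_happens'[OF trivial_limit_at_right_real] by blast
        qed
        then obtain \<delta> where \<delta>: "\<And>\<pi>. \<pi> \<in> orders \<Longrightarrow> 0 < \<delta> \<pi> \<and> ennreal (oval D \<pi> + \<delta> \<pi>) < ennreal \<Gamma> * expected_max n D"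
          by metis
        define \<epsilon> where "\<epsilon> = Min (insert 1 (\<delta> ` orders))"
        have "0 < \<epsilon>" unfolding \<epsilon>_def using fin \<delta> by (subst Min_gr_iff) auto
        from *[OF nD _ this] True obtain \<pi> where \<pi>: "\<pi> \<in> orders" "ennreal \<Gamma> * expected_max n D \<le> ennreal (oval D \<pi> + \<epsilon>)"
          unfolding orders_def by blast
        have "\<epsilon> \<le> \<delta> \<pi>" unfolding \<epsilon>_def using fin \<pi> by (intro Min_le) auto
        then have "ennreal (oval D \<pi> + \<epsilon>) \<le> ennreal (oval D \<pi> + \<delta> \<pi>)" by (intro ennreal_leI) auto
        then show False using \<pi> \<delta>[OF \<pi>(1)] by (meson leD le_less_trans less_le_trans)
      qed
      then obtain \<pi> where \<pi>: "distinct \<pi>" "set \<pi> = {..<n}" "ennreal \<Gamma> * expected_max n D \<le> ennreal (oval D \<pi>)" by blast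
      have "set js \<subseteq> {..<n} \<Longrightarrow> oval D js = oval D' js" for js by (induction js) (auto simp: D'_def)
      moreover have D': "D' i = D i" if "i < n" for i using that by (simp add: D'_def)
      moreover have D'': "AE x in D' i. 0 \<le> x" if "i < n" for i unfolding D'[OF that] by (rule D(3)[OF that])
      ultimately have "ennreal (oval D \<pi>) = ennreal (oval D' \<pi>)" using \<pi>(2) by simp
      also have "\<dots> \<le> expected_ALG n D (static_policy \<pi> (oval D'))"
        unfolding a expected_ALG_static_policy[OF \<pi>(1,2)] \<pi>(2)[symmetric]
        by (rule run_list_oval) (use \<pi>(1,2) True D'' in \<open>simp_all add: D'\<close>)
      finally show ?thesis using valid_static_policy[OF \<pi>(1,2)] \<pi>(3) by (meson order_trans)
    next
      case False
      then obtain i where i: "i < n" "\<not> integrable (D i) (\<lambda>x. x)" by auto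
      have top: "(\<integral>\<^sup>+ x. ennreal x \<partial>D i) = \<infinity>"
      proof (rule ccontr)
        assume "(\<integral>\<^sup>+ x. ennreal x \<partial>D i) \<noteq> \<infinity>"
        then have "integrable (D i) (\<lambda>x. x)"
          using D[OF i(1)] by (intro integrableI_nonneg) (auto simp: less_top cong: measurable_cong_sets)
        then show False using i by simp
      qed
      \<comment> \<open>The item with infinite mean comes first and meets threshold 0. A negative
        value counts as 0 in \<open>ennreal\<close>, so the reward dominates its value whether or
        not it is accepted.\<close>
      define \<pi> where "\<pi> = i # filter (\<lambda>j. j \<noteq> i) [0..<n]"
      have \<pi>: "distinct \<pi>" "set \<pi> = {..<n}" using i by (auto simp: \<pi>_def)
      have "\<infinity> = (\<integral>\<^sup>+ x. ennreal x \<partial>D' i)" using top i by (simp add: D'_def)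
      also have "\<dots> = (\<integral>\<^sup>+ v. ennreal (v i) \<partial>PiM {..<n} D')"
        using i by (intro nn_integral_component[symmetric]) auto
      also have "\<dots> \<le> (\<integral>\<^sup>+ v. ennreal (run_list (\<lambda>_. 0) v \<pi>) \<partial>PiM {..<n} D')"
        by (intro nn_integral_mono) (auto simp: \<pi>_def ennreal_neg)
      also have "\<dots> = expected_ALG n D (static_policy \<pi> (\<lambda>_. 0))"
        unfolding a expected_ALG_static_policy[OF \<pi>] ..
      finally have "expected_ALG n D (static_policy \<pi> (\<lambda>_. 0)) = \<infinity>" by (simp add: top_unique)
      then show ?thesis using valid_static_policy[OF \<pi>] by (intro exI[of _ "static_policy \<pi> (\<lambda>_. 0)"]) auto
    qed
  qed
  then obtain A where A: "\<And>n D. os_instance n D \<Longrightarrow> valid_policy n (A n D) \<and> ennreal \<Gamma> * expected_max n D \<le> expected_ALG n D (A n D)"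
    by metis
  then show ?thesis unfolding os_algorithm_def competitive_def by (intro exI[of _ A]) auto
qed

section \<open>Continuous-time designs\<close>

text \<open>Item i arrives at an opening moment with probability \<open>c i\<close>, during [0, 1]
  with density \<open>f i\<close>, and at a closing moment with probability \<open>d i\<close>. The
  acceptance level is a at the opening, \<open>\<sigma> t\<close> at time t and 1 at the closing.
  The atoms and a clock \<sigma> that may rest serve the exceptional item.\<close>

definition fluid_design :: "nat \<Rightarrow> (nat \<Rightarrow> real) \<Rightarrow> (nat \<Rightarrow> real \<Rightarrow> real) \<Rightarrow> (nat \<Rightarrow> real) \<Rightarrow> (real \<Rightarrow> real) \<Rightarrow> real \<Rightarrow> bool" where
  "fluid_design n c f d \<sigma> a \<longleftrightarrow>
     (\<forall>i<n. 0 \<le> c i \<and> 0 \<le> d i \<and> continuous_on {0..1} (f i) \<and> (\<forall>t. 0 \<le> f i t) \<and> c i + integral {0..1} (f i) + d i \<le> 1) \<and>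
     continuous_on {0..1} \<sigma> \<and> (\<forall>s t. 0 \<le> s \<longrightarrow> s \<le> t \<longrightarrow> t \<le> 1 \<longrightarrow> \<sigma> s \<le> \<sigma> t) \<and>
     (\<forall>t. 0 \<le> t \<longrightarrow> t \<le> 1 \<longrightarrow> 0 \<le> \<sigma> t \<and> \<sigma> t \<le> 1) \<and> 0 \<le> a \<and> a \<le> 1"

text \<open>A lower estimate for the chance of selling a value above level s. An item offered at
  level u is accepted with a value above level s with probability \<open>q i (min u s)\<close>; the
  product is the chance that no other item has been sold, simultaneous arrivals in an atom counting
  as earlier ones.\<close>

definition fluid_reward :: "nat \<Rightarrow> (nat \<Rightarrow> real \<Rightarrow> real) \<Rightarrow> (nat \<Rightarrow> real) \<Rightarrow> (nat \<Rightarrow> real \<Rightarrow> real) \<Rightarrow> (nat \<Rightarrow> real) \<Rightarrow> (real \<Rightarrow> real) \<Rightarrow> real \<Rightarrow> real \<Rightarrow> real" where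
  "fluid_reward n q c f d \<sigma> a s = (\<Sum>i<n.
     c i * q i (min a s) * (\<Prod>l\<in>{..<n}-{i}. 1 - c l * q l a)
     + integral {0..1} (\<lambda>t. f i t * (q i (min (\<sigma> t) s)
         * (\<Prod>l\<in>{..<n}-{i}. 1 - c l * q l a - integral {0..t} (\<lambda>x. q l (\<sigma> x) * f l x))))
     + d i * q i s * (\<Prod>l\<in>{..<n}-{i}. 1 - c l * q l a - integral {0..1} (\<lambda>x. q l (\<sigma> x) * f l x) - d l * q l 1))"

section \<open>A continuously differentiable ramp\<close>

lemma pos_part_square_deriv: "((\<lambda>u. (max 0 u)^2) has_real_derivative 2 * max 0 u) (at (u::real))"
proof -
  consider "u < 0" | "u = 0" | "0 < u" by linarith
  then show ?thesis
  proof cases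
    case 1
    have "((\<lambda>u. (max 0 u)^2) has_real_derivative 0) (at u)"
      by (rule has_field_derivative_transform_within_open[where S = "{..<0}" and f = "\<lambda>_. 0"]) (use 1 in auto)
    then show ?thesis using 1 by simp
  next
    case 2
    have "((\<lambda>u::real. (max 0 u)^2) has_real_derivative 0) (at 0)"
      unfolding CARAT_DERIV
    proof (intro exI[of _ "\<lambda>u::real. max 0 u"] conjI allI)
      show "isCont (\<lambda>u::real. max 0 u) 0" by (intro continuous_intros)
    qed (auto simp: power2_eq_square max_def)
    then show ?thesis using 2 by simp
  next
    case 3
    have "((\<lambda>u. u^2) has_real_derivative 2 * u) (at u)" by (auto intro!: derivative_eq_intros)
    then have "((\<lambda>u. (max 0 u)^2) has_real_derivative 2 * u) (at u)"
      by (rule has_field_derivative_transform_within_open[where S = "{0<..}"]) (use 3 in auto)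
    then show ?thesis using 3 by simp
  qed
qed

text \<open>Two parabolic arcs leading from 0 to 1 on [0, 1]; the derivative is the tent of height
  2. Arrival densities are built from derivatives of acceptance paths and must be continuous, which
  a piecewise linear path would not provide.\<close>

definition smooth :: "real \<Rightarrow> real" where
  "smooth u = 2 * (max 0 u)^2 - 4 * (max 0 (u - 1/2))^2 + 2 * (max 0 (u - 1))^2"

definition smooth' :: "real \<Rightarrow> real" where
  "smooth' u = 4 * max 0 u - 8 * max 0 (u - 1/2) + 4 * max 0 (u - 1)"

lemma smooth_deriv: "(smooth has_real_derivative smooth' u) (at u)"
proof -
  have sh: "((\<lambda>u. (max 0 (u - c))^2) has_real_derivative 2 * max 0 (u - c)) (at u)" for c
  proof -
    have "((\<lambda>u. u - c) has_real_derivative 1) (at u)" by (auto intro!: derivative_eq_intros)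
    from DERIV_chain2[where f = "\<lambda>u. (max 0 u)^2" and g = "\<lambda>u. u - c", OF pos_part_square_deriv this] show ?thesis by simp
  qed
  have "(smooth has_real_derivative 2 * (2 * max 0 u) - 4 * (2 * max 0 (u - 1/2)) + 2 * (2 * max 0 (u - 1))) (at u)"
    unfolding smooth_def[abs_def] by (intro DERIV_add DERIV_diff DERIV_cmult sh pos_part_square_deriv)
  then show ?thesis by (rule DERIV_cong) (simp add: smooth'_def)
qed

lemma smooth'_nonneg: "0 \<le> smooth' u" by (simp add: smooth'_def max_def)

lemma smooth'_cont: "continuous_on A smooth'"
  unfolding smooth'_def[abs_def] by (intro continuous_intros)

lemma smooth_cont: "continuous_on A smooth"
  by (intro continuous_at_imp_continuous_on ballI DERIV_isCont[OF smooth_deriv])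

lemma smooth_mono: "u \<le> v \<Longrightarrow> smooth u \<le> smooth v"
  by (rule DERIV_nonneg_imp_nondecreasing[where f = smooth]) (use smooth_deriv smooth'_nonneg in blast)+

lemma smooth_0 [simp]: "u \<le> 0 \<Longrightarrow> smooth u = 0" by (simp add: smooth_def max_def)

lemma smooth_1 [simp]: "1 \<le> u \<Longrightarrow> smooth u = 1"
  by (simp add: smooth_def max_def power2_eq_square field_simps)

lemma smooth01: "0 \<le> smooth u" "smooth u \<le> 1"
  using smooth_mono[of "min u 0" u] smooth_mono[of u "max u 1"] by auto

section \<open>From densities to finitely many time slots\<close>

text \<open>Compares two integrals cell by cell, with a factor K that is constant on each cell.
  Applied to negated integrands it gives the reverse estimate.\<close>

lemma cell_sum:
  fixes F g :: "real \<Rightarrow> real"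
  assumes F: "continuous_on {0..1} F" and g: "continuous_on {0..1} g" and N: "0 < N"
    and le: "\<And>\<tau> t. \<tau> < N \<Longrightarrow> real \<tau> / real N \<le> t \<Longrightarrow> t \<le> real (Suc \<tau>) / real N \<Longrightarrow> g t \<le> K \<tau> * F t"
    and m: "m \<le> N"
  shows "integral {0..real m / real N} g \<le> (\<Sum>\<tau><m. K \<tau> * integral {real \<tau> / real N..real (Suc \<tau>) / real N} F)"
  using m
proof (induction m)
  case (Suc m)
  define x where "x = real m / real N"
  define y where "y = real (Suc m) / real N"
  have xy: "0 \<le> x" "x \<le> y" "y \<le> 1" using Suc.prems N by (auto simp: x_def y_def divide_right_mono)
  have ig: "g integrable_on {0..y}" "g integrable_on {x..y}" "F integrable_on {x..y}"
    using xy by (auto intro!: integrable_continuous_interval intro: continuous_on_subset[OF g] continuous_on_subset[OF F])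
  have "integral {0..y} g = integral {0..x} g + integral {x..y} g"
    using Henstock_Kurzweil_Integration.integral_combine[OF xy(1,2) ig(1)] by simp
  also have "integral {x..y} g \<le> integral {x..y} (\<lambda>t. K m * F t)"
  proof (rule integral_le)
    show "(\<lambda>t. K m * F t) integrable_on {x..y}" using ig(3) integrable_on_cmult_left[of F "{x..y}" "K m"] by simp
    fix t assume t: "t \<in> {x..y}"
    show "g t \<le> K m * F t" by (rule le) (use Suc.prems t in \<open>simp_all add: x_def y_def\<close>)
  qed (rule ig)
  also have "integral {x..y} (\<lambda>t. K m * F t) = K m * integral {x..y} F" by simp
  also have "integral {0..x} g \<le> (\<Sum>\<tau><m. K \<tau> * integral {real \<tau> / real N..real (Suc \<tau>) / real N} F)"
    unfolding x_def using Suc by simp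
  finally show ?case unfolding sum.lessThan_Suc x_def y_def by simp
qed simp

text \<open>Slot 0 is the opening, the middle slots are cells of the clock, the last slot is the
  closing. Each cell uses the level at its left end: by monotonicity it then sells at most the
  integral over the cell, so the chances of being unsold do not drop below their fluid values. The
  loss comes from the lower level of the offer and from taking the product at the right end, and
  uniform continuity makes it small.\<close>

lemma discretize:
  fixes q f :: "nat \<Rightarrow> real \<Rightarrow> real" and tk :: "'k \<Rightarrow> real"
  assumes q: "\<And>i. i < n \<Longrightarrow> continuous_on {0..1} (q i)"
    and mono: "\<And>i s t. i < n \<Longrightarrow> 0 \<le> s \<Longrightarrow> s \<le> t \<Longrightarrow> t \<le> 1 \<Longrightarrow> q i s \<le> q i t"
    and q01: "\<And>i t. i < n \<Longrightarrow> 0 \<le> q i t \<and> q i t \<le> 1"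
    and des: "fluid_design n c f d \<sigma> a"
    and K: "finite K" "\<And>k. k \<in> K \<Longrightarrow> 0 \<le> tk k \<and> tk k \<le> 1" and \<epsilon>: "0 < \<epsilon>"
  shows "\<exists>(N::nat) p s. (\<forall>i<n. (\<forall>\<tau>. 0 \<le> p i \<tau>) \<and> (\<Sum>\<tau><N. p i \<tau>) \<le> 1) \<and> (\<forall>\<tau>. 0 \<le> s \<tau> \<and> s \<tau> \<le> 1) \<and>
    (\<forall>k\<in>K. fluid_reward n q c f d \<sigma> a (tk k) - \<epsilon> \<le>
      (\<Sum>i<n. \<Sum>\<tau><N. p i \<tau> * q i (min (s \<tau>) (tk k)) * (\<Prod>l\<in>{..<n}-{i}. 1 - (\<Sum>\<tau>'\<in>{..\<tau>}. p l \<tau>' * q l (s \<tau>')))))"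
proof -
  have cd: "0 \<le> c i" "0 \<le> d i" "continuous_on {0..1} (f i)" "\<And>t. 0 \<le> f i t" "c i + integral {0..1} (f i) + d i \<le> 1" if "i < n" for i
    using des that unfolding fluid_design_def by blast+
  have \<sigma>: "continuous_on {0..1} \<sigma>" "\<And>s t. 0 \<le> s \<Longrightarrow> s \<le> t \<Longrightarrow> t \<le> 1 \<Longrightarrow> \<sigma> s \<le> \<sigma> t" "\<And>t. 0 \<le> t \<Longrightarrow> t \<le> 1 \<Longrightarrow> 0 \<le> \<sigma> t \<and> \<sigma> t \<le> 1"
    and a: "0 \<le> a" "a \<le> 1" using des unfolding fluid_design_def by blast+
  define u where "u i k t = q i (min (\<sigma> t) (tk k))" for i k t
  define \<psi> where "\<psi> l t = 1 - c l * q l a - integral {0..t} (\<lambda>x. q l (\<sigma> x) * f l x)" for l t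
  define \<Psi> where "\<Psi> i t = (\<Prod>l\<in>{..<n}-{i}. \<psi> l t)" for i t
  have qs: "continuous_on {0..1} (\<lambda>x. q l (\<sigma> x))" if "l < n" for l
  proof (rule continuous_on_compose2[OF q[OF that] \<sigma>(1)], rule image_subsetI)
    show "\<sigma> t \<in> {0..1}" if "t \<in> {0..1}" for t using \<sigma>(3)[of t] that by simp
  qed
  have uc: "continuous_on {0..1} (u i k)" if "i < n" "k \<in> K" for i k
    unfolding u_def[abs_def]
  proof (rule continuous_on_compose2[OF q[OF that(1)] continuous_on_min[OF \<sigma>(1) continuous_on_const]], rule image_subsetI)
    show "min (\<sigma> t) (tk k) \<in> {0..1}" if "t \<in> {0..1}" for t
      using \<sigma>(3)[of t] that K(2)[OF \<open>k \<in> K\<close>] by (auto simp: min_def)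
  qed
  have qf: "continuous_on {0..1} (\<lambda>x. q l (\<sigma> x) * f l x)" if "l < n" for l
    using that by (intro continuous_intros qs cd)
  have \<psi>c: "continuous_on {0..1} (\<psi> l)" if "l < n" for l
    unfolding \<psi>_def[abs_def]
    by (intro continuous_intros indefinite_integral_continuous_1 integrable_continuous_interval qf that)
  have \<Psi>c: "continuous_on {0..1} (\<Psi> i)" for i
    unfolding \<Psi>_def[abs_def] by (intro continuous_on_prod \<psi>c) auto
  have intf: "integral {0..t} (f l) \<le> integral {0..1} (f l)" if "l < n" "0 \<le> t" "t \<le> 1" for l t
    using that cd by (intro integral_subset_le) (auto intro!: integrable_continuous_interval intro: continuous_on_subset[OF cd(3)])
  have qfi: "0 \<le> integral {0..t} (\<lambda>x. q l (\<sigma> x) * f l x)" "integral {0..t} (\<lambda>x. q l (\<sigma> x) * f l x) \<le> integral {0..1} (f l)"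
    if l: "l < n" and t: "0 \<le> t" "t \<le> 1" for l t
  proof -
    have i1: "(\<lambda>x. q l (\<sigma> x) * f l x) integrable_on {0..t}" "f l integrable_on {0..t}"
      using t by (auto intro!: integrable_continuous_interval intro: continuous_on_subset[OF qf[OF l]] continuous_on_subset[OF cd(3)[OF l]])
    show "0 \<le> integral {0..t} (\<lambda>x. q l (\<sigma> x) * f l x)"
      using q01[OF l] cd(4)[OF l] by (intro integral_nonneg i1) auto
    have "integral {0..t} (\<lambda>x. q l (\<sigma> x) * f l x) \<le> integral {0..t} (f l)"
      using q01[OF l] cd(4)[OF l] by (intro integral_le i1) (auto intro: mult_left_le_one_le)
    then show "integral {0..t} (\<lambda>x. q l (\<sigma> x) * f l x) \<le> integral {0..1} (f l)" using intf[OF l t] by simp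
  qed
  have cq: "0 \<le> c l * q l x" "c l * q l x \<le> c l" "d l * q l x \<le> d l" "0 \<le> d l * q l x" if "l < n" for l x
    using q01[OF that, of x] cd[OF that] by (auto intro: mult_left_le)
  have \<psi>d: "d l \<le> \<psi> l t" "\<psi> l t \<le> 1" if l: "l < n" and t: "0 \<le> t" "t \<le> 1" for l t
    using qfi[OF l t] cq[OF l, of a] cd(5)[OF l] by (auto simp: \<psi>_def)
  have \<psi>01: "0 \<le> \<psi> l t" if "l < n" "0 \<le> t" "t \<le> 1" for l t using \<psi>d[OF that] cd(2)[OF that(1)] by simp
  have \<Psi>01: "0 \<le> \<Psi> i t" "\<Psi> i t \<le> 1" if "0 \<le> t" "t \<le> 1" for i t
    unfolding \<Psi>_def using \<psi>d(2) \<psi>01 that by (auto intro!: prod_nonneg prod_le_1)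
  define \<epsilon>' where "\<epsilon>' = \<epsilon> / (real n + 1)"
  have \<epsilon>': "0 < \<epsilon>'" "real n * \<epsilon>' \<le> \<epsilon>" using \<epsilon> by (auto simp: \<epsilon>'_def field_simps)
  have "\<forall>\<^sub>F N in sequentially. \<forall>t x y. t \<in> {0..1} \<longrightarrow> x \<in> {0..1} \<longrightarrow> y \<in> {0..1} \<longrightarrow> \<bar>x - t\<bar> \<le> 1 / real N \<longrightarrow> \<bar>y - t\<bar> \<le> 1 / real N \<longrightarrow>
    u (fst ik) (snd ik) t * \<Psi> (fst ik) t - \<epsilon>' \<le> u (fst ik) (snd ik) x * \<Psi> (fst ik) y" if ik: "ik \<in> {..<n} \<times> K" for ik
  proof -
    obtain i k where ik': "ik = (i, k)" "i < n" "k \<in> K" using ik by auto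
    have U: "uniformly_continuous_on {0..1} (u i k)" "uniformly_continuous_on {0..1} (\<Psi> i)"
      by (intro compact_uniformly_continuous uc \<Psi>c ik' compact_Icc)+
    obtain d1 where d1: "d1 > 0" "\<And>x y. x \<in> {0..1} \<Longrightarrow> y \<in> {0..1} \<Longrightarrow> dist y x < d1 \<Longrightarrow> dist (u i k y) (u i k x) < \<epsilon>' / 2"
      using U(1)[unfolded uniformly_continuous_on_def, THEN spec, THEN mp, OF half_gt_zero[OF \<epsilon>'(1)]] by blast
    obtain d2 where d2: "d2 > 0" "\<And>x y. x \<in> {0..1} \<Longrightarrow> y \<in> {0..1} \<Longrightarrow> dist y x < d2 \<Longrightarrow> dist (\<Psi> i y) (\<Psi> i x) < \<epsilon>' / 2"
      using U(2)[unfolded uniformly_continuous_on_def, THEN spec, THEN mp, OF half_gt_zero[OF \<epsilon>'(1)]] by blast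
    have "\<forall>\<^sub>F N in sequentially. 1 / real N < min d1 d2"
      by (rule order_tendstoD(2)[OF lim_1_over_n]) (use d1 d2 in auto)
    then show ?thesis
    proof (rule eventually_mono, intro allI impI)
      fix N t x y assume N: "1 / real N < min d1 d2" and t: "t \<in> {0..1::real}" "x \<in> {0..1}" "y \<in> {0..1}" 
        and x: "\<bar>x - t\<bar> \<le> 1 / real N" and y: "\<bar>y - t\<bar> \<le> 1 / real N"
      have 1: "\<bar>u i k x - u i k t\<bar> < \<epsilon>' / 2" using d1(2)[OF t(1,2)] x N by (simp add: dist_real_def)
      have 2: "\<bar>\<Psi> i y - \<Psi> i t\<bar> < \<epsilon>' / 2" using d2(2)[OF t(1,3)] y N by (simp add: dist_real_def)
      have u01: "0 \<le> u i k t" "u i k t \<le> 1" using q01[OF ik'(2)] by (auto simp: u_def)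
      have P: "0 \<le> \<Psi> i y" "\<Psi> i y \<le> 1" using \<Psi>01[of y] t by auto
      have "\<bar>(u i k x - u i k t) * \<Psi> i y\<bar> \<le> \<bar>u i k x - u i k t\<bar> * 1"
        unfolding abs_mult using P by (intro mult_left_mono) auto
      moreover have "\<bar>u i k t * (\<Psi> i y - \<Psi> i t)\<bar> \<le> 1 * \<bar>\<Psi> i y - \<Psi> i t\<bar>"
        unfolding abs_mult using u01 by (intro mult_right_mono) auto
      moreover have "u i k x * \<Psi> i y - u i k t * \<Psi> i t = (u i k x - u i k t) * \<Psi> i y + u i k t * (\<Psi> i y - \<Psi> i t)"
        by (simp add: algebra_simps)
      moreover define X Y where "X = (u i k x - u i k t) * \<Psi> i y" and "Y = u i k t * (\<Psi> i y - \<Psi> i t)"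
      ultimately have "\<bar>X\<bar> < \<epsilon>' / 2" "\<bar>Y\<bar> < \<epsilon>' / 2" "u i k x * \<Psi> i y - u i k t * \<Psi> i t = X + Y" using 1 2 by simp_all
      then have "u i k t * \<Psi> i t - \<epsilon>' \<le> u i k x * \<Psi> i y" by linarith
      then show "u (fst ik) (snd ik) t * \<Psi> (fst ik) t - \<epsilon>' \<le> u (fst ik) (snd ik) x * \<Psi> (fst ik) y" by (simp add: ik')
    qed
  qed
  then have "\<forall>\<^sub>F N in sequentially. \<forall>ik\<in>{..<n} \<times> K. \<forall>t x y. t \<in> {0..1} \<longrightarrow> x \<in> {0..1} \<longrightarrow> y \<in> {0..1} \<longrightarrow> \<bar>x - t\<bar> \<le> 1 / real N \<longrightarrow> \<bar>y - t\<bar> \<le> 1 / real N \<longrightarrow>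
    u (fst ik) (snd ik) t * \<Psi> (fst ik) t - \<epsilon>' \<le> u (fst ik) (snd ik) x * \<Psi> (fst ik) y"
    by (intro eventually_ball_finite) (use K in auto)
  from eventually_happens'[OF sequentially_bot eventually_conj[OF this eventually_gt_at_top[of 0]]] obtain N where N: "0 < N" and
    uni0: "\<forall>ik\<in>{..<n} \<times> K. \<forall>t x y. t \<in> {0..1} \<longrightarrow> x \<in> {0..1} \<longrightarrow> y \<in> {0..1} \<longrightarrow> \<bar>x - t\<bar> \<le> 1 / real N \<longrightarrow> \<bar>y - t\<bar> \<le> 1 / real N \<longrightarrow>
    u (fst ik) (snd ik) t * \<Psi> (fst ik) t - \<epsilon>' \<le> u (fst ik) (snd ik) x * \<Psi> (fst ik) y"
    by blast
  have uni: "u i k t * \<Psi> i t - \<epsilon>' \<le> u i k x * \<Psi> i y"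
    if "i < n" "k \<in> K" "t \<in> {0..1}" "x \<in> {0..1}" "y \<in> {0..1}" "\<bar>x - t\<bar> \<le> 1 / real N" "\<bar>y - t\<bar> \<le> 1 / real N" for i k t x y
    by (rule uni0[THEN bspec, of "(i, k)", unfolded fst_conv snd_conv, rule_format]) (use that in simp_all)
  define I where "I i \<tau> = integral {real \<tau> / real N..real (Suc \<tau>) / real N} (f i)" for i \<tau>
  \<comment> \<open>The shift by \<open>case_nat\<close> puts cell \<tau> into slot \<tau> + 1.
    Every index from N + 1 on receives \<open>d i\<close>, but just N + 2 slots are summed.\<close>
  define p where "p i = case_nat (c i) (\<lambda>\<tau>. if \<tau> < N then I i \<tau> else d i)" for i
  define s where "s = case_nat a (\<lambda>\<tau>. if \<tau> < N then \<sigma> (real \<tau> / real N) else 1)"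
  have cell: "0 \<le> real \<tau> / real N" "real \<tau> / real N \<le> real (Suc \<tau>) / real N" "real (Suc \<tau>) / real N \<le> 1" 
    "real (Suc \<tau>) / real N = real \<tau> / real N + 1 / real N" if "\<tau> < N" for \<tau>
    using that N by (auto simp: field_simps)
  have s01: "0 \<le> s \<tau> \<and> s \<tau> \<le> 1" for \<tau>
  proof (cases \<tau>)
    case (Suc \<tau>')
    have "\<tau>' < N \<Longrightarrow> real \<tau>' / real N \<le> 1" using N by simp
    then show ?thesis using \<sigma>(3)[of "real \<tau>' / real N"] Suc by (simp add: s_def)
  qed (use a in \<open>simp add: s_def\<close>)
  have I0: "0 \<le> I i \<tau>" if i: "i < n" and \<tau>: "\<tau> < N" for i \<tau>
    unfolding I_def
  proof (rule integral_nonneg)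
    show "f i integrable_on {real \<tau> / real N..real (Suc \<tau>) / real N}"
      using cell[OF \<tau>] by (intro integrable_continuous_interval continuous_on_subset[OF cd(3)[OF i]]) auto
  qed (use cd(4)[OF i] in auto)
  have p0: "0 \<le> p i \<tau>" if i: "i < n" for i \<tau>
    using cd[OF i] I0[OF i] by (auto simp: p_def split: nat.splits)
  have N1: "real N / real N = 1" using N by simp
  have split: "(\<Sum>\<tau><Suc (Suc N). h \<tau>) = h 0 + (\<Sum>\<tau><N. h (Suc \<tau>)) + h (Suc N)" for h :: "nat \<Rightarrow> real"
    by (simp only: sum.lessThan_Suc[of h "Suc N"] sum.lessThan_Suc_shift[of h N])
  have p1: "(\<Sum>\<tau><Suc (Suc N). p i \<tau>) \<le> 1" if i: "i < n" for i
  proof -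
    have "integral {0..real N / real N} (\<lambda>x. - f i x) \<le> (\<Sum>\<tau><N. -1 * integral {real \<tau> / real N..real (Suc \<tau>) / real N} (f i))
      \<and> integral {0..real N / real N} (f i) \<le> (\<Sum>\<tau><N. 1 * integral {real \<tau> / real N..real (Suc \<tau>) / real N} (f i))"
      by (intro conjI cell_sum) (auto intro!: continuous_intros cd(3)[OF i] N)
    then have "(\<Sum>\<tau><N. I i \<tau>) = integral {0..1} (f i)"
      unfolding N1 by (simp add: I_def sum_negf)
    then have "(\<Sum>\<tau><Suc (Suc N). p i \<tau>) = c i + integral {0..1} (f i) + d i"
      unfolding split by (simp add: p_def)
    then show ?thesis using cd(5)[OF i] by simp
  qed
  have part: "(\<Sum>\<tau>'\<in>{..\<tau>}. p l \<tau>' * q l (s \<tau>')) \<le> c l * q l a + integral {0..real \<tau> / real N} (\<lambda>x. q l (\<sigma> x) * f l x)"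
    if l: "l < n" and \<tau>: "\<tau> \<le> N" for l \<tau>
  proof -
    have "integral {0..real \<tau> / real N} (\<lambda>x. - (q l (\<sigma> x) * f l x))
       \<le> (\<Sum>\<tau>'<\<tau>. - q l (\<sigma> (real \<tau>' / real N)) * integral {real \<tau>' / real N..real (Suc \<tau>') / real N} (f l))"
    proof (rule cell_sum[OF cd(3)[OF l] _ N _ \<tau>])
      show "continuous_on {0..1} (\<lambda>x. - (q l (\<sigma> x) * f l x))" by (intro continuous_intros qf l)
      fix \<tau>' t assume t: "\<tau>' < N" "real \<tau>' / real N \<le> t" "t \<le> real (Suc \<tau>') / real N"
      have t1: "0 \<le> real \<tau>' / real N" "t \<le> 1" using cell[OF t(1)] t by linarith+
      have "q l (\<sigma> (real \<tau>' / real N)) \<le> q l (\<sigma> t)"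
        by (rule mono[OF l]) (use \<sigma>(2)[OF t1(1) t(2) t1(2)] \<sigma>(3)[of t] \<sigma>(3)[of "real \<tau>' / real N"] t t1 in auto)
      then have "q l (\<sigma> (real \<tau>' / real N)) * f l t \<le> q l (\<sigma> t) * f l t" using cd(4)[OF l] by (rule mult_right_mono)
      then show "- (q l (\<sigma> t) * f l t) \<le> - q l (\<sigma> (real \<tau>' / real N)) * f l t" by simp
    qed
    then have "(\<Sum>\<tau>'<\<tau>. I l \<tau>' * q l (\<sigma> (real \<tau>' / real N))) \<le> integral {0..real \<tau> / real N} (\<lambda>x. q l (\<sigma> x) * f l x)"
      by (simp add: I_def sum_negf mult.commute)
    moreover have "(\<Sum>\<tau>'\<in>{..\<tau>}. p l \<tau>' * q l (s \<tau>')) = c l * q l a + (\<Sum>\<tau>'<\<tau>. I l \<tau>' * q l (\<sigma> (real \<tau>' / real N)))"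
    proof -
      have "(\<Sum>\<tau>'\<in>{..\<tau>}. p l \<tau>' * q l (s \<tau>')) = p l 0 * q l (s 0) + (\<Sum>\<tau>'<\<tau>. p l (Suc \<tau>') * q l (s (Suc \<tau>')))"
        unfolding lessThan_Suc_atMost[symmetric] by (rule sum.lessThan_Suc_shift)
      moreover have "(\<Sum>\<tau>'<\<tau>. p l (Suc \<tau>') * q l (s (Suc \<tau>'))) = (\<Sum>\<tau>'<\<tau>. I l \<tau>' * q l (\<sigma> (real \<tau>' / real N)))"
        by (rule sum.cong) (use \<tau> in \<open>auto simp: p_def s_def\<close>)
      ultimately show ?thesis by (simp add: p_def s_def)
    qed
    ultimately show ?thesis by simp
  qed
  have prodle: "\<Psi> i (real \<tau> / real N) \<le> (\<Prod>l\<in>{..<n}-{i}. 1 - (\<Sum>\<tau>'\<in>{..\<tau>}. p l \<tau>' * q l (s \<tau>')))" if \<tau>: "\<tau> \<le> N" for i \<tau>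
    unfolding \<Psi>_def
  proof (rule prod_mono)
    fix l assume l: "l \<in> {..<n}-{i}"
    have "0 \<le> real \<tau> / real N" "real \<tau> / real N \<le> 1" using \<tau> N by auto
    then show "0 \<le> \<psi> l (real \<tau> / real N) \<and> \<psi> l (real \<tau> / real N) \<le> 1 - (\<Sum>\<tau>'\<in>{..\<tau>}. p l \<tau>' * q l (s \<tau>'))"
      using \<psi>01[of l "real \<tau> / real N"] part[of l \<tau>] l \<tau> by (auto simp: \<psi>_def)
  qed
  define W where "W i k = (\<Sum>\<tau><Suc (Suc N). p i \<tau> * q i (min (s \<tau>) (tk k)) * (\<Prod>l\<in>{..<n}-{i}. 1 - (\<Sum>\<tau>'\<in>{..\<tau>}. p l \<tau>' * q l (s \<tau>'))))" for i k
  have item: "c i * q i (min a (tk k)) * (\<Prod>l\<in>{..<n}-{i}. 1 - c l * q l a)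
     + integral {0..1} (\<lambda>t. f i t * (u i k t * \<Psi> i t))
     + d i * q i (tk k) * (\<Prod>l\<in>{..<n}-{i}. \<psi> l 1 - d l * q l 1) - \<epsilon>' \<le> W i k" if i: "i < n" and k: "k \<in> K" for i k
  proof -
    have t0: "c i * q i (min a (tk k)) * (\<Prod>l\<in>{..<n}-{i}. 1 - c l * q l a)
      \<le> p i 0 * q i (min (s 0) (tk k)) * (\<Prod>l\<in>{..<n}-{i}. 1 - (\<Sum>\<tau>'\<in>{..0}. p l \<tau>' * q l (s \<tau>')))"
      by (simp add: p_def s_def)
    have "integral {0..real N / real N} (\<lambda>t. f i t * (u i k t * \<Psi> i t - \<epsilon>'))
      \<le> (\<Sum>\<tau><N. (u i k (real \<tau> / real N) * \<Psi> i (real (Suc \<tau>) / real N)) * integral {real \<tau> / real N..real (Suc \<tau>) / real N} (f i))"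
    proof (rule cell_sum[OF cd(3)[OF i] _ N _ order_refl])
      show "continuous_on {0..1} (\<lambda>t. f i t * (u i k t * \<Psi> i t - \<epsilon>'))" by (intro continuous_intros cd(3) uc \<Psi>c i k)
      fix \<tau> t assume t: "\<tau> < N" "real \<tau> / real N \<le> t" "t \<le> real (Suc \<tau>) / real N"
      have "u i k t * \<Psi> i t - \<epsilon>' \<le> u i k (real \<tau> / real N) * \<Psi> i (real (Suc \<tau>) / real N)"
      proof -
        define x y where "x = real \<tau> / real N" and "y = real (Suc \<tau>) / real N"
        have "0 \<le> x" "x \<le> y" "y \<le> 1" "y = x + 1 / real N" "x \<le> t" "t \<le> y"
          unfolding x_def y_def by (rule cell[OF t(1)] t(2,3))+
        then show ?thesis unfolding x_def[symmetric] y_def[symmetric] by (intro uni[OF i k]) auto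
      qed
      then have "f i t * (u i k t * \<Psi> i t - \<epsilon>') \<le> f i t * (u i k (real \<tau> / real N) * \<Psi> i (real (Suc \<tau>) / real N))"
        using cd(4)[OF i] by (rule mult_left_mono)
      then show "f i t * (u i k t * \<Psi> i t - \<epsilon>') \<le> u i k (real \<tau> / real N) * \<Psi> i (real (Suc \<tau>) / real N) * f i t"
        by (simp only: mult.commute)
    qed
    also have "\<dots> \<le> (\<Sum>\<tau><N. p i (Suc \<tau>) * q i (min (s (Suc \<tau>)) (tk k)) * (\<Prod>l\<in>{..<n}-{i}. 1 - (\<Sum>\<tau>'\<in>{..Suc \<tau>}. p l \<tau>' * q l (s \<tau>'))))"
    proof (rule sum_mono)
      fix \<tau> assume \<tau>: "\<tau> \<in> {..<N}"
      have e: "p i (Suc \<tau>) = I i \<tau>" "q i (min (s (Suc \<tau>)) (tk k)) = u i k (real \<tau> / real N)"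
        using \<tau> by (simp_all add: p_def s_def u_def)
      have "I i \<tau> * u i k (real \<tau> / real N) * \<Psi> i (real (Suc \<tau>) / real N)
        \<le> I i \<tau> * u i k (real \<tau> / real N) * (\<Prod>l\<in>{..<n}-{i}. 1 - (\<Sum>\<tau>'\<in>{..Suc \<tau>}. p l \<tau>' * q l (s \<tau>')))"
        using \<tau> I0[OF i, of \<tau>] q01[OF i] by (intro mult_left_mono prodle mult_nonneg_nonneg) (auto simp: u_def)
      then show "u i k (real \<tau> / real N) * \<Psi> i (real (Suc \<tau>) / real N) * integral {real \<tau> / real N..real (Suc \<tau>) / real N} (f i)
        \<le> p i (Suc \<tau>) * q i (min (s (Suc \<tau>)) (tk k)) * (\<Prod>l\<in>{..<n}-{i}. 1 - (\<Sum>\<tau>'\<in>{..Suc \<tau>}. p l \<tau>' * q l (s \<tau>')))"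
        unfolding e I_def[symmetric] by (simp only: mult_ac)
    qed
    finally have t1: "integral {0..1} (\<lambda>t. f i t * (u i k t * \<Psi> i t - \<epsilon>'))
      \<le> (\<Sum>\<tau><N. p i (Suc \<tau>) * q i (min (s (Suc \<tau>)) (tk k)) * (\<Prod>l\<in>{..<n}-{i}. 1 - (\<Sum>\<tau>'\<in>{..Suc \<tau>}. p l \<tau>' * q l (s \<tau>'))))"
      unfolding N1 .
    have ii: "(\<lambda>t. f i t * (u i k t * \<Psi> i t)) integrable_on {0..1}" "f i integrable_on {0..1}"
      by (intro integrable_continuous_interval continuous_intros cd(3) uc \<Psi>c i k)+
    have "((\<lambda>t. f i t * (u i k t * \<Psi> i t) - \<epsilon>' * f i t) has_integral
       (integral {0..1} (\<lambda>t. f i t * (u i k t * \<Psi> i t)) - \<epsilon>' * integral {0..1} (f i))) {0..1}"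
      by (intro has_integral_diff has_integral_mult_right integrable_integral ii)
    moreover have "(\<lambda>t. f i t * (u i k t * \<Psi> i t) - \<epsilon>' * f i t) = (\<lambda>t. f i t * (u i k t * \<Psi> i t - \<epsilon>'))"
      by (rule ext) (simp add: algebra_simps)
    ultimately have "integral {0..1} (\<lambda>t. f i t * (u i k t * \<Psi> i t - \<epsilon>')) 
      = integral {0..1} (\<lambda>t. f i t * (u i k t * \<Psi> i t)) - \<epsilon>' * integral {0..1} (f i)" by (simp add: integral_unique)
    moreover have "\<epsilon>' * integral {0..1} (f i) \<le> \<epsilon>' * 1" using \<epsilon>'(1) cd[OF i] by (intro mult_left_mono) auto
    ultimately have t1': "integral {0..1} (\<lambda>t. f i t * (u i k t * \<Psi> i t)) - \<epsilon>' \<le> integral {0..1} (\<lambda>t. f i t * (u i k t * \<Psi> i t - \<epsilon>'))" by simp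
    have pe: "p i (Suc N) = d i" "s (Suc N) = 1" for i by (simp_all add: p_def s_def)
    have tk: "min 1 (tk k) = tk k" using K(2)[OF k] by simp
    have "(\<Prod>l\<in>{..<n}-{i}. \<psi> l 1 - d l * q l 1) \<le> (\<Prod>l\<in>{..<n}-{i}. 1 - (\<Sum>\<tau>'\<in>{..Suc N}. p l \<tau>' * q l (s \<tau>')))"
    proof (rule prod_mono)
      fix l assume l: "l \<in> {..<n}-{i}"
      then show "0 \<le> \<psi> l 1 - d l * q l 1 \<and> \<psi> l 1 - d l * q l 1 \<le> 1 - (\<Sum>\<tau>'\<in>{..Suc N}. p l \<tau>' * q l (s \<tau>'))"
        using \<psi>d(1)[of l 1] cq(3)[of l 1] part[of l N] unfolding sum.atMost_Suc pe N1 by (auto simp: \<psi>_def)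
    qed
    then have t2: "d i * q i (tk k) * (\<Prod>l\<in>{..<n}-{i}. \<psi> l 1 - d l * q l 1) 
      \<le> p i (Suc N) * q i (min (s (Suc N)) (tk k)) * (\<Prod>l\<in>{..<n}-{i}. 1 - (\<Sum>\<tau>'\<in>{..Suc N}. p l \<tau>' * q l (s \<tau>')))"
      unfolding pe tk using cq(4)[OF i] by (rule mult_left_mono)
    show ?thesis unfolding W_def split using t0 t1 t1' t2 by linarith
  qed
  have fin: "fluid_reward n q c f d \<sigma> a (tk k) - \<epsilon> \<le> (\<Sum>i<n. W i k)" if k: "k \<in> K" for k
  proof -
    have "fluid_reward n q c f d \<sigma> a (tk k) - \<epsilon> \<le> fluid_reward n q c f d \<sigma> a (tk k) - (\<Sum>i<n. \<epsilon>')" using \<epsilon>'(2) by simp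
    also have "\<dots> = (\<Sum>i<n. c i * q i (min a (tk k)) * (\<Prod>l\<in>{..<n}-{i}. 1 - c l * q l a)
     + integral {0..1} (\<lambda>t. f i t * (u i k t * \<Psi> i t))
     + d i * q i (tk k) * (\<Prod>l\<in>{..<n}-{i}. \<psi> l 1 - d l * q l 1) - \<epsilon>')"
      unfolding fluid_reward_def u_def \<Psi>_def \<psi>_def by (rule sum_subtractf[symmetric])
    also have "\<dots> \<le> (\<Sum>i<n. W i k)" using item k by (intro sum_mono) auto
    finally show ?thesis .
  qed
  have all: "(\<forall>i<n. (\<forall>\<tau>. 0 \<le> p i \<tau>) \<and> (\<Sum>\<tau><Suc (Suc N). p i \<tau>) \<le> 1) \<and> (\<forall>\<tau>. 0 \<le> s \<tau> \<and> s \<tau> \<le> 1) \<and>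
    (\<forall>k\<in>K. fluid_reward n q c f d \<sigma> a (tk k) - \<epsilon> \<le>
      (\<Sum>i<n. \<Sum>\<tau><Suc (Suc N). p i \<tau> * q i (min (s \<tau>) (tk k)) * (\<Prod>l\<in>{..<n}-{i}. 1 - (\<Sum>\<tau>'\<in>{..\<tau>}. p l \<tau>' * q l (s \<tau>')))))"
    using p0 p1 s01 fin[unfolded W_def] by blast
  show ?thesis by (intro exI) (rule all)
qed

section \<open>Discretised values\<close>

text \<open>Each increment of e is spread by the ramp over one subinterval, so the values at the
  knots k / (M + 1) are e k - e 0. The construction is linear in e: averaging the paths of single
  values gives the path through the averaged levels.\<close>

definition level_path :: "nat \<Rightarrow> (nat \<Rightarrow> real) \<Rightarrow> real \<Rightarrow> real" where
  "level_path M e t = (\<Sum>k<Suc M. (e (Suc k) - e k) * smooth (real (Suc M) * t - real k))"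

definition level_path' :: "nat \<Rightarrow> (nat \<Rightarrow> real) \<Rightarrow> real \<Rightarrow> real" where
  "level_path' M e t = (\<Sum>k<Suc M. (e (Suc k) - e k) * (smooth' (real (Suc M) * t - real k) * real (Suc M)))"

lemma level_path_deriv: "(level_path M e has_real_derivative level_path' M e t) (at t)"
  unfolding level_path_def[abs_def] level_path'_def
proof (intro DERIV_sum DERIV_cmult)
  fix k
  have "((\<lambda>t. real (Suc M) * t - real k) has_real_derivative real (Suc M)) (at t)"
    by (auto intro!: derivative_eq_intros)
  then show "((\<lambda>t. smooth (real (Suc M) * t - real k)) has_real_derivative smooth' (real (Suc M) * t - real k) * real (Suc M)) (at t)"
    by (rule DERIV_chain2[OF smooth_deriv])
qed

lemma level_path'_cont: "continuous_on UNIV (level_path' M e)"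
  unfolding level_path'_def[abs_def]
  by (intro continuous_intros continuous_on_compose2[OF smooth'_cont[of UNIV]]) auto

lemma level_path'_nonneg:
  assumes "\<And>k. k \<le> M \<Longrightarrow> e k \<le> e (Suc k)"
  shows "0 \<le> level_path' M e t"
  unfolding level_path'_def
  by (intro sum_nonneg mult_nonneg_nonneg smooth'_nonneg) (use assms in auto)

lemma level_path_mono:
  assumes "\<And>k. k \<le> M \<Longrightarrow> e k \<le> e (Suc k)" "s \<le> t"
  shows "level_path M e s \<le> level_path M e t"
  unfolding level_path_def
proof (intro sum_mono mult_left_mono smooth_mono)
  show "real (Suc M) * s - real k \<le> real (Suc M) * t - real k" for k
    using mult_left_mono[OF assms(2), of "real (Suc M)"] by simp
qed (use assms in auto)

lemma level_path01:
  assumes "\<And>k. k \<le> M \<Longrightarrow> e k \<le> e (Suc k)" "e 0 = 0" "e (Suc M) = 1"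
  shows "0 \<le> level_path M e t" "level_path M e t \<le> 1"
proof -
  show "0 \<le> level_path M e t"
    unfolding level_path_def by (intro sum_nonneg mult_nonneg_nonneg smooth01) (use assms in auto)
  have "level_path M e t \<le> (\<Sum>k<Suc M. (e (Suc k) - e k) * 1)"
    unfolding level_path_def by (intro sum_mono mult_left_mono smooth01) (use assms in auto)
  also have "\<dots> = 1" using sum_lessThan_telescope[of e "Suc M"] assms by simp
  finally show "level_path M e t \<le> 1" .
qed

lemma level_path_knot:
  assumes "k \<le> Suc M"
  shows "level_path M e (real k / real (Suc M)) = e k - e 0"
proof -
  have "level_path M e (real k / real (Suc M)) = (\<Sum>j<Suc M. if j < k then e (Suc j) - e j else 0)"
    unfolding level_path_def
  proof (rule sum.cong[OF refl])
    fix j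
    have "real (Suc M) * (real k / real (Suc M)) = real k" by (simp del: of_nat_Suc)
    then show "(e (Suc j) - e j) * smooth (real (Suc M) * (real k / real (Suc M)) - real j) = (if j < k then e (Suc j) - e j else 0)"
      by (simp only:) (cases "j < k"; simp)
  qed
  also have "\<dots> = (\<Sum>j<k. e (Suc j) - e j)"
    by (rule sum.mono_neutral_cong_right) (use assms in auto)
  also have "\<dots> = e k - e 0" by (rule sum_lessThan_telescope)
  finally show ?thesis .
qed

text \<open>Level k stands for the threshold (M + 1 - k) * h, so rising levels lower the threshold.
  The ends are fixed at 0 and 1 for every x, which makes all paths run from exactly 0 to exactly
  1.\<close>

definition lev :: "nat \<Rightarrow> real \<Rightarrow> nat \<Rightarrow> real \<Rightarrow> real" where
  "lev M h k x = (if k = 0 then 0 else if M < k then 1 else indicator {real (Suc M - k) * h..} x)"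

lemma lev_mono: assumes "0 < h" "k \<le> M" shows "lev M h k x \<le> lev M h (Suc k) x"
proof -
  have "real (Suc M - Suc k) * h \<le> real (Suc M - k) * h" using assms by (intro mult_right_mono) auto
  then show ?thesis by (auto simp: lev_def indicator_def)
qed

lemma lev_measurable [measurable]: "lev M h k \<in> borel_measurable borel"
  unfolding lev_def[abs_def] by auto

lemma lev01: "0 \<le> lev M h k x" "lev M h k x \<le> 1" by (auto simp: lev_def indicator_def)

lemma lev_ends: "lev M h 0 x = 0" "lev M h (Suc M) x = 1" by (auto simp: lev_def)

lemma step_sum_le:
  fixes x h :: real
  assumes "0 < h" "0 \<le> x"
  shows "(\<Sum>k\<in>{1..M}. if real k * h \<le> x then h else 0) \<le> x"
proof (induction M)
  case (Suc M)
  have "(\<Sum>k\<in>{1..M}. if real k * h \<le> x then h else 0) \<le> (\<Sum>k\<in>{1..M}. h)" using assms by (intro sum_mono) auto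
  then have "(\<Sum>k\<in>{1..M}. if real k * h \<le> x then h else 0) \<le> real M * h" by simp
  then show ?case using Suc by (simp add: algebra_simps)
qed (use assms in simp)

lemma lev_sum_le: assumes "0 < h" "0 \<le> x" shows "h * (\<Sum>k\<in>{1..M}. lev M h k x) \<le> x"
proof -
  have "h * (\<Sum>k\<in>{1..M}. lev M h k x) = (\<Sum>k\<in>{1..M}. if real (M + 1 - k) * h \<le> x then h else 0)"
    unfolding sum_distrib_left by (rule sum.cong) (auto simp: lev_def indicator_def)
  also have "\<dots> = (\<Sum>k\<in>{1..M}. if real k * h \<le> x then h else 0)"
    by (rule sum.atLeastAtMost_rev[symmetric])
  also have "\<dots> \<le> x" by (rule step_sum_le[OF assms])
  finally show ?thesis .
qed

text \<open>If x misses the threshold of level k, its path is still 0 at that knot and the summand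
  vanishes; otherwise the summand is at most the acceptance probability at t. At most x / h levels
  are of the second kind.\<close>

lemma acceptance_ge:
  assumes h: "0 < h" and x: "0 \<le> x"
  shows "h * (\<Sum>k\<in>{1..M}. level_path M (\<lambda>k. lev M h k x) (min t (real k / real (Suc M)))) \<le> level_path M (\<lambda>k. lev M h k x) t * x"
proof -
  let ?\<alpha> = "level_path M (\<lambda>k. lev M h k x)"
  have m: "s \<le> t \<Longrightarrow> ?\<alpha> s \<le> ?\<alpha> t" for s t using lev_mono[OF h] by (intro level_path_mono) auto
  have 01: "0 \<le> ?\<alpha> t" for t using lev_mono[OF h] by (intro level_path01) (auto simp: lev_ends)
  have "?\<alpha> (min t (real k / real (Suc M))) \<le> ?\<alpha> t * lev M h k x" if k: "k \<in> {1..M}" for k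
  proof (cases "lev M h k x = 0")
    case True
    have "?\<alpha> (min t (real k / real (Suc M))) \<le> ?\<alpha> (real k / real (Suc M))" by (rule m) simp
    also have "\<dots> = 0" using k True by (subst level_path_knot) (auto simp: lev_ends)
    finally show ?thesis using True by simp
  next
    case False
    then have "lev M h k x = 1" by (auto simp: lev_def indicator_def split: if_splits)
    then show ?thesis using m[of "min t (real k / real (Suc M))" t] by simp
  qed
  then have "(\<Sum>k\<in>{1..M}. ?\<alpha> (min t (real k / real (Suc M)))) \<le> (\<Sum>k\<in>{1..M}. ?\<alpha> t * lev M h k x)" by (rule sum_mono)
  then have "h * (\<Sum>k\<in>{1..M}. ?\<alpha> (min t (real k / real (Suc M)))) \<le> h * (\<Sum>k\<in>{1..M}. ?\<alpha> t * lev M h k x)"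
    using h by (intro mult_left_mono) auto
  also have "\<dots> = ?\<alpha> t * (h * (\<Sum>k\<in>{1..M}. lev M h k x))" by (simp add: sum_distrib_left mult_ac)
  also have "\<dots> \<le> ?\<alpha> t * x" by (rule mult_left_mono[OF lev_sum_le[OF h x] 01])
  finally show ?thesis .
qed

text \<open>The pointwise facts averaged over the law of the item. From here on a distribution
  matters only through its path q: the reward of an offer at level t is bounded below by the chances
  of accepting above each level.\<close>

lemma acceptance_integrals:
  fixes D :: "real measure" and h :: real and M :: nat
  assumes D: "prob_space D" "sets D = sets borel" "integrable D (\<lambda>x. x)" "AE x in D. 0 \<le> x" and h: "0 < h"
  defines "q \<equiv> level_path M (\<lambda>k. \<integral>x. lev M h k x \<partial>D)"
  shows "(\<integral>x. level_path M (\<lambda>k. lev M h k x) t \<partial>D) = q t"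
    and "h * (\<Sum>k\<in>{1..M}. q (min t (real k / real (Suc M)))) \<le> (\<integral>x. level_path M (\<lambda>k. lev M h k x) t * x \<partial>D)"
proof -
  interpret prob_space D by (rule D(1))
  have [measurable]: "lev M h k \<in> borel_measurable D" for k using D(2) by (simp cong: measurable_cong_sets)
  have [measurable]: "(\<lambda>x. x) \<in> borel_measurable D" using D(2) by (simp cong: measurable_cong_sets)
  have il: "integrable D (lev M h k)" for k
    by (rule integrable_const_bound[of _ 1]) (auto simp: lev01 intro!: AE_I2)
  have pm [measurable]: "(\<lambda>x. level_path M (\<lambda>k. lev M h k x) t) \<in> borel_measurable D" for t
    unfolding level_path_def by measurable
  have p01: "0 \<le> level_path M (\<lambda>k. lev M h k x) t" "level_path M (\<lambda>k. lev M h k x) t \<le> 1" for t x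
    using lev_mono[OF h] by (auto intro!: level_path01 simp: lev_ends)
  have ip: "integrable D (\<lambda>x. level_path M (\<lambda>k. lev M h k x) t)" for t
    by (rule integrable_const_bound[of _ 1]) (auto simp: p01 intro!: AE_I2)
  have e: "(\<integral>x. level_path M (\<lambda>k. lev M h k x) t \<partial>D) = q t" for t
  proof -
    have "(\<integral>x. level_path M (\<lambda>k. lev M h k x) t \<partial>D) = (\<Sum>k<Suc M. \<integral>x. (lev M h (Suc k) x - lev M h k x) * smooth (real (Suc M) * t - real k) \<partial>D)"
      unfolding level_path_def by (rule Bochner_Integration.integral_sum) (intro integrable_mult_left Bochner_Integration.integrable_diff il)
    also have "\<dots> = q t" unfolding q_def level_path_def
      by (rule sum.cong[OF refl]) (simp only: integral_mult_left_zero Bochner_Integration.integral_diff[OF il il])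
    finally show ?thesis .
  qed
  show "(\<integral>x. level_path M (\<lambda>k. lev M h k x) t \<partial>D) = q t" by (rule e)
  have ipx: "integrable D (\<lambda>x. level_path M (\<lambda>k. lev M h k x) t * x)"
    by (rule Bochner_Integration.integrable_bound[OF D(3)]) (auto simp: abs_mult p01 intro!: AE_I2 mult_left_le_one_le)
  have "h * (\<Sum>k\<in>{1..M}. q (min t (real k / real (Suc M)))) = (\<integral>x. h * (\<Sum>k\<in>{1..M}. level_path M (\<lambda>k. lev M h k x) (min t (real k / real (Suc M)))) \<partial>D)"
    unfolding e[symmetric] by (simp only: integral_mult_right_zero Bochner_Integration.integral_sum[OF ip])
  also have "\<dots> \<le> (\<integral>x. level_path M (\<lambda>k. lev M h k x) t * x \<partial>D)"
    by (rule integral_mono_AE[OF _ ipx])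
       (use D(4) acceptance_ge[OF h] in \<open>auto intro!: integrable_mult_right Bochner_Integration.integrable_sum ip elim!: eventually_mono\<close>)
  finally show "h * (\<Sum>k\<in>{1..M}. q (min t (real k / real (Suc M)))) \<le> (\<integral>x. level_path M (\<lambda>k. lev M h k x) t * x \<partial>D)" .
qed

lemma tail_tendsto_0:
  fixes D :: "real measure"
  assumes "integrable D (\<lambda>x. x)" "0 < h"
  shows "(\<lambda>M. \<integral>x. max (x - real M * h) 0 \<partial>D) \<longlonglongrightarrow> 0"
proof -
  have [measurable]: "(\<lambda>x. x) \<in> borel_measurable D" using assms by auto
  have "(\<lambda>M. \<integral>x. max (x - real M * h) 0 \<partial>D) \<longlonglongrightarrow> (\<integral>x. 0 \<partial>D)"
  proof (rule integral_dominated_convergence[where w = "\<lambda>x. \<bar>x\<bar>"])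
    show "integrable D (\<lambda>x. \<bar>x\<bar>)" using assms by simp
    show "AE x in D. (\<lambda>M. max (x - real M * h) 0) \<longlonglongrightarrow> 0"
    proof (intro AE_I2 tendsto_eventually)
      fix x
      obtain N where N: "x / h < real N" using reals_Archimedean2 by blast
      show "\<forall>\<^sub>F M in sequentially. max (x - real M * h) 0 = 0"
        using eventually_ge_at_top[of N]
      proof eventually_elim
        case (elim M)
        then have "x / h \<le> real M" using N by simp
        then show ?case using assms by (simp add: divide_simps)
      qed
    qed
    show "AE x in D. norm (max (x - real M * h) 0) \<le> \<bar>x\<bar>" for M
    proof (intro AE_I2)
      fix x
      have "0 \<le> real M * h" using assms by simp
      then show "norm (max (x - real M * h) 0) \<le> \<bar>x\<bar>" by (auto simp: max_def)
    qed
  qed auto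
  then show ?thesis by simp
qed

lemma expected_max_le_instance:
  assumes nD: "os_instance n D" and D: "\<And>i. i < n \<Longrightarrow> integrable (D i) (\<lambda>x. x)" and h: "0 < h"
  shows "expected_max n D \<le> ennreal (h + (\<Sum>k\<in>{1..M}. h * (1 - (\<Prod>i<n. 1 - measure (D i) {real k * h..})))
    + (\<Sum>i<n. \<integral>x. max (x - real M * h) 0 \<partial>D i))"
proof -
  define D' where "D' i = (if i < n then D i else return borel 0)" for i
  have D1: "prob_space (D i)" "sets (D i) = sets borel" if "i < n" for i
    using nD that by (auto simp: os_instance_def)
  interpret borel_family D'
  proof (rule borel_family.intro)
    show "prob_space (D' i)" for i by (cases "i < n") (simp_all add: D'_def D1 prob_space_return)
    show "sets (D' i) = sets borel" for i by (cases "i < n") (simp_all add: D'_def D1)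
  qed
  have v: "values_measure n D = values_measure n D'"
    unfolding values_measure_def by (rule PiM_cong) (simp_all add: D'_def)
  have "0 < n" using nD by (simp add: os_instance_def)
  then have "expected_max n D' \<le> ennreal (h + (\<Sum>k\<in>{1..M}. h * (1 - (\<Prod>i<n. 1 - measure (D' i) {real k * h..})))
    + (\<Sum>i<n. \<integral>x. max (x - real M * h) 0 \<partial>D' i))"
    by (intro expected_max_le h) (simp_all add: D'_def D)
  moreover have "(\<Prod>i<n. 1 - measure (D' i) {real k * h..}) = (\<Prod>i<n. 1 - measure (D i) {real k * h..})" for k
    by (rule prod.cong) (simp_all add: D'_def)
  moreover have "(\<Sum>i<n. \<integral>x. max (x - real M * h) 0 \<partial>D' i) = (\<Sum>i<n. \<integral>x. max (x - real M * h) 0 \<partial>D i)"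
    by (rule sum.cong) (simp_all add: D'_def)
  ultimately show ?thesis unfolding expected_max_def v by simp
qed

text \<open>Reduces the theorem to increasing C^1 paths from 0 to 1 and one inequality per level s.
  Weighting the inequality at the M grid levels by h and summing turns chances of exceeding levels
  into expectations.\<close>

theorem competitive_from_design:
  assumes design: "\<And>n q q'. 1 < n \<Longrightarrow> (\<And>i t. i < n \<Longrightarrow> (q i has_real_derivative q' i t) (at t)) \<Longrightarrow>
      (\<And>i. i < n \<Longrightarrow> continuous_on UNIV (q' i)) \<Longrightarrow> (\<And>i t. i < n \<Longrightarrow> 0 \<le> q' i t) \<Longrightarrow>
      (\<And>i t. i < n \<Longrightarrow> 0 \<le> q i t \<and> q i t \<le> 1) \<Longrightarrow> (\<And>i. i < n \<Longrightarrow> q i 0 = 0) \<Longrightarrow> (\<And>i. i < n \<Longrightarrow> q i 1 = 1) \<Longrightarrow>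
      \<exists>c f d \<sigma> a. fluid_design n c f d \<sigma> a \<and>
        (\<forall>s. 0 \<le> s \<longrightarrow> s \<le> 1 \<longrightarrow> \<Gamma> * (1 - (\<Prod>i<n. 1 - q i s)) \<le> fluid_reward n q c f d \<sigma> a s)"
    and \<Gamma>: "0 \<le> \<Gamma>" "\<Gamma> \<le> 1"
  shows "\<exists>A. os_algorithm A \<and> competitive \<Gamma> A"
proof (rule competitiveI[OF _ \<Gamma>(1)])
  fix n D and \<epsilon> :: real
  assume nD: "os_instance n D" and int: "\<And>i. i < n \<Longrightarrow> integrable (D i) (\<lambda>x. x)" and \<epsilon>: "0 < \<epsilon>"
  have n: "1 < n" and D: "prob_space (D i)" "sets (D i) = sets borel" "AE x in D i. 0 \<le> x" if "i < n" for i
    using nD that by (auto simp: os_instance_def)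
  have n: "1 < n" using nD by (simp add: os_instance_def)
  \<comment> \<open>Rounding to the grid, the overflow and the time discretisation cost at most h
    each.\<close>
  define h where "h = \<epsilon> / 4"
  have h: "0 < h" using \<epsilon> by (simp add: h_def)
  have "(\<lambda>M. \<Sum>i<n. \<integral>x. max (x - real M * h) 0 \<partial>D i) \<longlonglongrightarrow> (\<Sum>i<n. 0)"
    by (intro tendsto_sum tail_tendsto_0 int h) auto
  then have "\<forall>\<^sub>F M in sequentially. (\<Sum>i<n. \<integral>x. max (x - real M * h) 0 \<partial>D i) < h"
    by (rule order_tendstoD(2)) (use h in simp)
  then obtain M where M: "(\<Sum>i<n. \<integral>x. max (x - real M * h) 0 \<partial>D i) < h"
    using eventually_happens'[OF sequentially_bot] by blast
  define q where "q i = level_path M (\<lambda>k. \<integral>x. lev M h k x \<partial>D i)" for i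
  define tk where "tk k = real k / real (Suc M)" for k
  have lm: "(\<integral>x. lev M h k x \<partial>D i) \<le> (\<integral>x. lev M h (Suc k) x \<partial>D i)" "(\<integral>x. lev M h 0 x \<partial>D i) = 0" "(\<integral>x. lev M h (Suc M) x \<partial>D i) = 1"
    if i: "i < n" and k: "k \<le> M" for i k
  proof -
    interpret Di: prob_space "D i" by (rule D(1)[OF i])
    have [measurable]: "lev M h k \<in> borel_measurable (D i)" for k using D(2)[OF i] by (simp cong: measurable_cong_sets)
    have il: "integrable (D i) (lev M h k)" for k
      by (rule Di.integrable_const_bound[of _ 1]) (auto simp: lev01 intro!: AE_I2)
    show "(\<integral>x. lev M h k x \<partial>D i) \<le> (\<integral>x. lev M h (Suc k) x \<partial>D i)"
      by (intro integral_mono il lev_mono h k)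
    show "(\<integral>x. lev M h 0 x \<partial>D i) = 0" "(\<integral>x. lev M h (Suc M) x \<partial>D i) = 1" by (simp_all add: Di.prob_space lev_ends)
  qed
  have q01: "0 \<le> q i t \<and> q i t \<le> 1" if i: "i < n" for i t
    unfolding q_def
    using level_path01[where e = "\<lambda>k. \<integral>x. lev M h k x \<partial>D i", OF lm(1)[OF i] lm(2)[OF i le0] lm(3)[OF i le0], of t] by blast
  have qk: "q i (tk k) = (\<integral>x. lev M h k x \<partial>D i)" if "i < n" "k \<le> Suc M" for i k
    using level_path_knot[OF that(2), of "\<lambda>k. \<integral>x. lev M h k x \<partial>D i"] lm(2)[OF that(1) le0] unfolding q_def tk_def by simp
  have q0: "q i 0 = 0" and q1: "q i 1 = 1" if "i < n" for i
    using qk[OF that, of 0] qk[OF that, of "Suc M"] lm(2,3)[OF that, of 0] by (simp_all add: tk_def del: of_nat_Suc)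
  have qd: "(q i has_real_derivative level_path' M (\<lambda>k. \<integral>x. lev M h k x \<partial>D i) t) (at t)" for i t
    unfolding q_def by (rule level_path_deriv)
  have qn: "0 \<le> level_path' M (\<lambda>k. \<integral>x. lev M h k x \<partial>D i) t" if "i < n" for i t
    by (rule level_path'_nonneg) (rule lm(1)[OF that])
  have "\<exists>c f d \<sigma> a. fluid_design n c f d \<sigma> a \<and>
        (\<forall>s. 0 \<le> s \<longrightarrow> s \<le> 1 \<longrightarrow> \<Gamma> * (1 - (\<Prod>i<n. 1 - q i s)) \<le> fluid_reward n q c f d \<sigma> a s)"
    by (rule design[OF n qd level_path'_cont qn q01 q0 q1])
  then obtain c f d \<sigma> a where des: "fluid_design n c f d \<sigma> a"
    and rew: "\<And>s. 0 \<le> s \<Longrightarrow> s \<le> 1 \<Longrightarrow> \<Gamma> * (1 - (\<Prod>i<n. 1 - q i s)) \<le> fluid_reward n q c f d \<sigma> a s" by blast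
  \<comment> \<open>Summed over M levels of weight h this error is at most h; the 1 keeps the
    denominator positive when M = 0.\<close>
  define \<epsilon>' where "\<epsilon>' = h / (real M * h + 1)"
  have pos: "0 < real M * h + 1" using h by (simp add: add_nonneg_pos)
  have \<epsilon>'1: "0 < \<epsilon>'" unfolding \<epsilon>'_def using h pos by simp
  have \<epsilon>'2: "real M * h * \<epsilon>' \<le> h"
    unfolding \<epsilon>'_def times_divide_eq_right pos_divide_le_eq[OF pos] using h by (simp add: algebra_simps)
  note \<epsilon>' = \<epsilon>'1 \<epsilon>'2
  have "\<exists>(N::nat) p s. (\<forall>i<n. (\<forall>\<tau>. 0 \<le> p i \<tau>) \<and> (\<Sum>\<tau><N. p i \<tau>) \<le> 1) \<and> (\<forall>\<tau>. 0 \<le> s \<tau> \<and> s \<tau> \<le> 1) \<and>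
    (\<forall>k\<in>{1..M}. fluid_reward n q c f d \<sigma> a (tk k) - \<epsilon>' \<le>
      (\<Sum>i<n. \<Sum>\<tau><N. p i \<tau> * q i (min (s \<tau>) (tk k)) * (\<Prod>l\<in>{..<n}-{i}. 1 - (\<Sum>\<tau>'\<in>{..\<tau>}. p l \<tau>' * q l (s \<tau>')))))"
  proof (rule discretize[OF _ _ q01 des _ _ \<epsilon>'(1)])
    show "continuous_on {0..1} (q i)" for i
      by (intro continuous_at_imp_continuous_on ballI DERIV_isCont[OF qd])
    show "q i s \<le> q i t" if "i < n" "s \<le> t" for i s t
      unfolding q_def by (rule level_path_mono[where e = "\<lambda>k. \<integral>x. lev M h k x \<partial>D i", OF lm(1)[OF that(1)] that(2)])
    show "0 \<le> tk k \<and> tk k \<le> 1" if "k \<in> {1..M}" for k using that by (simp add: tk_def)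
  qed auto
  then obtain N :: nat and p :: "nat \<Rightarrow> nat \<Rightarrow> real" and s :: "nat \<Rightarrow> real" where p: "\<And>i \<tau>. i < n \<Longrightarrow> 0 \<le> p i \<tau>" "\<And>i. i < n \<Longrightarrow> (\<Sum>\<tau><N. p i \<tau>) \<le> 1"
    and s: "\<And>\<tau>. 0 \<le> s \<tau> \<and> s \<tau> \<le> 1"
    and lower: "\<And>k. k \<in> {1..M} \<Longrightarrow> fluid_reward n q c f d \<sigma> a (tk k) - \<epsilon>' \<le>
      (\<Sum>i<n. \<Sum>\<tau><N. p i \<tau> * q i (min (s \<tau>) (tk k)) * (\<Prod>l\<in>{..<n}-{i}. 1 - (\<Sum>\<tau>'\<in>{..\<tau>}. p l \<tau>' * q l (s \<tau>'))))"
    by blast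
  define \<alpha> where "\<alpha> \<tau> x = level_path M (\<lambda>k. lev M h k x) (s \<tau>)" for \<tau> x
  have \<alpha>m: "\<alpha> \<tau> \<in> borel_measurable borel" for \<tau> unfolding \<alpha>_def[abs_def] level_path_def by measurable
  have \<alpha>01: "0 \<le> \<alpha> \<tau> x \<and> \<alpha> \<tau> x \<le> 1" for \<tau> x
    unfolding \<alpha>_def using lev_mono[OF h] by (intro conjI level_path01) (auto simp: lev_ends)
  have Q: "(\<integral>x. \<alpha> \<tau> x \<partial>D l) = q l (s \<tau>)" if "l < n" for l \<tau>
    unfolding \<alpha>_def q_def using D[OF that] int[OF that] h by (intro acceptance_integrals)
  have r: "h * (\<Sum>k\<in>{1..M}. q i (min (s \<tau>) (tk k))) \<le> (\<integral>x. \<alpha> \<tau> x * x \<partial>D i)" if "i < n" for i \<tau>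
    unfolding \<alpha>_def q_def tk_def using D[OF that] int[OF that] h by (intro acceptance_integrals)
  have "\<exists>\<pi>. distinct \<pi> \<and> set \<pi> = {..<n} \<and>
    (\<Sum>i<n. \<Sum>\<tau><N. p i \<tau> * (\<integral>x. \<alpha> \<tau> x * x \<partial>D i) * (\<Prod>l\<in>{..<n}-{i}. 1 - (\<Sum>\<tau>'\<in>{..\<tau>}. p l \<tau>' * (\<integral>x. \<alpha> \<tau>' x \<partial>D l)))) \<le> oval D \<pi>"
    by (rule order_exists[where \<alpha> = "\<lambda>i. \<alpha>", OF _ \<alpha>m \<alpha>01 p]) (use D int in blast)+
  then obtain \<pi> where \<pi>: "distinct \<pi>" "set \<pi> = {..<n}" and ov:
    "(\<Sum>i<n. \<Sum>\<tau><N. p i \<tau> * (\<integral>x. \<alpha> \<tau> x * x \<partial>D i) * (\<Prod>l\<in>{..<n}-{i}. 1 - (\<Sum>\<tau>'\<in>{..\<tau>}. p l \<tau>' * (\<integral>x. \<alpha> \<tau>' x \<partial>D l)))) \<le> oval D \<pi>"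
    by blast
  define P where "P i \<tau> = (\<Prod>l\<in>{..<n}-{i}. 1 - (\<Sum>\<tau>'\<in>{..\<tau>}. p l \<tau>' * q l (s \<tau>')))" for i \<tau>
  have P0: "0 \<le> P i \<tau>" if "\<tau> < N" for i \<tau>
    unfolding P_def
  proof (rule prod_nonneg)
    fix l assume l: "l \<in> {..<n}-{i}"
    have "(\<Sum>\<tau>'\<in>{..\<tau>}. p l \<tau>' * q l (s \<tau>')) \<le> (\<Sum>\<tau>'\<in>{..\<tau>}. p l \<tau>')"
      using p(1)[of l] q01[of l] l by (intro sum_mono mult_left_le) auto
    also have "\<dots> \<le> (\<Sum>\<tau>'<N. p l \<tau>')" using p(1)[of l] l that by (intro sum_mono2) auto
    also have "\<dots> \<le> 1" using p(2)[of l] l by simp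
    finally show "0 \<le> 1 - (\<Sum>\<tau>'\<in>{..\<tau>}. p l \<tau>' * q l (s \<tau>'))" by simp
  qed
  have "(\<Sum>k\<in>{1..M}. h * (\<Gamma> * (1 - (\<Prod>i<n. 1 - q i (tk k))) - \<epsilon>'))
    \<le> (\<Sum>k\<in>{1..M}. h * (\<Sum>i<n. \<Sum>\<tau><N. p i \<tau> * q i (min (s \<tau>) (tk k)) * P i \<tau>))"
  proof (intro sum_mono mult_left_mono)
    fix k assume k: "k \<in> {1..M}"
    then have "0 \<le> tk k" "tk k \<le> 1" by (simp_all add: tk_def)
    then show "\<Gamma> * (1 - (\<Prod>i<n. 1 - q i (tk k))) - \<epsilon>' \<le> (\<Sum>i<n. \<Sum>\<tau><N. p i \<tau> * q i (min (s \<tau>) (tk k)) * P i \<tau>)"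
      using rew[of "tk k"] lower[OF k] unfolding P_def by linarith
  qed (use h in simp)
  also have "\<dots> = (\<Sum>i<n. \<Sum>\<tau><N. p i \<tau> * (h * (\<Sum>k\<in>{1..M}. q i (min (s \<tau>) (tk k)))) * P i \<tau>)"
    unfolding sum_distrib_left sum_distrib_right
    by (subst sum.swap, rule sum.cong[OF refl], subst sum.swap, rule sum.cong[OF refl], rule sum.cong[OF refl]) (simp only: mult_ac)
  also have "\<dots> \<le> (\<Sum>i<n. \<Sum>\<tau><N. p i \<tau> * (\<integral>x. \<alpha> \<tau> x * x \<partial>D i) * P i \<tau>)"
    by (intro sum_mono mult_right_mono mult_left_mono r p(1) P0) auto
  also have "\<dots> = (\<Sum>i<n. \<Sum>\<tau><N. p i \<tau> * (\<integral>x. \<alpha> \<tau> x * x \<partial>D i) * (\<Prod>l\<in>{..<n}-{i}. 1 - (\<Sum>\<tau>'\<in>{..\<tau>}. p l \<tau>' * (\<integral>x. \<alpha> \<tau>' x \<partial>D l))))"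
    unfolding P_def by (rule sum.cong[OF refl], rule sum.cong[OF refl], rule arg_cong2[where f = "(*)", OF refl], rule prod.cong[OF refl]) (simp add: Q)
  finally have low: "(\<Sum>k\<in>{1..M}. h * (\<Gamma> * (1 - (\<Prod>i<n. 1 - q i (tk k))) - \<epsilon>')) \<le> oval D \<pi>" using ov by linarith
  define X where "X = (\<Sum>k\<in>{1..M}. h * (1 - (\<Prod>i<n. 1 - measure (D i) {real k * h..})))"
  have X: "X = (\<Sum>k\<in>{1..M}. h * (1 - (\<Prod>i<n. 1 - q i (tk k))))"
  proof -
    \<comment> \<open>Level k belongs to the grid point M + 1 - k, so the sum is reversed.\<close>
    have "X = (\<Sum>k\<in>{1..M}. h * (1 - (\<Prod>i<n. 1 - measure (D i) {real (M + 1 - k) * h..})))"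
      unfolding X_def by (rule sum.atLeastAtMost_rev)
    also have "\<dots> = (\<Sum>k\<in>{1..M}. h * (1 - (\<Prod>i<n. 1 - q i (tk k))))"
    proof (rule sum.cong[OF refl])
      fix k assume k: "k \<in> {1..M}"
      have "measure (D i) {real (M + 1 - k) * h..} = q i (tk k)" if i: "i < n" for i
      proof -
        have "lev M h k = indicator {real (M + 1 - k) * h..}" using k by (auto simp: lev_def fun_eq_iff)
        then have "(\<integral>x. lev M h k x \<partial>D i) = measure (D i) ({real (M + 1 - k) * h..} \<inter> space (D i))" by simp
        also have "space (D i) = UNIV" using sets_eq_imp_space_eq[OF D(2)[OF i]] by simp
        finally show ?thesis using qk[OF i, of k] k by simp
      qed
      then have "(\<Prod>i<n. 1 - measure (D i) {real (M + 1 - k) * h..}) = (\<Prod>i<n. 1 - q i (tk k))"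
        by (intro prod.cong) auto
      then show "h * (1 - (\<Prod>i<n. 1 - measure (D i) {real (M + 1 - k) * h..})) = h * (1 - (\<Prod>i<n. 1 - q i (tk k)))"
        by simp
    qed
    finally show ?thesis .
  qed
  have "(\<Sum>k\<in>{1..M}. h * (\<Gamma> * (1 - (\<Prod>i<n. 1 - q i (tk k))) - \<epsilon>')) = \<Gamma> * X - real M * h * \<epsilon>'"
    unfolding X by (simp add: sum_distrib_left sum_subtractf right_diff_distrib mult_ac)
  then have 1: "\<Gamma> * X \<le> oval D \<pi> + h" using low \<epsilon>'(2) by linarith
  define Tl where "Tl = (\<Sum>i<n. \<integral>x. max (x - real M * h) 0 \<partial>D i)"
  have Tl0: "0 \<le> Tl" unfolding Tl_def by (intro sum_nonneg integral_nonneg_AE) auto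
  have X0: "0 \<le> X" unfolding X using h q01 by (intro sum_nonneg mult_nonneg_nonneg) (auto intro!: prod_le_1)
  have "\<Gamma> * (h + Tl) \<le> 1 * (h + Tl)" using \<Gamma> h Tl0 by (intro mult_right_mono) auto
  then have "\<Gamma> * (h + X + Tl) \<le> oval D \<pi> + 3 * h" using 1 M unfolding Tl_def[symmetric] by (simp add: algebra_simps)
  then have 2: "\<Gamma> * (h + X + Tl) \<le> oval D \<pi> + \<epsilon>" using \<epsilon> by (simp add: h_def)
  have "ennreal \<Gamma> * expected_max n D \<le> ennreal \<Gamma> * ennreal (h + X + Tl)"
    unfolding X_def Tl_def by (intro mult_left_mono expected_max_le_instance nD int h) auto
  also have "\<dots> = ennreal (\<Gamma> * (h + X + Tl))" using \<Gamma> h X0 Tl0 by (intro ennreal_mult[symmetric]) auto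
  also have "\<dots> \<le> ennreal (oval D \<pi> + \<epsilon>)" by (rule ennreal_leI[OF 2])
  finally show "\<exists>\<pi>. distinct \<pi> \<and> set \<pi> = {..<n} \<and> ennreal \<Gamma> * expected_max n D \<le> ennreal (oval D \<pi> + \<epsilon>)"
    using \<pi> by blast
qed

section \<open>Numerical estimates\<close>

text \<open>For an item with own acceptance probability y, and z the product of 1 - q over the
  others, the chance S that nothing is sold satisfies S \<ge> \<open>aa G z\<close> + (1 - y) *
  \<open>qq G z\<close>. Thus \<open>aa\<close> belongs to y = 1 and \<open>AA\<close> to y = 0.
  Differences of \<open>PP\<close> bound the mass gathered with y = 0 while z falls; its lower limit
  lies below all points at which it is evaluated.\<close>

definition aa :: "real \<Rightarrow> real \<Rightarrow> real" where "aa G z = 1 - G + G * z"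
definition qq :: "real \<Rightarrow> real \<Rightarrow> real" where "qq G z = - (G * z * ln z)"
definition AA :: "real \<Rightarrow> real \<Rightarrow> real" where "AA G z = aa G z + qq G z"
definition PP :: "real \<Rightarrow> real \<Rightarrow> real" where "PP G z = integral {1/10..z} (\<lambda>x. G / AA G x)"

lemma AA_alt: "AA G z = 1 - G + G * (z * (1 - ln z))"
  by (simp add: AA_def aa_def qq_def algebra_simps)

lemma AA_pos: assumes "0 < G" "G < 1" "0 < z" "z \<le> 2" shows "AA G z > 0"
proof -
  have "ln z \<le> z - 1" using assms by (simp add: ln_le_minus_one)
  moreover have "ln z \<le> 1" 
  proof -
    have "ln z \<le> ln 2" using assms by simp
    also have "ln (2::real) \<le> 25/36" by (rule ln2_le_25_over_36)
    finally show ?thesis by simp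
  qed
  ultimately have "0 \<le> z * (1 - ln z)" using assms by simp
  then have "0 \<le> G * (z * (1 - ln z))" using assms by simp
  then show ?thesis unfolding AA_alt using assms by linarith
qed

lemma continuous_on_AA: "continuous_on {0<..} (AA G)"
  unfolding AA_def aa_def qq_def by (intro continuous_intros) auto

lemma AA_deriv: "0 < z \<Longrightarrow> (AA G has_real_derivative - (G * ln z)) (at z)"
  unfolding AA_def[abs_def] aa_def qq_def
  by (auto intro!: derivative_eq_intros simp: field_simps)

lemma PP_deriv: assumes "0 < G" "G < 1" "1/10 < z" "z < 2"
  shows "(PP G has_real_derivative G / AA G z) (at z)"
proof -
  have c: "continuous_on {1/10..2} (\<lambda>x. G / AA G x)"
    by (intro continuous_intros continuous_on_subset[OF continuous_on_AA])
       (auto dest!: AA_pos[OF assms(1,2), rotated] simp: less_imp_neq)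
  have "((\<lambda>u. integral {1/10..u} (\<lambda>x. G / AA G x)) has_real_derivative G / AA G z) (at z within {1/10..2})"
    by (rule integral_has_real_derivative[OF c]) (use assms in auto)
  moreover have "at z within {1/10..2} = at z"
    by (rule at_within_interior) (use assms in \<open>auto simp: interior_atLeastAtMost_real\<close>)
  ultimately show ?thesis by (simp add: PP_def[abs_def])
qed

lemma AA_concave: assumes "0 < G" shows "concave_on {0<..} (AA G)"
proof (rule f''_le0_imp_concave)
  show "convex {0::real<..}" by simp
  show "(AA G has_real_derivative - (G * ln x)) (at x)" if "x \<in> {0<..}" for x
    using that by (intro AA_deriv) auto
  show "((\<lambda>x. - (G * ln x)) has_real_derivative - (G / x)) (at x)" if "x \<in> {0<..}" for x
    using that by (auto intro!: derivative_eq_intros)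
  show "- (G / x) \<le> 0" if "x \<in> {0<..}" for x using that assms by auto
qed

text \<open>The trapezoidal rule overestimates the integral of the convex function \<open>G / AA G\<close>.\<close>

lemma PP_step:
  assumes G: "0 < G" "G < 1" and ab: "1/10 < a" "a < b" "b \<le> 1"
    and La: "La \<le> - ln a" "0 \<le> La" and Lb: "Lb \<le> - ln b" "0 \<le> Lb"
  shows "PP G b - PP G a \<le> (b - a) / 2 * (G / (aa G a + G * a * La) + G / (aa G b + G * b * Lb))"
proof -
  define p where "p = aa G a + G * a * La"
  define r where "r = aa G b + G * b * Lb"
  have pos: "p > 0" "r > 0" unfolding p_def r_def aa_def using G ab La Lb 
    by (auto intro!: add_pos_nonneg)
  have p: "p \<le> AA G a" and r: "r \<le> AA G b" 
    using mult_left_mono[OF La(1), of "G * a"] mult_left_mono[OF Lb(1), of "G * b"] G ab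
    by (auto simp: p_def r_def AA_def qq_def)
  define u where "u z = (z - a) / (b - a)" for z
  \<comment> \<open>By concavity \<open>AA\<close> lies above its chord, hence above the chord
    through p and r; the reciprocal of a chord lies below the chord of the reciprocals.\<close>
  have bnd: "G / AA G z \<le> G * ((1 - u z) / p + u z / r)" if z: "z \<in> {a..b}" for z
  proof -
    have u: "0 \<le> u z" "u z \<le> 1" using z ab by (auto simp: u_def field_simps)
    have "u z * (b - a) = z - a" using ab by (simp add: u_def)
    then have zu: "z = (1 - u z) * a + u z * b" by (simp add: algebra_simps)
    have "AA G z \<ge> (1 - u z) * AA G a + u z * AA G b"
      using concave_onD[OF AA_concave[OF G(1)], of "u z" a b] u ab zu by simp
    moreover have "(1 - u z) * AA G a \<ge> (1 - u z) * p" "u z * AA G b \<ge> u z * r"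
      using p r u by (auto intro: mult_left_mono)
    ultimately have A: "AA G z \<ge> (1 - u z) * p + u z * r" by linarith
    have c: "(1 - u z) * p + u z * r > 0"
    proof (cases "u z = 0")
      case False with u pos show ?thesis by (intro add_nonneg_pos) auto
    qed (use pos in auto)
    have "1 / ((1 - u z) * p + u z * r) \<le> (1 - u z) / p + u z / r"
    proof -
      have "((1 - u z) * p + u z * r) * ((1 - u z) * r + u z * p) - p * r = u z * (1 - u z) * (p - r)^2"
        by (simp add: algebra_simps power2_eq_square)
      moreover have "u z * (1 - u z) * (p - r)^2 \<ge> 0" using u by simp
      ultimately have "p * r \<le> ((1 - u z) * p + u z * r) * ((1 - u z) * r + u z * p)" by linarith
      then have e1: "1 \<le> ((1 - u z) * p + u z * r) * (((1 - u z) * r + u z * p) / (p * r))"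
        using pos by (simp add: field_simps)
      have e2: "((1 - u z) * r + u z * p) / (p * r) = (1 - u z) / p + u z / r"
        using pos by (simp add: field_simps)
      show ?thesis unfolding pos_divide_le_eq[OF c] using e1[unfolded e2] by (simp only: mult.commute)
    qed
    moreover have "1 / AA G z \<le> 1 / ((1 - u z) * p + u z * r)"
      using A c by (intro divide_left_mono) auto
    ultimately have "1 / AA G z \<le> (1 - u z) / p + u z / r" by linarith
    then have "G * (1 / AA G z) \<le> G * ((1 - u z) / p + u z / r)" using G by (intro mult_left_mono) auto
    then show ?thesis by simp
  qed
  define d where "d = 1 / (b - a) / 2"
  define ip where "ip = 1 / p"
  define ir where "ir = 1 / r"
  have uc: "u z = (z - a) * (2 * d)" for z unfolding u_def d_def using ab by (simp add: divide_simps) (simp add: algebra_simps)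
  define H where "H z = G * ((z - (z - a)^2 * d) * ip + (z - a)^2 * d * ir)" for z
  have dH: "(H has_real_derivative G * ((1 - u z) / p + u z / r)) (at z)" for z
  proof -
    have "(H has_real_derivative G * ((1 - u z) * ip + u z * ir)) (at z)"
      unfolding H_def[abs_def] uc
      by (auto intro!: derivative_eq_intros simp: algebra_simps)
    then show ?thesis by (simp add: ip_def ir_def)
  qed
  have "(\<lambda>z. H z - PP G z) a \<le> (\<lambda>z. H z - PP G z) b"
  proof (rule DERIV_nonneg_imp_nondecreasing[where f = "\<lambda>z. H z - PP G z"])
    fix z assume z: "a \<le> z" "z \<le> b"
    have "((\<lambda>z. H z - PP G z) has_real_derivative (G * ((1 - u z) / p + u z / r) - G / AA G z)) (at z)"
      using z ab by (intro DERIV_diff dH PP_deriv G) auto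
    then show "\<exists>y. ((\<lambda>z. H z - PP G z) has_real_derivative y) (at z) \<and> 0 \<le> y"
      using bnd[of z] z by (intro exI[of _ "G * ((1 - u z) / p + u z / r) - G / AA G z"] conjI) simp_all
  qed (use ab in simp)
  moreover have "H b - H a = (b - a) / 2 * (G / p + G / r)"
  proof -
    have cb: "(b - a) * d = 1 / 2" using ab by (simp add: d_def)
    have "H b - H a = G * ((b - a - (b - a) * ((b - a) * d)) * ip + (b - a) * ((b - a) * d) * ir)"
      unfolding H_def by (simp add: algebra_simps power2_eq_square)
    also have "\<dots> = (b - a) / 2 * (G * ip + G * ir)" unfolding cb by (simp add: field_simps)
    finally show ?thesis by (simp add: ip_def ir_def)
  qed
  ultimately show ?thesis unfolding p_def r_def by simp
qed

text \<open>Partial sums of the series of 2 * artanh((1 - z) / (1 + z)), all of whose terms are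
  positive.\<close>

lemma ln_lower: assumes "0 < z" "z < 1"
  shows "(\<Sum>k<n. 2 * ((1 - z) / (1 + z))^(2*k+1) / real (2*k+1)) \<le> - ln z"
proof -
  have e: "(1 / z - 1) / (1 / z + 1) = (1 - z) / (1 + z)" using assms by (auto simp: divide_simps)
  have "ln (1 / z) \<ge> (\<Sum>k<n. 2 * ((1 / z - 1) / (1 / z + 1))^(2*k+1) / real (2*k+1))"
    using ln_approx_bounds[of "1 / z" n] assms by auto
  then show ?thesis using assms by (simp add: e ln_div)
qed

section \<open>Trapezoidal tables for the rates 0.7258 and 0.757\<close>

lemma tabA_ln0: "1.558268 \<le> - ln (0.2105::real)"
  by (rule order_trans[OF _ ln_lower[of _ 13]]) (simp_all add: eval_nat_numeral)

lemma tabA_ln1: "1.52785 \<le> - ln (0.217::real)"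
  by (rule order_trans[OF _ ln_lower[of _ 11]]) (simp_all add: eval_nat_numeral)

lemma tabA_ln2: "1.47403 \<le> - ln (0.229::real)"
  by (rule order_trans[OF _ ln_lower[of _ 11]]) (simp_all add: eval_nat_numeral)

lemma tabA_ln3: "1.40649 \<le> - ln (0.245::real)"
  by (rule order_trans[OF _ ln_lower[of _ 10]]) (simp_all add: eval_nat_numeral)

lemma tabA_ln4: "1.3318 \<le> - ln (0.264::real)"
  by (rule order_trans[OF _ ln_lower[of _ 9]]) (simp_all add: eval_nat_numeral)

lemma tabA_ln5: "1.25526 \<le> - ln (0.285::real)"
  by (rule order_trans[OF _ ln_lower[of _ 9]]) (simp_all add: eval_nat_numeral)

lemma tabA_ln6: "1.17441 \<le> - ln (0.309::real)"
  by (rule order_trans[OF _ ln_lower[of _ 8]]) (simp_all add: eval_nat_numeral)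

lemma tabA_ln7: "1.09661 \<le> - ln (0.334::real)"
  by (rule order_trans[OF _ ln_lower[of _ 8]]) (simp_all add: eval_nat_numeral)

lemma tabA_ln8: "1.01611 \<le> - ln (0.362::real)"
  by (rule order_trans[OF _ ln_lower[of _ 8]]) (simp_all add: eval_nat_numeral)

lemma tabA_ln9: "0.93904 \<le> - ln (0.391::real)"
  by (rule order_trans[OF _ ln_lower[of _ 6]]) (simp_all add: eval_nat_numeral)

lemma tabA_ln10: "0.86274 \<le> - ln (0.422::real)"
  by (rule order_trans[OF _ ln_lower[of _ 6]]) (simp_all add: eval_nat_numeral)

lemma tabA_ln11: "0.78745 \<le> - ln (0.455::real)"
  by (rule order_trans[OF _ ln_lower[of _ 5]]) (simp_all add: eval_nat_numeral)

lemma tabA_ln12: "0.71539 \<le> - ln (0.489::real)"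
  by (rule order_trans[OF _ ln_lower[of _ 5]]) (simp_all add: eval_nat_numeral)

lemma tabA_ln13: "0.64435 \<le> - ln (0.525::real)"
  by (rule order_trans[OF _ ln_lower[of _ 4]]) (simp_all add: eval_nat_numeral)

lemma tabA_ln14: "0.57625 \<le> - ln (0.562::real)"
  by (rule order_trans[OF _ ln_lower[of _ 4]]) (simp_all add: eval_nat_numeral)

lemma tabA_ln15: "0.51082 \<le> - ln (0.6::real)"
  by (rule order_trans[OF _ ln_lower[of _ 4]]) (simp_all add: eval_nat_numeral)

lemma tabA_ln16: "0.44628 \<le> - ln (0.64::real)"
  by (rule order_trans[OF _ ln_lower[of _ 4]]) (simp_all add: eval_nat_numeral)

lemma tabA_ln17: "0.38419 \<le> - ln (0.681::real)"
  by (rule order_trans[OF _ ln_lower[of _ 3]]) (simp_all add: eval_nat_numeral)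

lemma tabA_ln18: "0.32434 \<le> - ln (0.723::real)"
  by (rule order_trans[OF _ ln_lower[of _ 3]]) (simp_all add: eval_nat_numeral)

lemma tabA_ln19: "0.26657 \<le> - ln (0.766::real)"
  by (rule order_trans[OF _ ln_lower[of _ 3]]) (simp_all add: eval_nat_numeral)

lemma tabA_ln20: "0.20948 \<le> - ln (0.811::real)"
  by (rule order_trans[OF _ ln_lower[of _ 2]]) (simp_all add: eval_nat_numeral)

lemma tabA_ln21: "0.15548 \<le> - ln (0.856::real)"
  by (rule order_trans[OF _ ln_lower[of _ 2]]) (simp_all add: eval_nat_numeral)

lemma tabA_ln22: "0.10203 \<le> - ln (0.903::real)"
  by (rule order_trans[OF _ ln_lower[of _ 2]]) (simp_all add: eval_nat_numeral)

lemma tabA_ln23: "0.05024 \<le> - ln (0.951::real)"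
  by (rule order_trans[OF _ ln_lower[of _ 2]]) (simp_all add: eval_nat_numeral)

text \<open>The numerical heart of the constant 0.7258: this is the mass of an item with y = 0 until
  z = 0.2105. It leaves 0.3561095 for the rest of the course, slightly less than the value 0.3578
  that the potential for y = 1 asks for. The mesh is graded, with the shortest steps at small
  z.\<close>

lemma tabA_bound: "PP 0.7258 1 - PP 0.7258 0.2105 \<le> 0.6438905"
proof -
  have s0: "PP 0.7258 0.217 - PP 0.7258 0.2105 \<le> 0.0070554"
    by (rule order_trans[OF PP_step[of "0.7258" "0.2105" "0.217" "1.558268" "1.52785"]])
      (use tabA_ln0 tabA_ln1 in \<open>simp_all add: aa_def\<close>)
  have s1: "PP 0.7258 0.229 - PP 0.7258 0.217 \<le> 0.0128308"
    by (rule order_trans[OF PP_step[of "0.7258" "0.217" "0.229" "1.52785" "1.47403"]])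
      (use tabA_ln1 tabA_ln2 in \<open>simp_all add: aa_def\<close>)
  have s2: "PP 0.7258 0.245 - PP 0.7258 0.229 \<le> 0.0167413"
    by (rule order_trans[OF PP_step[of "0.7258" "0.229" "0.245" "1.47403" "1.40649"]])
      (use tabA_ln2 tabA_ln3 in \<open>simp_all add: aa_def\<close>)
  have s3: "PP 0.7258 0.264 - PP 0.7258 0.245 \<le> 0.0193836"
    by (rule order_trans[OF PP_step[of "0.7258" "0.245" "0.264" "1.40649" "1.3318"]])
      (use tabA_ln3 tabA_ln4 in \<open>simp_all add: aa_def\<close>)
  have s4: "PP 0.7258 0.285 - PP 0.7258 0.264 \<le> 0.0208586"
    by (rule order_trans[OF PP_step[of "0.7258" "0.264" "0.285" "1.3318" "1.25526"]])
      (use tabA_ln4 tabA_ln5 in \<open>simp_all add: aa_def\<close>)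
  have s5: "PP 0.7258 0.309 - PP 0.7258 0.285 \<le> 0.0231906"
    by (rule order_trans[OF PP_step[of "0.7258" "0.285" "0.309" "1.25526" "1.17441"]])
      (use tabA_ln5 tabA_ln6 in \<open>simp_all add: aa_def\<close>)
  have s6: "PP 0.7258 0.334 - PP 0.7258 0.309 \<le> 0.0235033"
    by (rule order_trans[OF PP_step[of "0.7258" "0.309" "0.334" "1.17441" "1.09661"]])
      (use tabA_ln6 tabA_ln7 in \<open>simp_all add: aa_def\<close>)
  have s7: "PP 0.7258 0.362 - PP 0.7258 0.334 \<le> 0.0256261"
    by (rule order_trans[OF PP_step[of "0.7258" "0.334" "0.362" "1.09661" "1.01611"]])
      (use tabA_ln7 tabA_ln8 in \<open>simp_all add: aa_def\<close>)
  have s8: "PP 0.7258 0.391 - PP 0.7258 0.362 \<le> 0.0258558"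
    by (rule order_trans[OF PP_step[of "0.7258" "0.362" "0.391" "1.01611" "0.93904"]])
      (use tabA_ln8 tabA_ln9 in \<open>simp_all add: aa_def\<close>)
  have s9: "PP 0.7258 0.422 - PP 0.7258 0.391 \<le> 0.0269626"
    by (rule order_trans[OF PP_step[of "0.7258" "0.391" "0.422" "0.93904" "0.86274"]])
      (use tabA_ln9 tabA_ln10 in \<open>simp_all add: aa_def\<close>)
  have s10: "PP 0.7258 0.455 - PP 0.7258 0.422 \<le> 0.0280299"
    by (rule order_trans[OF PP_step[of "0.7258" "0.422" "0.455" "0.86274" "0.78745"]])
      (use tabA_ln10 tabA_ln11 in \<open>simp_all add: aa_def\<close>)
  have s11: "PP 0.7258 0.489 - PP 0.7258 0.455 \<le> 0.028246"
    by (rule order_trans[OF PP_step[of "0.7258" "0.455" "0.489" "0.78745" "0.71539"]])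
      (use tabA_ln11 tabA_ln12 in \<open>simp_all add: aa_def\<close>)
  have s12: "PP 0.7258 0.525 - PP 0.7258 0.489 \<le> 0.0292988"
    by (rule order_trans[OF PP_step[of "0.7258" "0.489" "0.525" "0.71539" "0.64435"]])
      (use tabA_ln12 tabA_ln13 in \<open>simp_all add: aa_def\<close>)
  have s13: "PP 0.7258 0.562 - PP 0.7258 0.525 \<le> 0.0295467"
    by (rule order_trans[OF PP_step[of "0.7258" "0.525" "0.562" "0.64435" "0.57625"]])
      (use tabA_ln13 tabA_ln14 in \<open>simp_all add: aa_def\<close>)
  have s14: "PP 0.7258 0.6 - PP 0.7258 0.562 \<le> 0.0298302"
    by (rule order_trans[OF PP_step[of "0.7258" "0.562" "0.6" "0.57625" "0.51082"]])
      (use tabA_ln14 tabA_ln15 in \<open>simp_all add: aa_def\<close>)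
  have s15: "PP 0.7258 0.64 - PP 0.7258 0.6 \<le> 0.0309173"
    by (rule order_trans[OF PP_step[of "0.7258" "0.6" "0.64" "0.51082" "0.44628"]])
      (use tabA_ln15 tabA_ln16 in \<open>simp_all add: aa_def\<close>)
  have s16: "PP 0.7258 0.681 - PP 0.7258 0.64 \<le> 0.0312534"
    by (rule order_trans[OF PP_step[of "0.7258" "0.64" "0.681" "0.44628" "0.38419"]])
      (use tabA_ln16 tabA_ln17 in \<open>simp_all add: aa_def\<close>)
  have s17: "PP 0.7258 0.723 - PP 0.7258 0.681 \<le> 0.031631"
    by (rule order_trans[OF PP_step[of "0.7258" "0.681" "0.723" "0.38419" "0.32434"]])
      (use tabA_ln17 tabA_ln18 in \<open>simp_all add: aa_def\<close>)
  have s18: "PP 0.7258 0.766 - PP 0.7258 0.723 \<le> 0.0320512"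
    by (rule order_trans[OF PP_step[of "0.7258" "0.723" "0.766" "0.32434" "0.26657"]])
      (use tabA_ln18 tabA_ln19 in \<open>simp_all add: aa_def\<close>)
  have s19: "PP 0.7258 0.811 - PP 0.7258 0.766 \<le> 0.0332519"
    by (rule order_trans[OF PP_step[of "0.7258" "0.766" "0.811" "0.26657" "0.20948"]])
      (use tabA_ln19 tabA_ln20 in \<open>simp_all add: aa_def\<close>)
  have s20: "PP 0.7258 0.856 - PP 0.7258 0.811 \<le> 0.0330211"
    by (rule order_trans[OF PP_step[of "0.7258" "0.811" "0.856" "0.20948" "0.15548"]])
      (use tabA_ln20 tabA_ln21 in \<open>simp_all add: aa_def\<close>)
  have s21: "PP 0.7258 0.903 - PP 0.7258 0.856 \<le> 0.0343092"
    by (rule order_trans[OF PP_step[of "0.7258" "0.856" "0.903" "0.15548" "0.10203"]])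
      (use tabA_ln21 tabA_ln22 in \<open>simp_all add: aa_def\<close>)
  have s22: "PP 0.7258 0.951 - PP 0.7258 0.903 \<le> 0.0349157"
    by (rule order_trans[OF PP_step[of "0.7258" "0.903" "0.951" "0.10203" "0.05024"]])
      (use tabA_ln22 tabA_ln23 in \<open>simp_all add: aa_def\<close>)
  have s23: "PP 0.7258 1 - PP 0.7258 0.951 \<le> 0.03558"
    by (rule order_trans[OF PP_step[of "0.7258" "0.951" "1" "0.05024" "0"]])
      (use tabA_ln23 in \<open>simp_all add: aa_def\<close>)
  show ?thesis using s0 s1 s2 s3 s4 s5 s6 s7 s8 s9 s10 s11 s12 s13 s14 s15 s16 s17 s18 s19 s20 s21 s22 s23 by simp
qed

lemma tabB_ln0: "1.309332 \<le> - ln (0.27::real)"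
  by (rule order_trans[OF _ ln_lower[of _ 10]]) (simp_all add: eval_nat_numeral)

lemma tabB_ln1: "1.22758 \<le> - ln (0.293::real)"
  by (rule order_trans[OF _ ln_lower[of _ 9]]) (simp_all add: eval_nat_numeral)

lemma tabB_ln2: "1.09362 \<le> - ln (0.335::real)"
  by (rule order_trans[OF _ ln_lower[of _ 8]]) (simp_all add: eval_nat_numeral)

lemma tabB_ln3: "0.94417 \<le> - ln (0.389::real)"
  by (rule order_trans[OF _ ln_lower[of _ 6]]) (simp_all add: eval_nat_numeral)

lemma tabB_ln4: "0.78965 \<le> - ln (0.454::real)"
  by (rule order_trans[OF _ ln_lower[of _ 5]]) (simp_all add: eval_nat_numeral)

lemma tabB_ln5: "0.63865 \<le> - ln (0.528::real)"
  by (rule order_trans[OF _ ln_lower[of _ 4]]) (simp_all add: eval_nat_numeral)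

lemma tabB_ln6: "0.49593 \<le> - ln (0.609::real)"
  by (rule order_trans[OF _ ln_lower[of _ 4]]) (simp_all add: eval_nat_numeral)

lemma tabB_ln7: "0.36096 \<le> - ln (0.697::real)"
  by (rule order_trans[OF _ ln_lower[of _ 3]]) (simp_all add: eval_nat_numeral)

lemma tabB_ln8: "0.23319 \<le> - ln (0.792::real)"
  by (rule order_trans[OF _ ln_lower[of _ 3]]) (simp_all add: eval_nat_numeral)

lemma tabB_ln9: "0.11316 \<le> - ln (0.893::real)"
  by (rule order_trans[OF _ ln_lower[of _ 2]]) (simp_all add: eval_nat_numeral)

text \<open>The same mass at the larger rate, followed down to z = 0.27 only. There is more room at
  that point, so a coarser mesh suffices.\<close>

lemma tabB_bound: "PP 0.757 1 - PP 0.757 0.27 \<le> 0.6101429"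
proof -
  have s0: "PP 0.757 0.293 - PP 0.757 0.27 \<le> 0.0239863"
    by (rule order_trans[OF PP_step[of "0.757" "0.27" "0.293" "1.309332" "1.22758"]])
      (use tabB_ln0 tabB_ln1 in \<open>simp_all add: aa_def\<close>)
  have s1: "PP 0.757 0.335 - PP 0.757 0.293 \<le> 0.0421082"
    by (rule order_trans[OF PP_step[of "0.757" "0.293" "0.335" "1.22758" "1.09362"]])
      (use tabB_ln1 tabB_ln2 in \<open>simp_all add: aa_def\<close>)
  have s2: "PP 0.757 0.389 - PP 0.757 0.335 \<le> 0.0514723"
    by (rule order_trans[OF PP_step[of "0.757" "0.335" "0.389" "1.09362" "0.94417"]])
      (use tabB_ln2 tabB_ln3 in \<open>simp_all add: aa_def\<close>)
  have s3: "PP 0.757 0.454 - PP 0.757 0.389 \<le> 0.0588406"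
    by (rule order_trans[OF PP_step[of "0.757" "0.389" "0.454" "0.94417" "0.78965"]])
      (use tabB_ln3 tabB_ln4 in \<open>simp_all add: aa_def\<close>)
  have s4: "PP 0.757 0.528 - PP 0.757 0.454 \<le> 0.0638339"
    by (rule order_trans[OF PP_step[of "0.757" "0.454" "0.528" "0.78965" "0.63865"]])
      (use tabB_ln4 tabB_ln5 in \<open>simp_all add: aa_def\<close>)
  have s5: "PP 0.757 0.609 - PP 0.757 0.528 \<le> 0.0670151"
    by (rule order_trans[OF PP_step[of "0.757" "0.528" "0.609" "0.63865" "0.49593"]])
      (use tabB_ln5 tabB_ln6 in \<open>simp_all add: aa_def\<close>)
  have s6: "PP 0.757 0.697 - PP 0.757 0.609 \<le> 0.0703704"
    by (rule order_trans[OF PP_step[of "0.757" "0.609" "0.697" "0.49593" "0.36096"]])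
      (use tabB_ln6 tabB_ln7 in \<open>simp_all add: aa_def\<close>)
  have s7: "PP 0.757 0.792 - PP 0.757 0.697 \<le> 0.0740171"
    by (rule order_trans[OF PP_step[of "0.757" "0.697" "0.792" "0.36096" "0.23319"]])
      (use tabB_ln7 tabB_ln8 in \<open>simp_all add: aa_def\<close>)
  have s8: "PP 0.757 0.893 - PP 0.757 0.792 \<le> 0.0773168"
    by (rule order_trans[OF PP_step[of "0.757" "0.792" "0.893" "0.23319" "0.11316"]])
      (use tabB_ln8 tabB_ln9 in \<open>simp_all add: aa_def\<close>)
  have s9: "PP 0.757 1 - PP 0.757 0.893 \<le> 0.0811822"
    by (rule order_trans[OF PP_step[of "0.757" "0.893" "1" "0.11316" "0"]])
      (use tabB_ln9 in \<open>simp_all add: aa_def\<close>)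
  show ?thesis using s0 s1 s2 s3 s4 s5 s6 s7 s8 s9 by simp
qed

section \<open>Polynomial inequalities with Bernstein certificates\<close>

text \<open>On [a, b] the polynomial is a combination of the products (x - a)^k * (b - x)^(n - k)
  with nonnegative coefficients. The five \<open>deficit_poly\<close> lemmas are what remains of
  \<open>deficit\<close> after - ln x is replaced by a rounded tangent at a point of each
  interval.\<close>

lemma deficit_poly0:
  fixes x :: real
  assumes "0.2 \<le> x" "x \<le> 0.2105"
  shows "0 \<le> 0.7258^2 * x * (0.2742 * (1.558268 + (1 - 4.7506 * x)) - (0.2742 + 0.7258 * x)) - 1.85 * (0.2105 - x) * ((0.2742 + 0.7258 * x) + 0.7258 * x * (1.558268 + (1 - 4.7506 * x))) * (0.2742 + 0.7258 * x)^2"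
proof -
  have "0.7258^2 * x * (0.2742 * (1.558268 + (1 - 4.7506 * x)) - (0.2742 + 0.7258 * x)) - 1.85 * (0.2105 - x) * ((0.2742 + 0.7258 * x) + 0.7258 * x * (1.558268 + (1 - 4.7506 * x))) * (0.2742 + 0.7258 * x)^2 = (14078812623880798048/39883798828125) * ((x - 0.2)^0 * (0.2105 - x)^5) + (1614079631179812509549/997094970703125) * ((x - 0.2)^1 * (0.2105 - x)^4) + (9532267008471720448087727/3190703906250000000) * ((x - 0.2)^2 * (0.2105 - x)^3) + (3558205405260978512338458749/1276281562500000000000) * ((x - 0.2)^3 * (0.2105 - x)^2) + (67553717885131069538983878589/51051262500000000000000) * ((x - 0.2)^4 * (0.2105 - x)^1) + (82010033172470477/319070390625) * ((x - 0.2)^5 * (0.2105 - x)^0)"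
    by algebra
  also have "\<dots> \<ge> 0"
    using assms by (intro add_nonneg_nonneg mult_nonneg_nonneg zero_le_power) auto
  finally show ?thesis .
qed

lemma deficit_poly1:
  fixes x :: real
  assumes "0.18 \<le> x" "x \<le> 0.2"
  shows "0 \<le> 0.7258^2 * x * (0.2742 * (1.66073 + (1 - 5.2632 * x)) - (0.2742 + 0.7258 * x)) - 1.85 * (0.2105 - x) * ((0.2742 + 0.7258 * x) + 0.7258 * x * (1.66073 + (1 - 5.2632 * x))) * (0.2742 + 0.7258 * x)^2"
proof -
  have "0.7258^2 * x * (0.2742 * (1.66073 + (1 - 5.2632 * x)) - (0.2742 + 0.7258 * x)) - 1.85 * (0.2105 - x) * ((0.2742 + 0.7258 * x) + 0.7258 * x * (1.66073 + (1 - 5.2632 * x))) * (0.2742 + 0.7258 * x)^2 = (107914017955459470046191/1000000000000000000) * ((x - 0.18)^0 * (0.2 - x)^5) + (113765003340585213657189/250000000000000000) * ((x - 0.18)^1 * (0.2 - x)^4) + (145812432537879059763071/200000000000000000) * ((x - 0.18)^2 * (0.2 - x)^3) + (2153231161199687048087/4000000000000000) * ((x - 0.18)^3 * (0.2 - x)^2) + (42489883661364868643/250000000000000) * ((x - 0.18)^4 * (0.2 - x)^1) + (169552360051892423/12500000000000) * ((x - 0.18)^5 * (0.2 - x)^0)"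
    by algebra
  also have "\<dots> \<ge> 0"
    using assms by (intro add_nonneg_nonneg mult_nonneg_nonneg zero_le_power) auto
  finally show ?thesis .
qed

lemma deficit_poly2:
  fixes x :: real
  assumes "0.16 \<le> x" "x \<le> 0.18"
  shows "0 \<le> 0.7258^2 * x * (0.2742 * (1.77195 + (1 - 5.8824 * x)) - (0.2742 + 0.7258 * x)) - 1.85 * (0.2105 - x) * ((0.2742 + 0.7258 * x) + 0.7258 * x * (1.77195 + (1 - 5.8824 * x))) * (0.2742 + 0.7258 * x)^2"
proof -
  have "0.7258^2 * x * (0.2742 * (1.77195 + (1 - 5.8824 * x)) - (0.2742 + 0.7258 * x)) - 1.85 * (0.2105 - x) * ((0.2742 + 0.7258 * x) + 0.7258 * x * (1.77195 + (1 - 5.8824 * x))) * (0.2742 + 0.7258 * x)^2 = (8105313670936854576421/31250000000000000) * ((x - 0.16)^0 * (0.18 - x)^5) + (293284106168400718122429/250000000000000000) * ((x - 0.16)^1 * (0.18 - x)^4) + (516743632922258431509773/250000000000000000) * ((x - 0.16)^2 * (0.18 - x)^3) + (1758256149725391899935129/1000000000000000000) * ((x - 0.16)^3 * (0.18 - x)^2) + (355568892948363963818979/500000000000000000) * ((x - 0.16)^4 * (0.18 - x)^1) + (106085619853563614408397/1000000000000000000) * ((x - 0.16)^5 * (0.18 - x)^0)"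
    by algebra
  also have "\<dots> \<ge> 0"
    using assms by (intro add_nonneg_nonneg mult_nonneg_nonneg zero_le_power) auto
  finally show ?thesis .
qed

lemma deficit_poly3:
  fixes x :: real
  assumes "0.135 \<le> x" "x \<le> 0.16"
  shows "0 \<le> 0.7258^2 * x * (0.2742 * (1.89711 + (1 - 6.6667 * x)) - (0.2742 + 0.7258 * x)) - 1.85 * (0.2105 - x) * ((0.2742 + 0.7258 * x) + 0.7258 * x * (1.89711 + (1 - 6.6667 * x))) * (0.2742 + 0.7258 * x)^2"
proof -
  have "0.7258^2 * x * (0.2742 * (1.89711 + (1 - 6.6667 * x)) - (0.2742 + 0.7258 * x)) - 1.85 * (0.2105 - x) * ((0.2742 + 0.7258 * x) + 0.7258 * x * (1.89711 + (1 - 6.6667 * x))) * (0.2742 + 0.7258 * x)^2 = (119077303303690880901563241/781250000000000000000) * ((x - 0.135)^0 * (0.16 - x)^5) + (112683573174438433763829603/156250000000000000000) * ((x - 0.135)^1 * (0.16 - x)^4) + (416145177192280507637839/312500000000000000) * ((x - 0.135)^2 * (0.16 - x)^3) + (728683205330042254026469/610351562500000000) * ((x - 0.135)^3 * (0.16 - x)^2) + (314477713371769807165279/610351562500000000) * ((x - 0.135)^4 * (0.16 - x)^1) + (8036580404318687587353/95367431640625000) * ((x - 0.135)^5 * (0.16 - x)^0)"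
    by algebra
  also have "\<dots> \<ge> 0"
    using assms by (intro add_nonneg_nonneg mult_nonneg_nonneg zero_le_power) auto
  finally show ?thesis .
qed

lemma deficit_poly4:
  fixes x :: real
  assumes "0.12 \<le> x" "x \<le> 0.135"
  shows "0 \<le> 0.7258^2 * x * (0.2742 * (2.04021 + (1 - 7.6924 * x)) - (0.2742 + 0.7258 * x)) - 1.85 * (0.2105 - x) * ((0.2742 + 0.7258 * x) + 0.7258 * x * (2.04021 + (1 - 7.6924 * x))) * (0.2742 + 0.7258 * x)^2"
proof -
  have "0.7258^2 * x * (0.2742 * (2.04021 + (1 - 7.6924 * x)) - (0.2742 + 0.7258 * x)) - 1.85 * (0.2105 - x) * ((0.2742 + 0.7258 * x) + 0.7258 * x * (2.04021 + (1 - 7.6924 * x))) * (0.2742 + 0.7258 * x)^2 = (2096187571130563573409/823974609375000) * ((x - 0.12)^0 * (0.135 - x)^5) + (6828065836547052448993/549316406250000) * ((x - 0.12)^1 * (0.135 - x)^4) + (1693777227618818047874983/70312500000000000) * ((x - 0.12)^2 * (0.135 - x)^3) + (39035060155042577575765609/1687500000000000000) * ((x - 0.12)^3 * (0.135 - x)^2) + (6185364254714307859075301/562500000000000000) * ((x - 0.12)^4 * (0.135 - x)^1) + (290737565495474470301801/140625000000000000) * ((x - 0.12)^5 * (0.135 - x)^0)"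
    by algebra
  also have "\<dots> \<ge> 0"
    using assms by (intro add_nonneg_nonneg mult_nonneg_nonneg zero_le_power) auto
  finally show ?thesis .
qed

text \<open>Here u = x - 0.2105. The squared factor is the tangent bound of \<open>AA\<close> at
  0.25, the other side is the lower bound of \<open>MM_low1\<close>; a common factor u has been
  divided out.\<close>

lemma slope_poly0:
  fixes u :: real
  assumes "0 \<le> u" "u \<le> 0.0895"
  shows "0 \<le> 0.7258^2 * (0.999 + 1.2 * u) - (1.12 - 1.4 * u) * (0.707194 + 1.00618 * (u - 0.0395))^2"
proof -
  have "0.7258^2 * (0.999 + 1.2 * u) - (1.12 - 1.4 * u) * (0.707194 + 1.00618 * (u - 0.0395))^2 = (1706923501229153/44807335937500) * ((u - 0)^0 * (0.0895 - u)^3) + (5969162012473046413/71691737500000000) * ((u - 0)^1 * (0.0895 - u)^2) + (21715375104620751/358458687500000) * ((u - 0)^2 * (0.0895 - u)^1) + (120660343005477/7169173750000) * ((u - 0)^3 * (0.0895 - u)^0)"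
    by algebra
  also have "\<dots> \<ge> 0"
    using assms by (intro add_nonneg_nonneg mult_nonneg_nonneg zero_le_power) auto
  finally show ?thesis .
qed

text \<open>Now u = x - 0.3, with the tangent of \<open>AA\<close> at 0.3 and the linear lower bound
  of \<open>MM_low2\<close>.\<close>

lemma slope_poly1:
  fixes u :: real
  assumes "0 \<le> u" "u \<le> 0.2"
  shows "0 \<le> 0.7258^2 * (0.09902 + 1.3 * u) - (1.12 * (0.0895 + u) - 1.4 * (0.0895 + u)^2) * (0.754094 + 0.873842 * u)^2"
proof -
  have "0.7258^2 * (0.09902 + 1.3 * u) - (1.12 * (0.0895 + u) - 1.4 * (0.0895 + u)^2) * (0.754094 + 0.873842 * u)^2 = (7685936434152783/320000000000000) * ((u - 0)^0 * (0.2 - u)^6) + (149021731385731257/400000000000000) * ((u - 0)^1 * (0.2 - u)^5) + (4965830907588268221/4000000000000000) * ((u - 0)^2 * (0.2 - u)^4) + (3736620181129146067/2000000000000000) * ((u - 0)^3 * (0.2 - u)^3) + (12385399352299411927/8000000000000000) * ((u - 0)^4 * (0.2 - u)^2) + (738590139788126071/1000000000000000) * ((u - 0)^5 * (0.2 - u)^1) + (82901680762903127/500000000000000) * ((u - 0)^6 * (0.2 - u)^0)"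
    by algebra
  also have "\<dots> \<ge> 0"
    using assms by (intro add_nonneg_nonneg mult_nonneg_nonneg zero_le_power) auto
  finally show ?thesis .
qed

text \<open>With u = w - 0.2105 this compares the gain 0.0312 = 0.757 - 0.7258 of the larger rate
  with the weight of the exceptional item, whose q is below 0.002 divided by the cubic in u.\<close>

lemma upper_poly0:
  fixes u :: real
  assumes "0.03 \<le> u" "u \<le> 0.065"
  shows "0 \<le> 0.0312 * (0.7895 - u) * (0.56 * u^2 - 0.4667 * u^3) - 0.002 * (0.7258 * (0.2105 + u) - 0.17688)"
proof -
  have "0.0312 * (0.7895 - u) * (0.56 * u^2 - 0.4667 * u^3) - 0.002 * (0.7258 * (0.2105 + u) - 0.17688) = (407364740831/37515625000) * ((u - 0.03)^0 * (0.065 - u)^4) + (406576312321/15006250000) * ((u - 0.03)^1 * (0.065 - u)^3) + (3800578807239/150062500000) * ((u - 0.03)^2 * (0.065 - u)^2) + (3609991411687/300125000000) * ((u - 0.03)^3 * (0.065 - u)^1) + (885812249111/300125000000) * ((u - 0.03)^4 * (0.065 - u)^0)"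
    by algebra
  also have "\<dots> \<ge> 0"
    using assms by (intro add_nonneg_nonneg mult_nonneg_nonneg zero_le_power) auto
  finally show ?thesis .
qed

lemma upper_poly1:
  fixes u :: real
  assumes "0.065 \<le> u" "u \<le> 0.0895"
  shows "0 \<le> 0.0312 * (0.7895 - u) * (0.56 * u^2 - 0.4667 * u^3) - 0.002 * (0.7258 * (0.2105 + u) - 0.17688)"
proof -
  have "0.0312 * (0.7895 - u) * (0.56 * u^2 - 0.4667 * u^3) - 0.002 * (0.7258 * (0.2105 + u) - 0.17688) = (885812249111/72060012500) * ((u - 0.065)^0 * (0.0895 - u)^4) + (34965293057739/720600125000) * ((u - 0.065)^1 * (0.0895 - u)^3) + (619688229095637/7206001250000) * ((u - 0.065)^2 * (0.0895 - u)^2) + (5373359525199257/72060012500000) * ((u - 0.065)^3 * (0.0895 - u)^1) + (8941217798151/360300062500) * ((u - 0.065)^4 * (0.0895 - u)^0)"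
    by algebra
  also have "\<dots> \<ge> 0"
    using assms by (intro add_nonneg_nonneg mult_nonneg_nonneg zero_le_power) auto
  finally show ?thesis .
qed

lemma upper_poly2:
  fixes u :: real
  assumes "0.0895 \<le> u" "u \<le> 0.2895"
  shows "0 \<le> 0.0312 * (0.7895 - u) * (0.56 * u^2 - 0.4667 * u^3) - 0.002 * (0.7258 * (0.2105 + u) - 0.17688)"
proof -
  have "0.0312 * (0.7895 - u) * (0.56 * u^2 - 0.4667 * u^3) - 0.002 * (0.7258 * (0.2105 + u) - 0.17688) = (8941217798151/1600000000000000) * ((u - 0.0895)^0 * (0.2895 - u)^4) + (54201103215109/800000000000000) * ((u - 0.0895)^1 * (0.2895 - u)^3) + (135050600565237/400000000000000) * ((u - 0.0895)^2 * (0.2895 - u)^2) + (300461173171923/800000000000000) * ((u - 0.0895)^3 * (0.2895 - u)^1) + (36695719342993/320000000000000) * ((u - 0.0895)^4 * (0.2895 - u)^0)"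
    by algebra
  also have "\<dots> \<ge> 0"
    using assms by (intro add_nonneg_nonneg mult_nonneg_nonneg zero_le_power) auto
  finally show ?thesis .
qed

text \<open>These six concern the potential \<open>V2\<close> and come in pairs, one pair per
  interval: the cases \<eta> = 0 and \<eta> = 0.803 of a condition that is affine in \<eta>.\<close>

lemma others_poly0:
  fixes x :: real
  assumes "0.197 \<le> x" "x \<le> 0.222"
  shows "0 \<le> (1.306 - 4.2 * (x - 0.197) + 12 * (x - 0.197)^2) * (0.243 + 0.757 * x + 0.757 * x * (1.56542 + (1 - 4.7847 * x))) - 0.757"
proof -
  have "(1.306 - 4.2 * (x - 0.197) + 12 * (x - 0.197)^2) * (0.243 + 0.757 * x + 0.757 * x * (1.56542 + (1 - 4.7847 * x))) - 0.757 = (355938291037817/1953125000) * ((x - 0.197)^0 * (0.222 - x)^4) + (2596949655714791/3906250000) * ((x - 0.197)^1 * (0.222 - x)^3) + (7008393337049973/7812500000) * ((x - 0.197)^2 * (0.222 - x)^2) + (1034906274871943/1953125000) * ((x - 0.197)^3 * (0.222 - x)^1) + (225259586384497/1953125000) * ((x - 0.197)^4 * (0.222 - x)^0)"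
    by algebra
  also have "\<dots> \<ge> 0"
    using assms by (intro add_nonneg_nonneg mult_nonneg_nonneg zero_le_power) auto
  finally show ?thesis .
qed

lemma others_poly1:
  fixes x :: real
  assumes "0.197 \<le> x" "x \<le> 0.222"
  shows "0 \<le> (1.306 - 4.2 * (x - 0.197) + 12 * (x - 0.197)^2) * (0.243 + 0.757 * x + 0.197 * (0.757 * x * (1.56542 + (1 - 4.7847 * x)))) - 0.757 * (1 - 0.803 * (0.30301 + 1.306 * (x - 0.197) - 2.1 * (x - 0.197)^2 + 4 * (x - 0.197)^3))"
proof -
  have "(1.306 - 4.2 * (x - 0.197) + 12 * (x - 0.197)^2) * (0.243 + 0.757 * x + 0.197 * (0.757 * x * (1.56542 + (1 - 4.7847 * x)))) - 0.757 * (1 - 0.803 * (0.30301 + 1.306 * (x - 0.197) - 2.1 * (x - 0.197)^2 + 4 * (x - 0.197)^3)) = (7883504994449949/1953125000000) * ((x - 0.197)^0 * (0.222 - x)^4) + (80024572105813827/3906250000000) * ((x - 0.197)^1 * (0.222 - x)^3) + (284240643938844681/7812500000000) * ((x - 0.197)^2 * (0.222 - x)^2) + (54846364914772771/1953125000000) * ((x - 0.197)^3 * (0.222 - x)^1) + (15898261452745909/1953125000000) * ((x - 0.197)^4 * (0.222 - x)^0)"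
    by algebra
  also have "\<dots> \<ge> 0"
    using assms by (intro add_nonneg_nonneg mult_nonneg_nonneg zero_le_power) auto
  finally show ?thesis .
qed

lemma others_poly2:
  fixes x :: real
  assumes "0.222 \<le> x" "x \<le> 0.247"
  shows "0 \<le> (1.306 - 4.2 * (x - 0.197) + 12 * (x - 0.197)^2) * (0.243 + 0.757 * x + 0.757 * x * (1.45243 + (1 - 4.2736 * x))) - 0.757"
proof -
  have "(1.306 - 4.2 * (x - 0.197) + 12 * (x - 0.197)^2) * (0.243 + 0.757 * x + 0.757 * x * (1.45243 + (1 - 4.2736 * x))) - 0.757 = (112870560250793/976562500) * ((x - 0.222)^0 * (0.247 - x)^4) + (782090039028679/1953125000) * ((x - 0.222)^1 * (0.247 - x)^3) + (991254244779391/1953125000) * ((x - 0.222)^2 * (0.247 - x)^2) + (270608130171357/976562500) * ((x - 0.222)^3 * (0.247 - x)^1) + (26558777769479/488281250) * ((x - 0.222)^4 * (0.247 - x)^0)"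
    by algebra
  also have "\<dots> \<ge> 0"
    using assms by (intro add_nonneg_nonneg mult_nonneg_nonneg zero_le_power) auto
  finally show ?thesis .
qed

lemma others_poly3:
  fixes x :: real
  assumes "0.222 \<le> x" "x \<le> 0.247"
  shows "0 \<le> (1.306 - 4.2 * (x - 0.197) + 12 * (x - 0.197)^2) * (0.243 + 0.757 * x + 0.197 * (0.757 * x * (1.45243 + (1 - 4.2736 * x)))) - 0.757 * (1 - 0.803 * (0.30301 + 1.306 * (x - 0.197) - 2.1 * (x - 0.197)^2 + 4 * (x - 0.197)^3))"
proof -
  have "(1.306 - 4.2 * (x - 0.197) + 12 * (x - 0.197)^2) * (0.243 + 0.757 * x + 0.197 * (0.757 * x * (1.45243 + (1 - 4.2736 * x)))) - 0.757 * (1 - 0.803 * (0.30301 + 1.306 * (x - 0.197) - 2.1 * (x - 0.197)^2 + 4 * (x - 0.197)^3)) = (7996561836906221/976562500000) * ((x - 0.222)^0 * (0.247 - x)^4) + (75278892403649763/1953125000000) * ((x - 0.222)^1 * (0.247 - x)^3) + (131885853206540027/1953125000000) * ((x - 0.222)^2 * (0.247 - x)^2) + (51532001801257329/976562500000) * ((x - 0.222)^3 * (0.247 - x)^1) + (7612245498087363/488281250000) * ((x - 0.222)^4 * (0.247 - x)^0)"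
    by algebra
  also have "\<dots> \<ge> 0"
    using assms by (intro add_nonneg_nonneg mult_nonneg_nonneg zero_le_power) auto
  finally show ?thesis .
qed

lemma others_poly4:
  fixes x :: real
  assumes "0.247 \<le> x" "x \<le> 0.27"
  shows "0 \<le> (1.306 - 4.2 * (x - 0.197) + 12 * (x - 0.197)^2) * (0.243 + 0.757 * x + 0.757 * x * (1.35479 + (1 - 3.876 * x))) - 0.757"
proof -
  have "(1.306 - 4.2 * (x - 0.197) + 12 * (x - 0.197)^2) * (0.243 + 0.757 * x + 0.757 * x * (1.35479 + (1 - 3.876 * x))) - 0.757 = (5341609892493/69960250) * ((x - 0.247)^0 * (0.27 - x)^4) + (33000070672363/139920500) * ((x - 0.247)^1 * (0.27 - x)^3) + (8839026088034157/34980125000) * ((x - 0.247)^2 * (0.27 - x)^2) + (145780057654299/1399205000) * ((x - 0.247)^3 * (0.27 - x)^1) + (7669128790361/699602500) * ((x - 0.247)^4 * (0.27 - x)^0)"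
    by algebra
  also have "\<dots> \<ge> 0"
    using assms by (intro add_nonneg_nonneg mult_nonneg_nonneg zero_le_power) auto
  finally show ?thesis .
qed

lemma others_poly5:
  fixes x :: real
  assumes "0.247 \<le> x" "x \<le> 0.27"
  shows "0 \<le> (1.306 - 4.2 * (x - 0.197) + 12 * (x - 0.197)^2) * (0.243 + 0.757 * x + 0.197 * (0.757 * x * (1.35479 + (1 - 3.876 * x)))) - 0.757 * (1 - 0.803 * (0.30301 + 1.306 * (x - 0.197) - 2.1 * (x - 0.197)^2 + 4 * (x - 0.197)^3))"
proof -
  have "(1.306 - 4.2 * (x - 0.197) + 12 * (x - 0.197)^2) * (0.243 + 0.757 * x + 0.197 * (0.757 * x * (1.35479 + (1 - 3.876 * x)))) - 0.757 * (1 - 0.803 * (0.30301 + 1.306 * (x - 0.197) - 2.1 * (x - 0.197)^2 + 4 * (x - 0.197)^3)) = (1528330404321121/69960250000) * ((x - 0.247)^0 * (0.27 - x)^4) + (14139999897955511/139920500000) * ((x - 0.247)^1 * (0.27 - x)^3) + (6135522474239728929/34980125000000) * ((x - 0.247)^2 * (0.27 - x)^2) + (189762176641216903/1399205000000) * ((x - 0.247)^3 * (0.27 - x)^1) + (27582481637921117/699602500000) * ((x - 0.247)^4 * (0.27 - x)^0)"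
    by algebra
  also have "\<dots> \<ge> 0"
    using assms by (intro add_nonneg_nonneg mult_nonneg_nonneg zero_le_power) auto
  finally show ?thesis .
qed

section \<open>Monotonicity and tangent bounds\<close>

lemma deriv_nonnegI: 
  "(f has_real_derivative d) (at z) \<Longrightarrow> 0 \<le> d \<Longrightarrow> \<exists>d. (f has_real_derivative d) (at z) \<and> 0 \<le> d"
  by blast

lemma AA_mono: assumes "0 < G" "0 < x" "x \<le> y" "y \<le> 1" shows "AA G x \<le> AA G y"
proof (rule DERIV_nonneg_imp_nondecreasing[where f = "AA G"])
  fix z assume z: "x \<le> z" "z \<le> y"
  have "(AA G has_real_derivative - (G * ln z)) (at z)" using z assms by (intro AA_deriv) auto
  moreover have "0 \<le> - (G * ln z)" using z assms by (simp add: mult_nonneg_nonpos)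
  ultimately show "\<exists>d. (AA G has_real_derivative d) (at z) \<and> 0 \<le> d" by blast
qed (use assms in simp)

lemma AA_le_1: assumes "0 < G" "0 < x" "x \<le> 1" shows "AA G x \<le> 1"
  using AA_mono[OF assms(1,2,3)] by (simp add: AA_def aa_def qq_def)

lemma qq_nonneg: assumes "0 \<le> G" "0 \<le> z" "z \<le> 1" shows "qq G z \<ge> 0"
proof (cases "z = 0")
  case False
  then have "ln z \<le> 0" using assms by simp
  then show ?thesis unfolding qq_def using assms by (simp add: mult_nonneg_nonpos)
qed (simp add: qq_def)

text \<open>x * (1 - ln x) is concave, and p - x * ln p is its tangent at p.\<close>

lemma AA_tangent: assumes "0 \<le> G" "0 < x" "0 < p" shows "AA G x \<le> 1 - G + G * (p - x * ln p)"
proof -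
  have "ln (p / x) \<le> p / x - 1" using assms by (intro ln_le_minus_one) auto
  then have "x * ln (p / x) \<le> x * (p / x - 1)" using assms by (intro mult_left_mono) auto
  also have "\<dots> = p - x" using assms by (simp add: field_simps)
  finally have "x * (ln p - ln x) \<le> p - x" using assms by (simp add: ln_div)
  then have "G * (x * (1 - ln x)) \<le> G * (p - x * ln p)" 
    using assms by (intro mult_left_mono) (auto simp: algebra_simps)
  then show ?thesis unfolding AA_alt by simp
qed

text \<open>The tangent of - ln at p with - ln p rounded down to L and 1 / p rounded up to
  c.\<close>

lemma ln_tangent: assumes "0 < x" "0 < p" "L \<le> - ln p" "1 / p \<le> c" shows "L + (1 - c * x) \<le> - ln (x::real)"
proof -
  have "ln (x / p) \<le> x / p - 1" using assms by (intro ln_le_minus_one) auto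
  moreover have "x / p \<le> c * x" using assms mult_right_mono[OF assms(4), of x] by simp
  ultimately show ?thesis using assms by (simp add: ln_div)
qed

lemma ln_upper: assumes "0 < z" "z < 1"
  shows "- ln z \<le> (\<Sum>k<n. 2 * ((1 - z) / (1 + z))^(2*k+1) / real (2*k+1)) 
     + 2 * (((1 - z) / (1 + z))^(2*n+1) / (1 - ((1 - z) / (1 + z))^2) / real (2*n+1))"
proof -
  have e: "(1 / z - 1) / (1 / z + 1) = (1 - z) / (1 + z)" using assms by (auto simp: divide_simps)
  have "ln (1 / z) \<le> (\<Sum>k<n. 2 * ((1 / z - 1) / (1 / z + 1))^(2*k+1) / real (2*k+1))
     + 2 * (((1 / z - 1) / (1 / z + 1))^(2*n+1) / (1 - ((1 / z - 1) / (1 / z + 1))^2) / real (2*n+1))"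
    using ln_approx_bounds[of "1 / z" n] assms by auto
  then show ?thesis using assms by (simp only: e) (simp add: ln_div)
qed

lemma ln_2105_upper: "- ln (0.2105::real) \<le> 1.55827"
  by (rule order_trans[OF ln_upper[of _ 14]]) (simp_all add: eval_nat_numeral)

lemma ln_3_upper: "- ln (0.3::real) \<le> 1.203973"
  by (rule order_trans[OF ln_upper[of _ 12]]) (simp_all add: eval_nat_numeral)

lemma ln_25_upper: "- ln (0.25::real) \<le> 1.386295"
  by (rule order_trans[OF ln_upper[of _ 14]]) (simp_all add: eval_nat_numeral)

section \<open>The potential for y = 0 at rate 0.7258\<close>

abbreviation Ga :: real where "Ga \<equiv> 0.7258"

text \<open>\<open>V0 x\<close> is what remains of a mass 1 when z has come down to x with y = 0.
  The slack 0.002 in \<open>WW\<close> exceeds the possible gap between \<open>V0\<close> and the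
  potential for y = 1 at 0.2105. \<open>MM \<ge> 0\<close> means \<open>WW \<ge> qq / AA\<close>,
  the condition under which \<open>WW\<close> is a potential for all y.\<close>

definition V0 :: "real \<Rightarrow> real" where "V0 x = 1 - (PP Ga 1 - PP Ga x)"
definition WW :: "real \<Rightarrow> real" where "WW x = V0 x + 0.002"
definition MM :: "real \<Rightarrow> real" where "MM x = AA Ga x * WW x - qq Ga x"

lemma V0_deriv: "1/10 < x \<Longrightarrow> x < 2 \<Longrightarrow> (V0 has_real_derivative Ga / AA Ga x) (at x)"
  unfolding V0_def[abs_def] by (auto intro!: derivative_eq_intros PP_deriv)

lemma V0_1: "V0 1 = 1" by (simp add: V0_def)

lemma V0_2105: "V0 0.2105 \<ge> 0.356109" using tabA_bound by (simp add: V0_def)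

lemma V0_mono: assumes "0.2105 \<le> x" "x \<le> y" "y \<le> 1" shows "V0 x \<le> V0 y"
proof (rule DERIV_nonneg_imp_nondecreasing[where f = V0])
  fix z assume z: "x \<le> z" "z \<le> y"
  have "(V0 has_real_derivative Ga / AA Ga z) (at z)" using z assms by (intro V0_deriv) auto
  moreover have "AA Ga z > 0" using z assms by (intro AA_pos) auto
  ultimately show "\<exists>d. (V0 has_real_derivative d) (at z) \<and> 0 \<le> d" 
    by (intro exI[of _ "Ga / AA Ga z"]) auto
qed (use assms in simp)

lemma ln_dec: assumes "0 < x" "x \<le> y" shows "- ln y \<le> - ln (x::real)" using assms by simp

lemma MM_deriv: assumes "1/10 < x" "x < 2"
  shows "(MM has_real_derivative Ga * (2 - (- ln x) * (1 - WW x))) (at x)"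
proof -
  have A: "AA Ga x > 0" using assms by (intro AA_pos) auto
  have dW: "(WW has_real_derivative Ga / AA Ga x) (at x)"
    unfolding WW_def[abs_def] using V0_deriv[OF assms] by (auto intro!: derivative_eq_intros)
  have dq: "(qq Ga has_real_derivative - (Ga * (ln x + 1))) (at x)"
    unfolding qq_def[abs_def] using assms by (auto intro!: derivative_eq_intros simp: field_simps)
  have "(MM has_real_derivative (AA Ga x * (Ga / AA Ga x) + - (Ga * ln x) * WW x) - (- (Ga * (ln x + 1)))) (at x)"
    unfolding MM_def[abs_def] using assms by (intro DERIV_diff DERIV_mult' dW dq AA_deriv) auto
  then show ?thesis by (rule DERIV_cong) (use A in \<open>simp add: field_simps\<close>)
qed

text \<open>Splitting \<open>AA\<close> into \<open>aa\<close> + \<open>qq\<close> gives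
  \<open>MM\<close> = \<open>aa\<close> * \<open>WW\<close> - \<open>qq\<close> * (1 -
  \<open>WW\<close>), where the bounds for \<open>WW\<close> and \<open>qq\<close> act in the right
  direction. The margin is about 0.0001.\<close>

lemma MM_2105: "MM 0.2105 \<ge> 0"
proof -
  have "qq Ga 0.2105 \<le> 0.23807534" using ln_2105_upper by (simp add: qq_def)
  moreover have "MM 0.2105 = aa Ga 0.2105 * WW 0.2105 - qq Ga 0.2105 * (1 - WW 0.2105)"
    by (simp add: MM_def AA_def algebra_simps)
  moreover have "WW 0.2105 \<ge> 0.358109" using V0_2105 by (simp add: WW_def)
  moreover have "qq Ga 0.2105 \<ge> 0" by (rule qq_nonneg) auto
  ultimately have q: "qq Ga 0.2105 \<le> 0.23807534" "0 \<le> qq Ga 0.2105" and W: "WW 0.2105 \<ge> 0.358109"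
    and M: "MM 0.2105 = aa Ga 0.2105 * WW 0.2105 - qq Ga 0.2105 * (1 - WW 0.2105)" by auto
  have "qq Ga 0.2105 * (1 - WW 0.2105) \<le> qq Ga 0.2105 * (1 - 0.358109)"
    using q W by (intro mult_left_mono) auto
  also have "\<dots> \<le> 0.23807534 * (1 - 0.358109)" using q by (intro mult_right_mono) auto
  finally have 1: "qq Ga 0.2105 * (1 - WW 0.2105) \<le> 0.23807534 * (1 - 0.358109)" .
  have 2: "aa Ga 0.2105 * WW 0.2105 \<ge> aa Ga 0.2105 * 0.358109"
    using W by (intro mult_left_mono) (auto simp: aa_def)
  have 3: "aa Ga 0.2105 * 0.358109 \<ge> 0.23807534 * (1 - 0.358109)" by (simp add: aa_def)
  show ?thesis unfolding M using 1 2 3 by linarith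
qed

text \<open>In the derivative of \<open>MM\<close>, 1 - \<open>WW\<close> is bounded by its value at
  0.2105 and - ln z by its chord over [0.2105, 0.3]; the decline of this chord produces the
  quadratic term.\<close>

lemma MM_low1: assumes x: "0.2105 \<le> x" "x \<le> 0.3"
  shows "MM x \<ge> Ga * (0.999 * (x - 0.2105) + 1.2 * (x - 0.2105)^2)"
proof -
  let ?h = "\<lambda>x. MM x - Ga * (0.999 * (x - 0.2105) + 1.2 * (x - 0.2105)^2)"
  have "?h 0.2105 \<le> ?h x"
  proof (rule DERIV_nonneg_imp_nondecreasing[where f = ?h])
    fix z assume z: "0.2105 \<le> z" "z \<le> x"
    have d: "(?h has_real_derivative (Ga * (2 - (- ln z) * (1 - WW z)) - Ga * (0.999 + 2.4 * (z - 0.2105)))) (at z)"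
      using z x by (auto intro!: derivative_eq_intros MM_deriv)
    define s where "s = (z - 0.2105) / 0.0895"
    have s: "0 \<le> s" "s \<le> 1" "z = (1 - s) * 0.2105 + s * 0.3" using z x by (auto simp: s_def field_simps)
    have "ln z \<ge> (1 - s) * ln 0.2105 + s * ln 0.3"
      using concave_onD[OF ln_concave, of s "0.2105" "0.3"] s by simp
    moreover have "(1 - s) * ln 0.2105 \<ge> (1 - s) * (-1.55827)" "s * ln 0.3 \<ge> s * (- 1.203973)"
      by (rule mult_left_mono; use s ln_2105_upper ln_3_upper in linarith)+
    ultimately have l: "- ln z \<le> (1 - s) * 1.55827 + s * 1.203973" by linarith
    have W: "1 - WW z \<le> 0.641891" using V0_mono[of "0.2105" z] V0_2105 z x by (simp add: WW_def)
    have "(- ln z) * (1 - WW z) \<le> (- ln z) * 0.641891" using W z x by (intro mult_left_mono) auto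
    also have "\<dots> \<le> ((1 - s) * 1.55827 + s * 1.203973) * 0.641891" using l by (intro mult_right_mono) auto
    also have "\<dots> \<le> 2 - (0.999 + 2.4 * (z - 0.2105))" using s by (simp add: s(3) field_simps)
    finally have P: "(- ln z) * (1 - WW z) \<le> \<dots>" .
    define X where "X = (- ln z) * (1 - WW z)"
    show "\<exists>d. (?h has_real_derivative d) (at z) \<and> 0 \<le> d" by (rule deriv_nonnegI[OF d]) (use P l in \<open>fold X_def, simp add: field_simps\<close>)
  qed (use x in simp)
  moreover have "?h 0.2105 = MM 0.2105" by simp
  ultimately show ?thesis using MM_2105 by linarith
qed

lemma AA_3: "AA Ga 0.3 \<le> 0.754094"
  using ln_3_upper by (simp add: AA_def aa_def qq_def)

text \<open>0.96 is a lower bound for the slope \<open>Ga / AA\<close> of \<open>V0\<close> up to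
  0.3, taken from the value of \<open>AA\<close> at the right end.\<close>

lemma WW_3: "WW 0.3 \<ge> 0.44402"
proof -
  let ?h = "\<lambda>x. V0 x - 0.96 * x"
  have "?h 0.2105 \<le> ?h 0.3"
  proof (rule DERIV_nonneg_imp_nondecreasing[where f = ?h])
    fix z :: real assume z: "0.2105 \<le> z" "z \<le> 0.3"
    have A: "AA Ga z \<le> 0.754094" "AA Ga z > 0" using AA_mono[of Ga z "0.3"] AA_3 AA_pos[of Ga z] z by auto
    have "Ga / AA Ga z \<ge> 0.96" using A by (simp add: field_simps)
    moreover have "(?h has_real_derivative (Ga / AA Ga z - 0.96)) (at z)"
      using z by (auto intro!: derivative_eq_intros V0_deriv)
    ultimately show "\<exists>d. (?h has_real_derivative d) (at z) \<and> 0 \<le> d" 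
      by (intro exI conjI) (assumption, simp)
  qed simp
  then show ?thesis using V0_2105 by (simp add: WW_def)
qed

lemma MM_low2: assumes x: "0.3 \<le> x" "x \<le> 0.5"
  shows "MM x \<ge> Ga * (0.09902 + 1.3 * (x - 0.3))"
proof -
  let ?h = "\<lambda>x. MM x - Ga * (0.09902 + 1.3 * (x - 0.3))"
  have "?h 0.3 \<le> ?h x"
  proof (rule DERIV_nonneg_imp_nondecreasing[where f = ?h])
    fix z assume z: "0.3 \<le> z" "z \<le> x"
    have d: "(?h has_real_derivative (Ga * (2 - (- ln z) * (1 - WW z)) - Ga * 1.3)) (at z)"
      using z x by (auto intro!: derivative_eq_intros MM_deriv)
    have W: "1 - WW z \<le> 0.55598" using V0_mono[of "0.3" z] WW_3 z x by (simp add: WW_def)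
    have l: "- ln z \<le> 1.203973" using ln_dec[of "0.3" z, OF _ z(1)] ln_3_upper by simp
    have "(- ln z) * (1 - WW z) \<le> (- ln z) * 0.55598" using W z x by (intro mult_left_mono) auto
    also have "\<dots> \<le> 1.203973 * 0.55598" using l by (intro mult_right_mono) auto
    finally have P: "(- ln z) * (1 - WW z) \<le> \<dots>" .
    define X where "X = (- ln z) * (1 - WW z)"
    show "\<exists>d. (?h has_real_derivative d) (at z) \<and> 0 \<le> d" by (rule deriv_nonnegI[OF d]) (use P l in \<open>fold X_def, simp add: field_simps\<close>)
  qed (use x in simp)
  moreover have "?h 0.3 \<ge> 0" using MM_low1[of "0.3"] by (simp add: power2_eq_square)
  ultimately have "?h x \<ge> 0" by linarith
  then show ?thesis by simp
qed

text \<open>Divided by \<open>AA\<close> this says \<open>V0 \<ge> qq / AA\<close>: from 0.214 on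
  the unpadded \<open>V0\<close> is itself a potential for all y.\<close>

lemma MM_AA: assumes x: "0.214 \<le> x" "x \<le> 1" shows "MM x \<ge> 0.002 * AA Ga x"
proof -
  let ?h = "\<lambda>x. MM x - 0.002 * AA Ga x"
  have "?h 0.214 \<le> ?h x"
  proof (rule DERIV_nonneg_imp_nondecreasing[where f = ?h])
    fix z assume z: "0.214 \<le> z" "z \<le> x"
    have d: "(?h has_real_derivative (Ga * (2 - (- ln z) * (1 - WW z)) - 0.002 * (- (Ga * ln z)))) (at z)"
      using z x by (auto intro!: derivative_eq_intros MM_deriv AA_deriv)
    have W: "1 - WW z \<le> 0.641891" using V0_mono[of "0.2105" z] V0_2105 z x by (simp add: WW_def)
    have l: "- ln z \<le> 1.55827" using ln_dec[of "0.2105" z, OF _ order_trans[OF _ z(1)]] ln_2105_upper by simp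
    have "(- ln z) * (1 - WW z) \<le> (- ln z) * 0.641891" using W z x by (intro mult_left_mono) auto
    also have "\<dots> \<le> 1.55827 * 0.641891" using l by (intro mult_right_mono) auto
    finally have P: "(- ln z) * (1 - WW z) \<le> \<dots>" .
    define X where "X = (- ln z) * (1 - WW z)"
    show "\<exists>d. (?h has_real_derivative d) (at z) \<and> 0 \<le> d" by (rule deriv_nonnegI[OF d]) (use P l in \<open>fold X_def, simp add: field_simps\<close>)
  qed (use x in simp)
  moreover have "?h 0.214 \<ge> 0" using MM_low1[of "0.214"] AA_mono[of Ga "0.214" "0.3"] AA_3 
    by (simp add: power2_eq_square)
  ultimately show ?thesis by simp
qed

lemma MM_nonneg: assumes "0.2105 \<le> x" "x \<le> 1" shows "MM x \<ge> 0"
proof (cases "x \<le> 0.3")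
  case True then show ?thesis using MM_low1[of x] assms by (intro order_trans[OF _ MM_low1]) auto
next
  case False then show ?thesis using MM_AA[of x] AA_pos[of Ga x] assms by simp
qed

section \<open>The arrival mass of a single item\<close>

text \<open>The solution of G * (1 - U) = U' * \<open>aa\<close> with U = 0 at 0, which is the
  potential equation for y = 1.\<close>

definition BB :: "real \<Rightarrow> real \<Rightarrow> real" where "BB G x = G * x / aa G x"

lemma aa_pos: "0 < G \<Longrightarrow> G < 1 \<Longrightarrow> 0 \<le> x \<Longrightarrow> aa G x > 0"
  by (simp add: aa_def add_pos_nonneg)

lemma BB_deriv: assumes "0 < G" "G < 1" "0 \<le> x"
  shows "(BB G has_real_derivative G * (1 - G) / (aa G x)^2) (at x)"
proof -
  have a: "aa G x \<noteq> 0" using aa_pos[OF assms] by simp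
  have "(BB G has_real_derivative (G * aa G x - G * x * G) / (aa G x * aa G x)) (at x)"
    unfolding BB_def[abs_def] aa_def using a unfolding aa_def
    by (auto intro!: derivative_eq_intros)
  then show ?thesis by (rule DERIV_cong) (simp add: aa_def power2_eq_square algebra_simps)
qed

text \<open>The potential condition for \<open>BB\<close> is an equality at y = 1, hence the factor
  1 - y. The sign of the last factor is that of (1 - G) * (- ln x) - \<open>aa G x\<close>; for G =
  0.7258 it changes just above 0.2105, which is the origin of that number.\<close>

lemma BB_defect: assumes "0 < G" "G < 1" "0 \<le> x"
  shows "G * (1 - G) / (aa G x)^2 * (aa G x + (1 - y) * qq G x) - G * (1 - y * BB G x)
    = G * (1 - y) / (aa G x)^2 * ((1 - G) * qq G x - G * x * aa G x)"
proof -
  have a: "aa G x \<noteq> 0" using aa_pos[OF assms] by simp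
  define i where "i = 1 / aa G x"
  have i: "aa G x * i = 1" using a by (simp add: i_def)
  have g: "1 - G = aa G x - G * x" by (simp add: aa_def)
  have "G * (1 - G) * i^2 * (aa G x + (1 - y) * qq G x) - G * (1 - y * (G * x * i))
    = G * (1 - y) * i^2 * ((1 - G) * qq G x - G * x * aa G x)"
    using i unfolding g by algebra
  then show ?thesis by (simp add: i_def BB_def power_divide)
qed

text \<open>The potential condition for a function of slope G / \<open>AA\<close> + k, rearranged.
  With k = 0 and \<eta> > 0 it reduces to U \<ge> \<open>qq\<close> / \<open>AA\<close>.\<close>

lemma lin_cond: 
  assumes A: "AA G x > 0" and e: "\<eta> * (G * (U - qq G x / AA G x) - k * qq G x) \<ge> - (k * AA G x)"
  shows "G * (1 - \<eta> * U) \<le> (G / AA G x + k) * (aa G x + (1 - \<eta>) * qq G x)"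
proof -
  have "(G / AA G x + k) * (aa G x + (1 - \<eta>) * qq G x) = (G / AA G x + k) * (AA G x - \<eta> * qq G x)"
    by (simp add: AA_def algebra_simps)
  also have "\<dots> = G - \<eta> * G * (qq G x / AA G x) + k * AA G x - k * \<eta> * qq G x"
    using A by (simp add: field_simps)
  also have "\<dots> = G * (1 - \<eta> * U) + (\<eta> * (G * (U - qq G x / AA G x) - k * qq G x) + k * AA G x)"
    by (simp add: algebra_simps)
  finally show ?thesis using e by linarith
qed

lemma Ga01: "0 < Ga" "Ga < 1" by simp_all

text \<open>What the mass bound uses about one item: y is its own q, z the product of 1 - q over the
  others, F the mass arrived so far, g the chance that it has not yet arrived and been acceptable, c
  the ratio of its density to g, and S the chance that nothing is sold.\<close>

locale item_curve =
  fixes G :: real and z y S c F g :: "real \<Rightarrow> real"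
  assumes G: "0 < G" "G < 1"
    and cz: "continuous_on {0..1} z" and cF: "continuous_on {0..1} F" and cg: "continuous_on {0..1} g"
    and dz: "\<And>t. 0 < t \<Longrightarrow> t < 1 \<Longrightarrow> (z has_real_derivative - (c t * S t / G)) (at t)"
    and dF: "\<And>t. 0 < t \<Longrightarrow> t < 1 \<Longrightarrow> (F has_real_derivative c t * g t) (at t)"
    and dg: "\<And>t. 0 < t \<Longrightarrow> t < 1 \<Longrightarrow> (g has_real_derivative - (y t * (c t * g t))) (at t)"
    and c: "\<And>t. 0 < t \<Longrightarrow> t < 1 \<Longrightarrow> c t \<ge> 0"
    and S: "\<And>t. 0 \<le> t \<Longrightarrow> t \<le> 1 \<Longrightarrow> aa G (z t) + (1 - y t) * qq G (z t) \<le> S t"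
    and z: "\<And>s t. 0 \<le> s \<Longrightarrow> s \<le> t \<Longrightarrow> t \<le> 1 \<Longrightarrow> z t \<le> z s"
    and y: "\<And>s t. 0 \<le> s \<Longrightarrow> s \<le> t \<Longrightarrow> t \<le> 1 \<Longrightarrow> y s \<le> y t"
    and y01: "\<And>t. 0 \<le> t \<Longrightarrow> t \<le> 1 \<Longrightarrow> y t \<in> {0..1}"
    and z0: "z 0 = 1" and z1: "z 1 = 0" and F0: "F 0 = 0" and g0: "g 0 = 1"
    and g: "\<And>t. 0 \<le> t \<Longrightarrow> t \<le> 1 \<Longrightarrow> g t \<ge> 0"
begin

lemma z01: "0 \<le> t \<Longrightarrow> t \<le> 1 \<Longrightarrow> z t \<in> {0..1}"
  using z[of 0 t] z[of t 1] z0 z1 by auto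

lemma hit_before: assumes "0 \<le> t" "t \<le> 1" "z t \<le> v" "v \<le> 1" obtains s where "0 \<le> s" "s \<le> t" "z s = v"
  using IVT2'[of z t v 0] assms z0 continuous_on_subset[OF cz, of "{0..t}"] by auto

lemma hit_after: assumes "0 \<le> t" "t \<le> 1" "v \<le> z t" "0 \<le> v" obtains s where "t \<le> s" "s \<le> 1" "z s = v"
  using IVT2'[of z 1 v t] assms z1 continuous_on_subset[OF cz, of "{t..1}"] by auto

text \<open>The derivative of F + g * U(z) is - c * g / G * (U' * S - G * (1 - y * U)). A potential
  that vanishes at z = 0 therefore bounds the mass still to come relative to g, and potentials on
  adjacent ranges of z can be chained.\<close>

lemma pot:
  assumes st: "0 \<le> s" "s \<le> t" "t \<le> 1"
    and dU: "\<And>x. z t \<le> x \<Longrightarrow> x \<le> z s \<Longrightarrow> (U has_real_derivative U' x) (at x)"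
    and cond: "\<And>r. s < r \<Longrightarrow> r < t \<Longrightarrow> G * (1 - y r * U (z r)) \<le> U' (z r) * S r"
  shows "F t + g t * U (z t) \<le> F s + g s * U (z s)"
proof (cases "s = t")
  case False
  let ?h = "\<lambda>r. F r + g r * U (z r)"
  have zr: "z t \<le> z r" "z r \<le> z s" if "s \<le> r" "r \<le> t" for r using z[of s r] z[of r t] that st by auto
  have "?h s \<ge> ?h t"
  proof (rule DERIV_nonpos_imp_decreasing_open[where f = ?h])
    show "s \<le> t" using st by simp
    fix r assume r: "s < r" "r < t"
    let ?d = "c r * g r + (- (y r * (c r * g r)) * U (z r) + U' (z r) * - (c r * S r / G) * g r)"
    have "((\<lambda>r. U (z r)) has_real_derivative U' (z r) * - (c r * S r / G)) (at r)"
      by (rule DERIV_chain2[OF dU dz]) (use r st zr[of r] in auto)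
    then have "(?h has_real_derivative ?d) (at r)"
      using r st by (intro DERIV_add DERIV_mult dF dg) auto
    moreover have "?d = - (c r * g r / G * (U' (z r) * S r - G * (1 - y r * U (z r))))"
      using G by (simp add: field_simps)
    moreover have "c r * g r / G * (U' (z r) * S r - G * (1 - y r * U (z r))) \<ge> 0"
      using cond[OF r] c[of r] g[of r] G r st by (intro mult_nonneg_nonneg divide_nonneg_pos) auto
    ultimately show "\<exists>d. (?h has_real_derivative d) (at r) \<and> d \<le> 0" by (metis neg_le_0_iff_le)
  next
    have "continuous_on {z t..z s} U"
      using dU by (intro continuous_at_imp_continuous_on ballI DERIV_isCont) auto
    then have "continuous_on {s..t} (\<lambda>r. U (z r))"
      by (rule continuous_on_compose2) (use cz st zr in \<open>auto intro: continuous_on_subset\<close>)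
    then show "continuous_on {s..t} ?h"
      using cF cg st by (auto intro!: continuous_intros intro: continuous_on_subset)
  qed
  then show ?thesis .
qed simp

text \<open>As U' \<ge> 0, S may be replaced by its lower bound in z and y. What is left is an
  inequality in two real variables, x for z and \<eta> for y, over the ranges that monotonicity
  allows.\<close>

lemma pot_std:
  assumes st: "0 \<le> s" "s \<le> t" "t \<le> 1"
    and dU: "\<And>x. z t \<le> x \<Longrightarrow> x \<le> z s \<Longrightarrow> (U has_real_derivative U' x) (at x)"
    and U': "\<And>x. z t \<le> x \<Longrightarrow> x \<le> z s \<Longrightarrow> U' x \<ge> 0"
    and cond: "\<And>x \<eta>. z t \<le> x \<Longrightarrow> x \<le> z s \<Longrightarrow> y s \<le> \<eta> \<Longrightarrow> \<eta> \<le> y t \<Longrightarrow> 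
      G * (1 - \<eta> * U x) \<le> U' x * (aa G x + (1 - \<eta>) * qq G x)"
  shows "F t + g t * U (z t) \<le> F s + g s * U (z s)"
proof (rule pot[OF st dU])
  fix r assume r: "s < r" "r < t"
  have zr: "z t \<le> z r" "z r \<le> z s" using z[of s r] z[of r t] r st by auto
  have "G * (1 - y r * U (z r)) \<le> U' (z r) * (aa G (z r) + (1 - y r) * qq G (z r))"
    using y[of s r] y[of r t] r st zr by (intro cond) auto
  also have "\<dots> \<le> U' (z r) * S r" using S[of r] U'[OF zr] r st by (intro mult_left_mono) auto
  finally show "G * (1 - y r * U (z r)) \<le> U' (z r) * S r" .
qed auto

end

section \<open>Rate 0.7258: which courses can exceed mass 1\<close>

locale item_curve_a = item_curve Ga z y S c F g for z y S c F g
begin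

lemma pot_BB: assumes t: "0 \<le> t" "t \<le> 1" "z t \<le> 0.2105" shows "F 1 \<le> F t + g t * BB Ga (z t)"
proof -
  have "F 1 + g 1 * BB Ga (z 1) \<le> F t + g t * BB Ga (z t)"
  proof (rule pot_std)
    fix x assume "z 1 \<le> x" "x \<le> z t"
    then have x: "0 \<le> x" "x \<le> 0.2105" using t z1 by auto
    show "(BB Ga has_real_derivative Ga * (1 - Ga) / (aa Ga x)^2) (at x)" using x by (intro BB_deriv) auto
    show "0 \<le> Ga * (1 - Ga) / (aa Ga x)^2" by simp
    fix \<eta> assume "y t \<le> \<eta>" "\<eta> \<le> y 1"
    then have \<eta>: "\<eta> \<le> 1" using y01[of 1] by auto
    have "(1 - Ga) * qq Ga x - Ga * x * aa Ga x \<ge> 0"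
    proof (cases "x = 0")
      case False
      then have "- ln x \<ge> - ln 0.2105" using x by (intro ln_dec) auto
      then have "(1 - Ga) * (- ln x) \<ge> aa Ga x" using tabA_ln0 x by (simp add: aa_def)
      then have "Ga * x * ((1 - Ga) * (- ln x)) \<ge> Ga * x * aa Ga x" using x by (intro mult_left_mono) auto
      then show ?thesis by (simp add: qq_def algebra_simps)
    qed (simp add: qq_def)
    then have "0 \<le> Ga * (1 - \<eta>) / (aa Ga x)^2 * ((1 - Ga) * qq Ga x - Ga * x * aa Ga x)" using \<eta>
      by (intro mult_nonneg_nonneg) auto
    then show "Ga * (1 - \<eta> * BB Ga x) \<le> Ga * (1 - Ga) / (aa Ga x)^2 * (aa Ga x + (1 - \<eta>) * qq Ga x)"
      using BB_defect[OF Ga01 x(1), of \<eta>] by linarith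
  qed (use t in auto)
  then show ?thesis by (simp add: z1 BB_def)
qed

lemma MM_div: assumes "0.2105 \<le> x" "x \<le> 1" shows "WW x - qq Ga x / AA Ga x = MM x / AA Ga x"
  using AA_pos[of Ga x] assms by (simp add: MM_def field_simps)

lemma pot_V0: assumes t: "0 \<le> t" "t \<le> 1" "z t \<ge> 0.214" shows "F t + g t * V0 (z t) \<le> 1"
proof -
  have "F t + g t * V0 (z t) \<le> F 0 + g 0 * V0 (z 0)"
  proof (rule pot_std)
    fix x assume "z t \<le> x" "x \<le> z 0"
    then have x: "0.214 \<le> x" "x \<le> 1" using t z0 by auto
    have A: "AA Ga x > 0" using x by (intro AA_pos) auto
    show "(V0 has_real_derivative Ga / AA Ga x) (at x)" using x by (intro V0_deriv) auto
    show "0 \<le> Ga / AA Ga x" using A by simp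
    fix \<eta> assume "y 0 \<le> \<eta>" "\<eta> \<le> y t"
    then have \<eta>: "0 \<le> \<eta>" using y01[of 0] by auto
    have "WW x - qq Ga x / AA Ga x \<ge> 0.002" 
      using MM_AA[OF x] A x by (subst MM_div) (auto simp: field_simps)
    then have "V0 x - qq Ga x / AA Ga x \<ge> 0" unfolding WW_def by linarith
    then have "\<eta> * (Ga * (V0 x - qq Ga x / AA Ga x)) \<ge> 0" using \<eta>
      by (intro mult_nonneg_nonneg) auto
    then show "Ga * (1 - \<eta> * V0 x) \<le> Ga / AA Ga x * (aa Ga x + (1 - \<eta>) * qq Ga x)"
      using lin_cond[OF A, where \<eta> = \<eta> and U = "V0 x" and k = 0] by (simp only: mult_zero_left diff_zero add_0_right minus_zero)
  qed (use t in auto)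
  then show ?thesis by (simp add: F0 g0 z0 V0_1)
qed

text \<open>The amount, per unit of y, by which a positive y lets the potential be lowered. It
  vanishes at 0.2105, and its slope is kept below \<open>Ga * MM / AA^2\<close>.\<close>

definition kk :: "real \<Rightarrow> real" where "kk x = 0.56 * (x - 0.2105)^2 - 0.4667 * (x - 0.2105)^3"

text \<open>Both sides are small near 0.2105, so up to 0.3 their common factor u = x - 0.2105 is
  separated before \<open>AA\<close> is replaced by a tangent. Beyond 0.3 the linear bound for
  \<open>MM\<close> takes over.\<close>

lemma slope: assumes x: "0.2105 \<le> x" "x \<le> 0.5" 
  shows "Ga * MM x \<ge> (1.12 * (x - 0.2105) - 1.4 * (x - 0.2105)^2) * (AA Ga x)^2"
proof -
  have A: "AA Ga x > 0" using x by (intro AA_pos) auto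
  define u where "u = x - 0.2105"
  show ?thesis
  proof (cases "x \<le> 0.3")
    case True
    have "AA Ga x \<le> 1 - Ga + Ga * (0.25 - x * ln 0.25)" using x by (intro AA_tangent) auto
    also have "\<dots> \<le> 0.707194 + 1.00618 * (u - 0.0395)"
    proof -
      define l where "l = ln (0.25::real)"
      have "x * (- l) \<le> x * 1.386295" using ln_25_upper x unfolding l_def by (intro mult_left_mono) auto
      then show ?thesis using x unfolding u_def l_def[symmetric] by (simp add: field_simps)
    qed
    finally have "(AA Ga x)^2 \<le> (0.707194 + 1.00618 * (u - 0.0395))^2" using A by (intro power_mono) auto
    moreover have u: "0 \<le> u" "u \<le> 0.0895" using x True by (auto simp: u_def)
    then have "u * (1.12 - 1.4 * u) \<ge> 0" by auto
    ultimately have "u * (1.12 - 1.4 * u) * (AA Ga x)^2 \<le> u * (1.12 - 1.4 * u) * (0.707194 + 1.00618 * (u - 0.0395))^2"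
      by (intro mult_left_mono) auto
    also have "\<dots> = u * ((1.12 - 1.4 * u) * (0.707194 + 1.00618 * (u - 0.0395))^2)" by simp
    also have "\<dots> \<le> u * (Ga^2 * (0.999 + 1.2 * u))" using slope_poly0[of u] u by (intro mult_left_mono) auto
    also have "\<dots> = Ga * (Ga * (0.999 * u + 1.2 * u^2))" by (simp add: power2_eq_square algebra_simps)
    also have "\<dots> \<le> Ga * MM x" using MM_low1[of x] x True by (intro mult_left_mono) (auto simp: u_def)
    moreover have e: "1.12 * (x - 0.2105) - 1.4 * (x - 0.2105)^2 = u * (1.12 - 1.4 * u)" 
      unfolding u_def[symmetric] by (simp add: power2_eq_square algebra_simps)
    ultimately show ?thesis unfolding e by linarith
  next
    case False
    define v where "v = x - 0.3"
    have v: "0 \<le> v" "v \<le> 0.2" "u = 0.0895 + v" using x False by (auto simp: u_def v_def)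
    have "AA Ga x \<le> 1 - Ga + Ga * (0.3 - x * ln 0.3)" using x by (intro AA_tangent) auto
    also have "\<dots> \<le> 0.754094 + 0.873842 * v"
    proof -
      define l where "l = ln (0.3::real)"
      have "x * (- l) \<le> x * 1.203973" using ln_3_upper x unfolding l_def by (intro mult_left_mono) auto
      then show ?thesis using x False unfolding v_def l_def[symmetric] by (simp add: field_simps)
    qed
    finally have "(AA Ga x)^2 \<le> (0.754094 + 0.873842 * v)^2" using A by (intro power_mono) auto
    moreover have "1.12 * u - 1.4 * u^2 = u * (1.12 - 1.4 * u)" by (simp add: power2_eq_square algebra_simps)
    then have "1.12 * u - 1.4 * u^2 \<ge> 0" using v by simp
    ultimately have "(1.12 * u - 1.4 * u^2) * (AA Ga x)^2 \<le> (1.12 * u - 1.4 * u^2) * (0.754094 + 0.873842 * v)^2"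
      by (intro mult_left_mono) auto
    also have "\<dots> \<le> Ga^2 * (0.09902 + 1.3 * v)" using slope_poly1[of v] v by simp
    also have "\<dots> = Ga * (Ga * (0.09902 + 1.3 * v))" by (simp add: power2_eq_square)
    also have "\<dots> \<le> Ga * MM x" using MM_low2[of x] x False by (intro mult_left_mono) (auto simp: v_def)
    finally show ?thesis by (simp add: u_def)
  qed
qed


text \<open>The quadratic is the derivative of \<open>kk\<close>: 1.12 = 2 * 0.56 and 1.4001 = 3 *
  0.4667, slightly below the quadratic of \<open>slope\<close>. The second claim lets the
  \<open>qq\<close> term of \<open>lin_cond\<close> absorb the lowering of the potential by
  \<open>kk\<close>.\<close>

lemma kk_bound: assumes "0.2105 \<le> x" "x \<le> 0.5"
  shows "1.12 * (x - 0.2105) - 1.4001 * (x - 0.2105)^2 \<ge> 0"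
    and "Ga * kk x \<le> (1.12 * (x - 0.2105) - 1.4001 * (x - 0.2105)^2) * qq Ga x" and "kk x \<ge> 0"
proof -
  define u where "u = x - 0.2105"
  have u: "0 \<le> u" "u \<le> 0.2895" using assms by (auto simp: u_def)
  have e1: "1.12 * u - 1.4001 * u^2 = u * (1.12 - 1.4001 * u)" by (simp add: power2_eq_square algebra_simps)
  have e2: "kk x = u^2 * (0.56 - 0.4667 * u)" 
    unfolding kk_def u_def[symmetric] by (simp add: power2_eq_square power3_eq_cube algebra_simps)
  have s1: "u * 0.7146 \<le> u * (1.12 - 1.4001 * u)" using u by (intro mult_left_mono) auto
  then show n: "1.12 * (x - 0.2105) - 1.4001 * (x - 0.2105)^2 \<ge> 0" unfolding u_def[symmetric] e1 using u by simp
  show "kk x \<ge> 0" unfolding e2 using u by simp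
  \<comment> \<open>Tangent at 0.334 with slope rounded to 3. Together with (x - 0.2105) * (1/2 - x)
    \<ge> 0, which linearises the square, it yields x * (- ln x) \<ge> 0.29.\<close>
  have "1.09661 + (1 - 3 * x) \<le> - ln x" using assms tabA_ln7 by (intro ln_tangent[of x "0.334"]) auto
  then have "209661 / 100000 - 3 * x \<le> - ln x" by simp
  then have "x * (209661 / 100000 - 3 * x) \<le> x * (- ln x)" using assms by (intro mult_left_mono) auto
  moreover have "209661 / 100000 * x - 3 * (x * x) = x * (209661 / 100000 - 3 * x)" by (simp add: field_simps)
  ultimately have h1: "209661 / 100000 * x - 3 * (x * x) \<le> x * (- ln x)" by (simp only:)
  have "(x - 421 / 2000) * (1 / 2 - x) \<ge> 0" using assms by (intro mult_nonneg_nonneg) auto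
  moreover have "1421 / 2000 * x - 421 / 4000 - x * x = (x - 421 / 2000) * (1 / 2 - x)" by (simp add: field_simps)
  ultimately have h2: "1421 / 2000 * x - 421 / 4000 - x * x \<ge> 0" by (simp only:)
  have "x \<le> 1 / 2" using assms by simp
  with h1 h2 have "29 / 100 \<le> x * (- ln x)" by linarith
  then have "0.29 \<le> x * (- ln x)" by simp
  then have q: "qq Ga x \<ge> Ga * 0.29" unfolding qq_def by simp
  have "kk x \<le> u * (0.2895 * 0.56)" 
  proof -
    have "u * (0.56 - 0.4667 * u) \<le> 0.2895 * 0.56" using u by (intro mult_mono) auto
    then have "u * (u * (0.56 - 0.4667 * u)) \<le> u * (0.2895 * 0.56)" using u by (intro mult_left_mono) auto
    then show ?thesis unfolding e2 by (simp add: power2_eq_square mult.assoc)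
  qed
  then have "Ga * kk x \<le> Ga * (u * (0.2895 * 0.56))" by simp
  also have "\<dots> \<le> u * 0.7146 * (Ga * 0.29)" using u by simp
  also have "\<dots> \<le> u * (1.12 - 1.4001 * u) * qq Ga x" using s1 q u by (intro mult_mono) auto
  finally show "Ga * kk x \<le> (1.12 * (x - 0.2105) - 1.4001 * (x - 0.2105)^2) * qq Ga x"
    unfolding u_def[symmetric] e1 .
qed

lemma kk_deriv: "(kk has_real_derivative 1.12 * (x - 0.2105) - 1.4001 * (x - 0.2105)^2) (at x)"
proof -
  have "(kk has_real_derivative 0.56 * (2 * (x - 0.2105)) - 0.4667 * (3 * (x - 0.2105)^2)) (at x)"
    unfolding kk_def[abs_def] by (auto intro!: derivative_eq_intros)
  then show ?thesis by simp
qed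

lemma WW_deriv: "1/10 < x \<Longrightarrow> x < 2 \<Longrightarrow> (WW has_real_derivative Ga / AA Ga x) (at x)"
  unfolding WW_def[abs_def] by (auto intro!: derivative_eq_intros V0_deriv)

text \<open>An early positive y is a gain. From t on y is at least \<open>y t\<close>, so
  \<open>WW\<close> - \<open>y t\<close> * \<open>kk\<close> is a potential down to 0.2105. At t it
  is at most \<open>V0\<close>, because the subtracted term covers the slack 0.002; at 0.2105 it
  equals \<open>WW\<close>, which dominates \<open>BB\<close>. This closes the gap.\<close>

lemma upper_structure:
  assumes t: "0 \<le> t" "t \<le> 1" and zt: "0.214 \<le> z t" "z t \<le> 0.5" and k: "y t * kk (z t) \<ge> 0.002"
  shows "F 1 \<le> 1"
proof -
  define \<eta>0 where "\<eta>0 = y t"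
  have \<eta>0: "0 \<le> \<eta>0" "\<eta>0 \<le> 1" using y01[of t] t by (auto simp: \<eta>0_def)
  obtain s where s: "t \<le> s" "s \<le> 1" "z s = 0.2105" using hit_after[of t "0.2105"] t zt by auto
  let ?k' = "\<lambda>x. 1.12 * (x - 0.2105) - 1.4001 * (x - 0.2105)^2"
  have "F s + g s * (WW (z s) - \<eta>0 * kk (z s)) \<le> F t + g t * (WW (z t) - \<eta>0 * kk (z t))"
  proof (rule pot_std[where U = "\<lambda>x. WW x - \<eta>0 * kk x" and U' = "\<lambda>x. Ga / AA Ga x + - (\<eta>0 * ?k' x)"])
    fix x assume "z s \<le> x" "x \<le> z t"
    then have x: "0.2105 \<le> x" "x \<le> 0.5" using s zt by auto
    have A: "AA Ga x > 0" "AA Ga x \<le> 1" using x AA_pos[of Ga x] AA_le_1[of Ga x] by auto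
    show "((\<lambda>x. WW x - \<eta>0 * kk x) has_real_derivative Ga / AA Ga x + - (\<eta>0 * ?k' x)) (at x)"
      using x by (auto intro!: derivative_eq_intros WW_deriv kk_deriv)
    have k'0: "?k' x \<ge> 0" by (rule kk_bound[OF x])
    have "?k' x \<le> 1.12 * (x - 0.2105) - 0" by (intro diff_left_mono) simp
    also have "\<dots> \<le> 0.33" using x by simp
    finally have "?k' x \<le> 0.33" .
    then have "\<eta>0 * ?k' x \<le> 1 * 0.33" using \<eta>0 k'0 by (intro mult_mono) auto
    moreover have "0.33 \<le> Ga / AA Ga x" using A by (simp add: field_simps)
    ultimately show "0 \<le> Ga / AA Ga x + - (\<eta>0 * ?k' x)" by linarith
    fix \<eta> assume "y t \<le> \<eta>" "\<eta> \<le> y s"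
    then have \<eta>: "\<eta>0 \<le> \<eta>" "\<eta> \<le> 1" using y01[of s] t s by (auto simp: \<eta>0_def)
    define k' where "k' = ?k' x"
    have "(1.12 * (x - 0.2105) - 1.4 * (x - 0.2105)^2) * (AA Ga x)^2 \<ge> k' * (AA Ga x)^2"
      unfolding k'_def by (intro mult_right_mono) auto
    then have K: "Ga * MM x \<ge> k' * (AA Ga x)^2" using slope[OF x] by linarith
    have "MM x / AA Ga x = WW x - qq Ga x / AA Ga x" by (rule MM_div[symmetric]) (use x in auto)
    then have K1: "k' * AA Ga x \<le> Ga * (WW x - qq Ga x / AA Ga x)" using K A
      by (simp add: field_simps power2_eq_square)
    \<comment> \<open>Lowering the potential costs Ga * \<open>kk\<close>, which the term k' *
      \<open>qq\<close> of \<open>lin_cond\<close> returns. The rest is K1 multiplied by \<eta>, and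
      \<eta> \<ge> \<eta>0.\<close>
    have K2: "\<eta>0 * (Ga * kk x) \<le> \<eta>0 * (k' * qq Ga x)" 
      using kk_bound(2)[OF x] \<eta>0 unfolding k'_def by (intro mult_left_mono) auto
    have "\<eta>0 * (k' * AA Ga x) \<le> \<eta> * (k' * AA Ga x)" 
      using \<eta> k'0 A by (intro mult_right_mono) (auto simp: k'_def)
    also have "k' * AA Ga x \<le> Ga * (WW x - \<eta>0 * kk x - qq Ga x / AA Ga x) - - (\<eta>0 * k') * qq Ga x"
      using K1 K2 by (simp add: algebra_simps)
    then have "\<eta> * (k' * AA Ga x) \<le> \<eta> * (Ga * (WW x - \<eta>0 * kk x - qq Ga x / AA Ga x) - - (\<eta>0 * k') * qq Ga x)"
      using \<eta> \<eta>0 by (intro mult_left_mono) auto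
    finally show "Ga * (1 - \<eta> * (WW x - \<eta>0 * kk x)) \<le> (Ga / AA Ga x + - (\<eta>0 * ?k' x)) * (aa Ga x + (1 - \<eta>) * qq Ga x)"
      unfolding k'_def[symmetric] by (intro lin_cond[OF A(1)]) simp
  qed (use t s in auto)
  moreover have "WW (z t) - \<eta>0 * kk (z t) \<le> V0 (z t)" using k by (simp add: WW_def \<eta>0_def)
  then have "g t * (WW (z t) - \<eta>0 * kk (z t)) \<le> g t * V0 (z t)" using g[of t] t by (intro mult_left_mono) auto
  moreover have "F t + g t * V0 (z t) \<le> 1" by (rule pot_V0) (use t zt in auto)
  ultimately have 1: "F s + g s * WW 0.2105 \<le> 1" unfolding s(3) kk_def by simp
  have "BB Ga 0.2105 \<le> WW 0.2105" using V0_2105 by (simp add: BB_def aa_def WW_def)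
  then have "g s * BB Ga 0.2105 \<le> g s * WW 0.2105" using g[of s] t s by (intro mult_left_mono) auto
  then show ?thesis using pot_BB[of s] 1 t s by simp
qed


lemma ln_l19: "1.66073 \<le> - ln (0.19::real)"
  by (rule order_trans[OF _ ln_lower[of _ 18]]) (simp_all add: eval_nat_numeral)

lemma ln_l17: "1.77195 \<le> - ln (0.17::real)"
  by (rule order_trans[OF _ ln_lower[of _ 18]]) (simp_all add: eval_nat_numeral)

lemma ln_l15: "1.89711 \<le> - ln (0.15::real)"
  by (rule order_trans[OF _ ln_lower[of _ 18]]) (simp_all add: eval_nat_numeral)

lemma ln_l13: "2.04021 \<le> - ln (0.13::real)"
  by (rule order_trans[OF _ ln_lower[of _ 18]]) (simp_all add: eval_nat_numeral)

text \<open>Below 0.2105 the slack of \<open>BB\<close> grows at least linearly with the distance.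
  Both sides are affine in - ln x, and in their difference - ln x has the nonnegative coefficient C,
  so a lower tangent may be inserted on each of five intervals.\<close>

lemma deficit: assumes "0.12 \<le> x" "x \<le> 0.2105"
  shows "Ga * ((1 - Ga) * qq Ga x - Ga * x * aa Ga x) \<ge> 1.85 * (0.2105 - x) * AA Ga x * (aa Ga x)^2"
proof -
  have key: ?thesis if L: "L \<le> - ln x" 
    and p: "0 \<le> 0.7258^2 * x * (0.2742 * L - (0.2742 + 0.7258 * x)) - 1.85 * (0.2105 - x) * 
      ((0.2742 + 0.7258 * x) + 0.7258 * x * L) * (0.2742 + 0.7258 * x)^2" for L
  proof -
    define l where "l = - ln x"
    define a where "a = aa Ga x"
    have a: "a = 0.2742 + 0.7258 * x" by (simp add: a_def aa_def)
    have a2: "a^2 \<le> 0.43^2" using assms unfolding a by (intro power_mono) auto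
    define C where "C = Ga * x * (Ga * (1 - Ga) - 1.85 * (0.2105 - x) * a^2)"
    have "1.85 * (0.2105 - x) * a^2 \<le> 0.17 * 0.43^2" using assms a2 by (intro mult_mono) auto
    also have "\<dots> \<le> Ga * (1 - Ga)" by (simp add: power2_eq_square)
    finally have "0 \<le> Ga * (1 - Ga) - 1.85 * (0.2105 - x) * a^2" by (simp only: diff_ge_0_iff_ge)
    moreover have "0 \<le> Ga * x" using assms by simp
    ultimately have "C \<ge> 0" unfolding C_def by (rule mult_nonneg_nonneg[rotated])
    then have "C * L \<le> C * l" using L unfolding l_def by (intro mult_left_mono) auto
    moreover have "Ga * ((1 - Ga) * (Ga * x * l) - Ga * x * a) - 1.85 * (0.2105 - x) * (a + Ga * x * l) * a^2
      = C * l - (Ga^2 * x * a + 1.85 * (0.2105 - x) * a * a^2)"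
      unfolding C_def by algebra
    moreover have "0.7258^2 * x * (0.2742 * L - a) - 1.85 * (0.2105 - x) * (a + 0.7258 * x * L) * a^2
      = C * L - (Ga^2 * x * a + 1.85 * (0.2105 - x) * a * a^2)"
      unfolding C_def by algebra
    ultimately have "Ga * ((1 - Ga) * (Ga * x * l) - Ga * x * a) - 1.85 * (0.2105 - x) * (a + Ga * x * l) * a^2 \<ge> 0"
      using p unfolding a[symmetric] by linarith
    then show ?thesis unfolding AA_def qq_def l_def a_def[symmetric] by simp
  qed
  consider "0.2 \<le> x" | "0.18 \<le> x" "x \<le> 0.2" | "0.16 \<le> x" "x \<le> 0.18" | "0.135 \<le> x" "x \<le> 0.16" | "x \<le> 0.135"
    by linarith
  then show ?thesis
  proof cases
    case 1 then show ?thesis using assms tabA_ln0 deficit_poly0[of x]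
      by (intro key[OF ln_tangent[of x "0.2105" "1.558268" "4.7506"]]) auto
  next
    case 2 then show ?thesis using ln_l19 deficit_poly1[of x]
      by (intro key[OF ln_tangent[of x "0.19" "1.66073" "5.2632"]]) auto
  next
    case 3 then show ?thesis using ln_l17 deficit_poly2[of x]
      by (intro key[OF ln_tangent[of x "0.17" "1.77195" "5.8824"]]) auto
  next
    case 4 then show ?thesis using ln_l15 deficit_poly3[of x]
      by (intro key[OF ln_tangent[of x "0.15" "1.89711" "6.6667"]]) auto
  next
    case 5 then show ?thesis using assms ln_l13 deficit_poly4[of x]
      by (intro key[OF ln_tangent[of x "0.13" "2.04021" "7.6924"]]) auto
  qed
qed


text \<open>Between 0.214 and 0.2105 the lowered \<open>V0\<close> may miss the condition for a
  potential, but by at most 0.002014. An extra slope of 0.004 makes up for this and costs 0.004 *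
  0.0035 = 0.000014.\<close>

lemma pot_V0_2105: assumes t: "0 \<le> t" "t \<le> 1" "z t = 0.2105" shows "F t + g t * (V0 0.2105 - 0.000014) \<le> 1"
proof -
  obtain s where s: "0 \<le> s" "s \<le> t" "z s = 0.214" using hit_before[of t "0.214"] t by auto
  have "F t + g t * (V0 (z t) - 0.004 * (0.214 - z t)) \<le> F s + g s * (V0 (z s) - 0.004 * (0.214 - z s))"
  proof (rule pot_std[where U = "\<lambda>x. V0 x - 0.004 * (0.214 - x)" and U' = "\<lambda>x. Ga / AA Ga x + 0.004"])
    fix x assume "z t \<le> x" "x \<le> z s"
    then have x: "0.2105 \<le> x" "x \<le> 0.214" using s t by auto
    have A: "AA Ga x > 0" using x AA_pos[of Ga x] by auto
    show "((\<lambda>x. V0 x - 0.004 * (0.214 - x)) has_real_derivative Ga / AA Ga x + 0.004) (at x)"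
      using x by (auto intro!: derivative_eq_intros V0_deriv)
    show "0 \<le> Ga / AA Ga x + 0.004" using A by simp
    fix \<eta> assume "y s \<le> \<eta>" "\<eta> \<le> y t"
    then have \<eta>: "0 \<le> \<eta>" "\<eta> \<le> 1" using y01[of s] y01[of t] t s by auto
    define Q where "Q = qq Ga x / AA Ga x"
    have "WW x - Q \<ge> 0" unfolding Q_def using MM_nonneg[of x] A x by (subst MM_div) auto
    then have "V0 x - 0.004 * (0.214 - x) - Q \<ge> -0.002014" using x unfolding WW_def by (simp add: field_simps)
    then have "Ga * (V0 x - 0.004 * (0.214 - x) - Q) \<ge> Ga * -0.002014" by (rule mult_left_mono) simp
    then have "Ga * (V0 x - 0.004 * (0.214 - x) - Q) - 0.004 * qq Ga x \<ge> Ga * -0.002014 - 0.004 * qq Ga x"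
      by (rule diff_right_mono)
    also have "Ga * -0.002014 \<ge> - (0.004 * aa Ga x)" using x by (simp add: aa_def)
    then have "Ga * -0.002014 - 0.004 * qq Ga x \<ge> - (0.004 * AA Ga x)" by (simp add: AA_def field_simps)
    finally have 1: "Ga * (V0 x - 0.004 * (0.214 - x) - Q) - 0.004 * qq Ga x \<ge> - (0.004 * AA Ga x)" .
    have "\<eta> * (Ga * (V0 x - 0.004 * (0.214 - x) - Q) - 0.004 * qq Ga x) \<ge> \<eta> * (- (0.004 * AA Ga x))"
      using 1 \<eta>(1) by (rule mult_left_mono)
    also have "\<eta> * (- (0.004 * AA Ga x)) \<ge> - (0.004 * AA Ga x)" using \<eta> A by simp
    finally show "Ga * (1 - \<eta> * (V0 x - 0.004 * (0.214 - x))) \<le> (Ga / AA Ga x + 0.004) * (aa Ga x + (1 - \<eta>) * qq Ga x)"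
      unfolding Q_def by (rule lin_cond[OF A])
  qed (use t s in auto)
  moreover have "F s + g s * V0 (z s) \<le> 1" by (rule pot_V0) (use t s in auto)
  ultimately show ?thesis using s t by simp
qed

text \<open>A y that stays away from 1 after z = 0.2105 is a gain as well. Until t the slack of
  \<open>BB\<close> is at least 1 - \<eta>0 times the bound of \<open>deficit\<close>, so
  \<open>BB\<close> may be lowered by a function \<open>dlt\<close> that is 0 at \<open>z t\<close>
  and at least 0.00173 at 0.2105. That covers the gap 0.35782 - 0.356109 together with the 0.000014
  above.\<close>

lemma lower_structure:
  assumes t: "0 \<le> t" "t \<le> 1" and zt: "0.12 \<le> z t" "z t \<le> 0.2105" and \<eta>0: "y t \<le> \<eta>0" "\<eta>0 \<le> 1"
    and \<tau>: "Ga * \<eta>0 * ((1 - \<eta>0) * 0.925 * (0.2105 - z t)^2) \<le> 0.36 * \<tau>"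
    and D: "0.00173 \<le> (1 - \<eta>0) * 0.925 * (0.2105 - z t)^2 - \<tau> * (0.2105 - z t)"
  shows "F 1 \<le> 1"
proof -
  obtain s where s: "0 \<le> s" "s \<le> t" "z s = 0.2105" using hit_before[of t "0.2105"] t zt by auto
  define \<zeta> where "\<zeta> = z t"
  define C where "C = (1 - \<eta>0) * 0.925"
  have C: "0 \<le> C" "C \<le> 0.925" using \<eta>0 y01[of t] t by (auto simp: C_def)
  have \<eta>0': "0 \<le> \<eta>0" using \<eta>0 y01[of t] t by auto
  \<comment> \<open>Its slope 2 * C * (0.2105 - x) - \<tau> spends the slack of \<open>BB\<close>,
    where 2 * 0.925 = 1.85. The \<tau> is held back because lowering the potential adds Ga * \<eta>
    * \<open>dlt\<close> to the side that must be small.\<close>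
  define dlt where "dlt x = C * ((0.2105 - \<zeta>)^2 - (0.2105 - x)^2) - \<tau> * (x - \<zeta>)" for x
  have "0 \<le> Ga * \<eta>0 * ((1 - \<eta>0) * 0.925 * (0.2105 - z t)^2)" using \<eta>0 \<eta>0' by (intro mult_nonneg_nonneg) auto
  then have \<tau>0: "0 \<le> \<tau>" using \<tau> by simp
  have "F t + g t * (BB Ga (z t) - dlt (z t)) \<le> F s + g s * (BB Ga (z s) - dlt (z s))"
  proof (rule pot_std[where U = "\<lambda>x. BB Ga x - dlt x" and U' = "\<lambda>x. Ga * (1 - Ga) / (aa Ga x)^2 - (C * 2 * (0.2105 - x) - \<tau>)"])
    fix x assume "z t \<le> x" "x \<le> z s"
    then have x: "0.12 \<le> x" "\<zeta> \<le> x" "x \<le> 0.2105" using s zt by (auto simp: \<zeta>_def)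
    have dd: "(dlt has_real_derivative (C * 2 * (0.2105 - x) - \<tau>)) (at x)"
      unfolding dlt_def[abs_def] by (auto intro!: derivative_eq_intros simp: algebra_simps)
    show "((\<lambda>x. BB Ga x - dlt x) has_real_derivative Ga * (1 - Ga) / (aa Ga x)^2 - (C * 2 * (0.2105 - x) - \<tau>)) (at x)"
      using x by (intro DERIV_diff dd BB_deriv) auto
    have a: "aa Ga x \<ge> 0.36" "aa Ga x \<le> 0.43" using x by (auto simp: aa_def)
    define D1 where "D1 = C * 2 * (0.2105 - x)"
    have "C * (2 * (0.2105 - x)) \<le> 0.925 * (2 * 0.0905)" using C x by (intro mult_mono) auto
    also have "\<dots> \<le> (1::real)" by simp
    finally have D1: "D1 \<le> 1" by (simp only: D1_def mult.assoc)
    have "(aa Ga x)^2 \<le> 0.43^2" using a by (intro power_mono) auto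
    then have "Ga * (1 - Ga) / (aa Ga x)^2 \<ge> Ga * (1 - Ga) / 0.43^2" using a by (intro divide_left_mono) auto
    moreover have "Ga * (1 - Ga) / 0.43^2 \<ge> 1" by (simp add: power2_eq_square)
    ultimately have "Ga * (1 - Ga) / (aa Ga x)^2 \<ge> 1" by (rule order_trans[rotated])
    then show "0 \<le> Ga * (1 - Ga) / (aa Ga x)^2 - (C * 2 * (0.2105 - x) - \<tau>)"
      unfolding D1_def[symmetric] using \<tau>0 D1 by linarith
    fix \<eta> assume "y s \<le> \<eta>" "\<eta> \<le> y t"
    then have \<eta>: "0 \<le> \<eta>" "\<eta> \<le> \<eta>0" using y01[of s] t s \<eta>0 by auto
    have q: "0 \<le> qq Ga x" using x by (intro qq_nonneg) auto
    have A: "AA Ga x > 0" using x AA_pos[of Ga x] by auto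
    define E where "E = (1 - Ga) * qq Ga x - Ga * x * aa Ga x"
    \<comment> \<open>m is the lower bound for S. It is at least \<open>aa\<close>, hence at least
      0.36 for x \<ge> 0.12, which is the 0.36 in the condition on \<tau>.\<close>
    define m where "m = aa Ga x + (1 - \<eta>) * qq Ga x"
    have m: "0.36 \<le> m" "m \<le> AA Ga x" using a q \<eta> \<eta>0 by (auto simp: m_def AA_def mult_left_le_one_le intro: add_increasing2)
    have E: "Ga * E \<ge> 1.85 * (0.2105 - x) * AA Ga x * (aa Ga x)^2" unfolding E_def by (rule deficit) (use x in auto)
    then have "Ga * E / (aa Ga x)^2 \<ge> 1.85 * (0.2105 - x) * AA Ga x" using a by (simp add: field_simps)
    then have "(1 - \<eta>) * (1.85 * (0.2105 - x) * AA Ga x) \<le> (1 - \<eta>) * (Ga * E / (aa Ga x)^2)" 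
      using \<eta> \<eta>0 by (intro mult_left_mono) auto
    moreover have "(1 - \<eta>0) * (1.85 * (0.2105 - x) * AA Ga x) \<le> (1 - \<eta>) * (1.85 * (0.2105 - x) * AA Ga x)"
      using \<eta> x A by (intro mult_right_mono) auto
    moreover have "(1 - \<eta>0) * (1.85 * (0.2105 - x) * m) \<le> (1 - \<eta>0) * (1.85 * (0.2105 - x) * AA Ga x)"
      using m x \<eta>0 by (intro mult_left_mono) auto
    moreover have "(1 - \<eta>0) * (1.85 * (0.2105 - x) * m) = C * 2 * (0.2105 - x) * m"
      unfolding C_def by algebra
    moreover have "\<eta> * dlt x \<le> \<eta>0 * (C * (0.2105 - \<zeta>)^2)"
    proof -
      have "0 \<le> C * (0.2105 - x)^2" "0 \<le> \<tau> * (x - \<zeta>)" using C \<tau>0 x by auto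
      then have "dlt x \<le> C * (0.2105 - \<zeta>)^2" unfolding dlt_def right_diff_distrib by linarith
      then have "\<eta> * dlt x \<le> \<eta> * (C * (0.2105 - \<zeta>)^2)" using \<eta> by (intro mult_left_mono)
      also have "\<dots> \<le> \<eta>0 * (C * (0.2105 - \<zeta>)^2)" using \<eta> C by (intro mult_right_mono) auto
      finally show ?thesis .
    qed
    then have "Ga * (\<eta> * dlt x) \<le> \<tau> * 0.36" using \<tau> by (simp add: C_def \<zeta>_def)
    moreover have "\<tau> * 0.36 \<le> \<tau> * m" using m \<tau>0 by (intro mult_left_mono) auto
    moreover have "Ga * (1 - Ga) / (aa Ga x)^2 * m - Ga * (1 - \<eta> * BB Ga x) = (1 - \<eta>) * (Ga * E / (aa Ga x)^2)"
    proof -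
      have "0 \<le> x" using x by simp
      from BB_defect[OF Ga01 this, of \<eta>] show ?thesis
        unfolding m_def[symmetric] E_def[symmetric] by (simp only: mult_ac times_divide_eq_left times_divide_eq_right)
    qed
    moreover have "Ga * (1 - \<eta> * (BB Ga x - dlt x)) = Ga * (1 - \<eta> * BB Ga x) + Ga * (\<eta> * dlt x)"
      "(Ga * (1 - Ga) / (aa Ga x)^2 - (C * 2 * (0.2105 - x) - \<tau>)) * m = 
        Ga * (1 - Ga) / (aa Ga x)^2 * m - C * 2 * (0.2105 - x) * m + \<tau> * m"
      by (simp_all add: right_diff_distrib left_diff_distrib)
    ultimately show "Ga * (1 - \<eta> * (BB Ga x - dlt x)) \<le> 
        (Ga * (1 - Ga) / (aa Ga x)^2 - (C * 2 * (0.2105 - x) - \<tau>)) * (aa Ga x + (1 - \<eta>) * qq Ga x)"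
      unfolding m_def[symmetric] by argo
  qed (use t s in auto)
  moreover have "dlt (z t) = 0" by (simp add: dlt_def \<zeta>_def)
  moreover have "BB Ga (z s) - dlt (z s) \<le> V0 0.2105 - 0.000014"
  proof -
    have "dlt (z s) \<ge> 0.00173" using D by (simp add: dlt_def s(3) C_def \<zeta>_def)
    moreover have "BB Ga (z s) \<le> 0.35782" by (simp add: s(3) BB_def aa_def)
    ultimately show ?thesis using V0_2105 by simp
  qed
  then have "g s * (BB Ga (z s) - dlt (z s)) \<le> g s * (V0 0.2105 - 0.000014)" 
    by (rule mult_left_mono) (use g[of s] s t in auto)
  moreover have "F s + g s * (V0 0.2105 - 0.000014) \<le> 1" by (rule pot_V0_2105) (use s t in auto)
  moreover have "F 1 \<le> F t + g t * BB Ga (z t)" by (rule pot_BB) (use t zt in auto)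
  ultimately show ?thesis by simp
qed

end

section \<open>Rate 0.757: the remaining items always fit\<close>

abbreviation Gb :: real where "Gb \<equiv> 0.757"

lemma Gb01: "0 < Gb" "Gb < 1" by simp_all

definition V3 :: "real \<Rightarrow> real" where "V3 x = 1 - (PP Gb 1 - PP Gb x)"

lemma V3_deriv: "1/10 < x \<Longrightarrow> x < 2 \<Longrightarrow> (V3 has_real_derivative Gb / AA Gb x) (at x)"
  unfolding V3_def[abs_def] by (auto intro!: derivative_eq_intros PP_deriv)

lemma V3_27: "V3 0.27 \<ge> 0.3898" using tabB_bound by (simp add: V3_def)

lemma V3_mono: assumes "0.27 \<le> x" "x \<le> y" "y \<le> 1" shows "V3 x \<le> V3 y"
proof (rule DERIV_nonneg_imp_nondecreasing[where f = V3])
  fix z assume z: "x \<le> z" "z \<le> y"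
  have "(V3 has_real_derivative Gb / AA Gb z) (at z)" using z assms by (intro V3_deriv) auto
  moreover have "AA Gb z > 0" using z assms by (intro AA_pos) auto
  ultimately show "\<exists>d. (V3 has_real_derivative d) (at z) \<and> 0 \<le> d" 
    by (intro exI[of _ "Gb / AA Gb z"]) auto
qed (use assms in simp)

lemma ln_27_upper: "- ln (0.27::real) \<le> 1.30934"
  by (rule order_trans[OF ln_upper[of _ 14]]) (simp_all add: eval_nat_numeral)

text \<open>\<open>V3\<close> is the potential for y = 0 at this rate, and the inequality is the
  case k = 0 of \<open>lin_cond\<close>: \<open>V3\<close> then works for all y. It holds at 0.27
  and the difference of the two sides increases.\<close>

lemma V3_qq: assumes x: "0.27 \<le> x" "x \<le> 1" shows "qq Gb x \<le> AA Gb x * V3 x"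
proof -
  let ?h = "\<lambda>x. AA Gb x * V3 x - qq Gb x"
  have "?h 0.27 \<le> ?h x"
  proof (rule DERIV_nonneg_imp_nondecreasing[where f = ?h])
    fix z assume z: "0.27 \<le> z" "z \<le> x"
    have A: "AA Gb z > 0" using z x by (intro AA_pos) auto
    have dq: "(qq Gb has_real_derivative - (Gb * (ln z + 1))) (at z)"
      unfolding qq_def[abs_def] using z by (auto intro!: derivative_eq_intros simp: field_simps)
    have "(?h has_real_derivative (AA Gb z * (Gb / AA Gb z) + - (Gb * ln z) * V3 z) - (- (Gb * (ln z + 1)))) (at z)"
      using z x by (intro DERIV_diff DERIV_mult' V3_deriv dq AA_deriv) auto
    moreover have "AA Gb z * (Gb / AA Gb z) = Gb" using A by simp
    ultimately have d: "(?h has_real_derivative (Gb + - (Gb * ln z) * V3 z) - (- (Gb * (ln z + 1)))) (at z)" by (simp only:)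
    have W: "1 - V3 z \<le> 0.6102" using V3_mono[of "0.27" z] V3_27 z x by simp
    have l: "- ln z \<le> 1.30934" using ln_dec[of "0.27" z, OF _ z(1)] ln_27_upper by simp
    have "(- ln z) * (1 - V3 z) \<le> (- ln z) * 0.6102" using W z x by (intro mult_left_mono) auto
    also have "\<dots> \<le> 1.30934 * 0.6102" using l by (intro mult_right_mono) auto
    finally have P: "(- ln z) * (1 - V3 z) \<le> 2" by simp
    have "(Gb + - (Gb * ln z) * V3 z) - (- (Gb * (ln z + 1))) = Gb * (2 - (- ln z) * (1 - V3 z))"
      by (simp add: field_simps)
    then have "(Gb + - (Gb * ln z) * V3 z) - (- (Gb * (ln z + 1))) \<ge> 0" using P by (simp only: mult_nonneg_nonneg diff_ge_0_iff_ge less_imp_le[OF Gb01(1)])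
    then show "\<exists>d. (?h has_real_derivative d) (at z) \<and> 0 \<le> d" by (rule deriv_nonnegI[OF d])
  qed (use x in simp)
  moreover have "?h 0.27 \<ge> 0"
  proof -
    have q: "qq Gb 0.27 \<le> 0.26762" using ln_27_upper by (simp add: qq_def)
    have q0: "qq Gb 0.27 \<ge> 0" by (rule qq_nonneg) auto
    have "?h 0.27 = aa Gb 0.27 * V3 0.27 - qq Gb 0.27 * (1 - V3 0.27)" by (simp add: AA_def algebra_simps)
    moreover have "qq Gb 0.27 * (1 - V3 0.27) \<le> qq Gb 0.27 * (1 - 0.3898)"
      using q0 V3_27 by (intro mult_left_mono) auto
    moreover have "qq Gb 0.27 * (1 - 0.3898) \<le> 0.26762 * (1 - 0.3898)" using q by (intro mult_right_mono) auto
    moreover have "aa Gb 0.27 * V3 0.27 \<ge> aa Gb 0.27 * 0.3898"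
      using V3_27 by (intro mult_left_mono) (auto simp: aa_def)
    moreover have "aa Gb 0.27 * 0.3898 \<ge> 0.26762 * (1 - 0.3898)" by (simp add: aa_def)
    ultimately show ?thesis by linarith
  qed
  ultimately show ?thesis by linarith
qed

lemma affine_nonneg: fixes p d :: real assumes "p \<ge> 0" "p + h * d \<ge> 0" "0 \<le> \<eta>" "\<eta> \<le> h" shows "p + \<eta> * d \<ge> 0"
proof (cases "d \<ge> 0")
  case True then show ?thesis using assms by simp
next
  case False then have "h * d \<le> \<eta> * d" using assms by (intro mult_right_mono_neg) auto
  then show ?thesis using assms by linarith
qed

text \<open>A cubic expanded at 0.197 that bridges [0.197, 0.27]. Its coefficients place it just
  above \<open>V1\<close> at 0.197 and just below \<open>V3\<close> at 0.27.\<close>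

definition V2 :: "real \<Rightarrow> real" where 
  "V2 x = 0.30301 + 1.306 * (x - 0.197) - 2.1 * (x - 0.197)^2 + 4 * (x - 0.197)^3"
definition V2' :: "real \<Rightarrow> real" where "V2' x = 1.306 - 4.2 * (x - 0.197) + 12 * (x - 0.197)^2"

lemma V2_deriv: "(V2 has_real_derivative V2' x) (at x)"
proof -
  have "(V2 has_real_derivative 1.306 - 2.1 * (2 * (x - 0.197)) + 4 * (3 * (x - 0.197)^2)) (at x)"
    unfolding V2_def[abs_def] by (auto intro!: derivative_eq_intros)
  then show ?thesis by (rule DERIV_cong) (simp add: V2'_def field_simps)
qed

lemma ln_209: "1.56542 \<le> - ln (0.209::real)"
  by (rule order_trans[OF _ ln_lower[of _ 18]]) (simp_all add: eval_nat_numeral)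
lemma ln_234: "1.45243 \<le> - ln (0.234::real)"
  by (rule order_trans[OF _ ln_lower[of _ 18]]) (simp_all add: eval_nat_numeral)
lemma ln_258: "1.35479 \<le> - ln (0.258::real)"
  by (rule order_trans[OF _ ln_lower[of _ 18]]) (simp_all add: eval_nat_numeral)

text \<open>For fixed x the condition is affine in \<eta>, so the ends 0 and 0.803 of the range
  decide. At both, - ln x enters with a nonnegative coefficient and is replaced by a tangent on
  three intervals.\<close>

lemma V2_cond:
  assumes x: "0.197 \<le> x" "x \<le> 0.27" and \<eta>: "0 \<le> \<eta>" "\<eta> \<le> 0.803"
  shows "V2' x \<ge> 0" and "Gb * (1 - \<eta> * V2 x) \<le> V2' x * (aa Gb x + (1 - \<eta>) * qq Gb x)"
proof -
  have "4.2 * (x - 0.197) \<le> 1" using x by simp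
  then show s: "V2' x \<ge> 0" unfolding V2'_def by (simp add: add_increasing2)
  have key: "V2' x * (aa Gb x + qq Gb x) - Gb \<ge> 0 \<and> V2' x * (aa Gb x + 0.197 * qq Gb x) - Gb * (1 - 0.803 * V2 x) \<ge> 0"
    if L: "L \<le> - ln x" and p: "0 \<le> V2' x * (0.243 + 0.757 * x + 0.757 * x * L) - 0.757"
      "0 \<le> V2' x * (0.243 + 0.757 * x + 0.197 * (0.757 * x * L)) - 0.757 * (1 - 0.803 * V2 x)" for L
  proof -
    have a: "0.243 + 0.757 * x = aa Gb x" by (simp add: aa_def)
    have "0.757 * x * L \<le> 0.757 * x * (- ln x)" using L x by (intro mult_left_mono) auto
    then have q: "0.757 * x * L \<le> qq Gb x" unfolding qq_def by simp
    have "0 \<le> V2' x * (aa Gb x + 0.757 * x * L) - Gb" by (rule p(1)[unfolded a])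
    then have "Gb \<le> V2' x * (aa Gb x + 0.757 * x * L)" by (simp only: diff_ge_0_iff_ge)
    also have "\<dots> \<le> V2' x * (aa Gb x + qq Gb x)" by (rule mult_left_mono[OF add_left_mono[OF q] s])
    finally have 1: "0 \<le> V2' x * (aa Gb x + qq Gb x) - Gb" by (simp only: diff_ge_0_iff_ge)
    have "0 \<le> V2' x * (aa Gb x + 0.197 * (0.757 * x * L)) - Gb * (1 - 0.803 * V2 x)" by (rule p(2)[unfolded a])
    then have "Gb * (1 - 0.803 * V2 x) \<le> V2' x * (aa Gb x + 0.197 * (0.757 * x * L))" by (simp only: diff_ge_0_iff_ge)
    also have "\<dots> \<le> V2' x * (aa Gb x + 0.197 * qq Gb x)" 
      by (rule mult_left_mono[OF add_left_mono[OF mult_left_mono[OF q]] s]) simp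
    finally have "0 \<le> V2' x * (aa Gb x + 0.197 * qq Gb x) - Gb * (1 - 0.803 * V2 x)" by (simp only: diff_ge_0_iff_ge)
    with 1 show ?thesis by blast
  qed
  consider "x \<le> 0.222" | "0.222 \<le> x" "x \<le> 0.247" | "0.247 \<le> x" by linarith
  then have k: "V2' x * (aa Gb x + qq Gb x) - Gb \<ge> 0 \<and> V2' x * (aa Gb x + 0.197 * qq Gb x) - Gb * (1 - 0.803 * V2 x) \<ge> 0"
  proof cases
    case 1 
    have "1.56542 + (1 - 4.7847 * x) \<le> - ln x" using x ln_209 by (intro ln_tangent[of x "0.209" "1.56542" "4.7847"]) auto
    moreover have "0 \<le> V2' x * (0.243 + 0.757 * x + 0.757 * x * (1.56542 + (1 - 4.7847 * x))) - 0.757"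
      unfolding V2'_def by (rule others_poly0) (use 1 x in simp_all)
    moreover have "0 \<le> V2' x * (0.243 + 0.757 * x + 0.197 * (0.757 * x * (1.56542 + (1 - 4.7847 * x)))) - 0.757 * (1 - 0.803 * V2 x)"
      unfolding V2'_def V2_def by (rule others_poly1) (use 1 x in simp_all)
    ultimately show ?thesis by (rule key)
  next
    case 2 
    have "1.45243 + (1 - 4.2736 * x) \<le> - ln x" using x ln_234 by (intro ln_tangent[of x "0.234" "1.45243" "4.2736"]) auto
    moreover have "0 \<le> V2' x * (0.243 + 0.757 * x + 0.757 * x * (1.45243 + (1 - 4.2736 * x))) - 0.757"
      unfolding V2'_def by (rule others_poly2) (use 2 x in simp_all)
    moreover have "0 \<le> V2' x * (0.243 + 0.757 * x + 0.197 * (0.757 * x * (1.45243 + (1 - 4.2736 * x)))) - 0.757 * (1 - 0.803 * V2 x)"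
      unfolding V2'_def V2_def by (rule others_poly3) (use 2 x in simp_all)
    ultimately show ?thesis by (rule key)
  next
    case 3 
    have "1.35479 + (1 - 3.876 * x) \<le> - ln x" using x ln_258 by (intro ln_tangent[of x "0.258" "1.35479" "3.876"]) auto
    moreover have "0 \<le> V2' x * (0.243 + 0.757 * x + 0.757 * x * (1.35479 + (1 - 3.876 * x))) - 0.757"
      unfolding V2'_def by (rule others_poly4) (use 3 x in simp_all)
    moreover have "0 \<le> V2' x * (0.243 + 0.757 * x + 0.197 * (0.757 * x * (1.35479 + (1 - 3.876 * x)))) - 0.757 * (1 - 0.803 * V2 x)"
      unfolding V2'_def V2_def by (rule others_poly5) (use 3 x in simp_all)
    ultimately show ?thesis by (rule key)
  qed
  have "(V2' x * (aa Gb x + qq Gb x) - Gb) + \<eta> * (Gb * V2 x - V2' x * qq Gb x) \<ge> 0"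
  proof (rule affine_nonneg[OF _ _ \<eta>])
    show "V2' x * (aa Gb x + qq Gb x) - Gb \<ge> 0" using k by blast
    have "V2' x * (aa Gb x + qq Gb x) - Gb + 0.803 * (Gb * V2 x - V2' x * qq Gb x)
      = V2' x * (aa Gb x + 0.197 * qq Gb x) - Gb * (1 - 0.803 * V2 x)" by algebra
    then show "V2' x * (aa Gb x + qq Gb x) - Gb + 0.803 * (Gb * V2 x - V2' x * qq Gb x) \<ge> 0" 
      by (rule ssubst) (use k in blast)
  qed
  moreover have "V2' x * (aa Gb x + (1 - \<eta>) * qq Gb x) = Gb * (1 - \<eta> * V2 x) 
      + ((V2' x * (aa Gb x + qq Gb x) - Gb) + \<eta> * (Gb * V2 x - V2' x * qq Gb x))" by algebra
  ultimately show "Gb * (1 - \<eta> * V2 x) \<le> V2' x * (aa Gb x + (1 - \<eta>) * qq Gb x)" by linarith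
qed

text \<open>A Moebius function vanishing at 0, of the same type as \<open>BB\<close>. The slope
  1.9305 at 0 is 0.757 / 0.392129 rounded up, and 1.295 brings the value at 0.197 just below that of
  \<open>V2\<close>.\<close>

definition V1 :: "real \<Rightarrow> real" where "V1 x = 1.9305 * x / (1 + 1.295 * x)"

lemma moebius_deriv: fixes a b x :: real assumes "1 + b * x > 0"
  shows "((\<lambda>x. a * x / (1 + b * x)) has_real_derivative a / (1 + b * x)^2) (at x)"
proof -
  have "((\<lambda>x. a * x / (1 + b * x)) has_real_derivative (a * (1 + b * x) - a * x * b) / ((1 + b * x) * (1 + b * x))) (at x)"
    using assms by (auto intro!: derivative_eq_intros)
  moreover have "a * (1 + b * x) - a * x * b = a" by (simp add: algebra_simps)
  ultimately show ?thesis by (simp add: power2_eq_square)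
qed

lemma V1_deriv: assumes "0 \<le> x" shows "(V1 has_real_derivative 1.9305 / (1 + 1.295 * x)^2) (at x)"
  unfolding V1_def[abs_def] by (rule moebius_deriv) (use assms in simp)

text \<open>The last factor is a lower bound for S once the remaining items rest, with 0.392129 = 1
  - 0.757 * 0.803. After clearing the denominator the condition is affine in \<eta> and quadratic in
  x.\<close>

lemma V1_cond:
  assumes x: "0 \<le> x" "x \<le> 0.197" and \<eta>: "0 \<le> \<eta>" "\<eta> \<le> 0.803"
  shows "Gb * (1 - \<eta> * V1 x) \<le> 1.9305 / (1 + 1.295 * x)^2 * (0.392129 + Gb * x * (0.4 + (1 - \<eta>) * 1.1137))"
proof -
  define D where "D = 1 + 1.295 * x"
  have D: "D > 0" using x by (simp add: D_def)
  have V: "V1 x = 1.9305 * x / D" by (simp add: V1_def D_def)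
  have x2: "x * x \<le> 0.197 * x" using x by (intro mult_right_mono) auto
  have "(1.9305 * (0.392129 + Gb * x * 1.5137) - Gb * D^2) + \<eta> * (Gb * 1.9305 * x * D - 1.9305 * Gb * x * 1.1137) \<ge> 0"
  proof (rule affine_nonneg[OF _ _ \<eta>])
    have "1.9305 * (0.392129 + Gb * x * 1.5137) - Gb * D^2 
      = (1.9305 * 0.392129 - Gb) + (1.9305 * Gb * 1.5137 - 2 * 1.295 * Gb) * x - Gb * 1.295^2 * (x * x)"
      unfolding D_def by algebra
    also have "\<dots> \<ge> (1.9305 * 0.392129 - Gb) + (1.9305 * Gb * 1.5137 - 2 * 1.295 * Gb) * x - Gb * 1.295^2 * (0.197 * x)"
      using x2 by (intro diff_left_mono mult_left_mono) auto
    finally have "1.9305 * (0.392129 + Gb * x * 1.5137) - Gb * D^2 \<ge> (1.9305 * 0.392129 - Gb) + (1.9305 * Gb * 1.5137 - 2 * 1.295 * Gb) * x - Gb * 1.295^2 * (0.197 * x)" .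
    moreover have "(1.9305 * 0.392129 - Gb) + (1.9305 * Gb * 1.5137 - 2 * 1.295 * Gb) * x - Gb * 1.295^2 * (0.197 * x) \<ge> 0"
      using x by (simp add: power2_eq_square)
    ultimately show "1.9305 * (0.392129 + Gb * x * 1.5137) - Gb * D^2 \<ge> 0" by (rule order_trans[rotated])
    have "1.9305 * (0.392129 + Gb * x * 1.5137) - Gb * D^2 + 0.803 * (Gb * 1.9305 * x * D - 1.9305 * Gb * x * 1.1137)
      = (1.9305 * 0.392129 - Gb) + (1.9305 * Gb * 1.5137 - 2 * 1.295 * Gb + 0.803 * (Gb * 1.9305) - 0.803 * 1.9305 * Gb * 1.1137) * x
        - (Gb * 1.295^2 - 0.803 * Gb * 1.9305 * 1.295) * (x * x)"
      unfolding D_def by algebra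
    also have "\<dots> \<ge> 0" using x by (simp add: power2_eq_square)
    finally show "1.9305 * (0.392129 + Gb * x * 1.5137) - Gb * D^2 + 0.803 * (Gb * 1.9305 * x * D - 1.9305 * Gb * x * 1.1137) \<ge> 0" .
  qed
  moreover have "(1.9305 * (0.392129 + Gb * x * 1.5137) - Gb * D^2) + \<eta> * (Gb * 1.9305 * x * D - 1.9305 * Gb * x * 1.1137)
     = 1.9305 * (0.392129 + Gb * x * (0.4 + (1 - \<eta>) * 1.1137)) - Gb * (D^2 - \<eta> * (1.9305 * x * D))" by algebra
  ultimately have "Gb * (D^2 - \<eta> * (1.9305 * x * D)) \<le> 1.9305 * (0.392129 + Gb * x * (0.4 + (1 - \<eta>) * 1.1137))" by linarith
  then have "Gb * (D^2 - \<eta> * (1.9305 * x * D)) / D^2 \<le> 1.9305 * (0.392129 + Gb * x * (0.4 + (1 - \<eta>) * 1.1137)) / D^2"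
    using D by (intro divide_right_mono) auto
  moreover have "Gb * (D^2 - \<eta> * (1.9305 * x * D)) / D^2 = Gb * (1 - \<eta> * V1 x)"
    using D unfolding V by (simp add: field_simps power2_eq_square)
  ultimately show ?thesis unfolding D_def[symmetric] by (simp only: times_divide_eq_left)
qed

lemma ln_div_split: "0 < p \<Longrightarrow> 0 < c \<Longrightarrow> 0 < u \<Longrightarrow> - ln (p / u) = - ln (p / c) - ln (c / (u::real))"
  by (simp add: ln_div)

text \<open>From h on only the exceptional item moves, so y is frozen; \<open>zh\<close> says that
  the product over the non-exceptional items has reached 0.197. The bound \<open>Sh\<close> keeps
  the constant 0.197 as z tends to 0, which the general bound for S loses.\<close>

locale item_curve_b = item_curve Gb z y S c F g for z y S c F g +
  fixes h :: real
  assumes h: "0 \<le> h" "h \<le> 1" and yh: "\<And>t. h \<le> t \<Longrightarrow> t \<le> 1 \<Longrightarrow> y t = y h"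
    and zh: "z h * (1 - y h) = 0.197"
    and Sh: "\<And>t. h \<le> t \<Longrightarrow> t \<le> 1 \<Longrightarrow> 1 - Gb + Gb * (0.197 + z t * (y h + (1 - y h) * - ln (z h))) \<le> S t"
begin

lemma yh_le: "y h \<le> 0.803" "z h \<ge> 0.197"
proof -
  have z: "z h \<le> 1" "0 \<le> z h" and y: "y h \<le> 1" "0 \<le> y h" using z01[of h] y01[of h] h by auto
  have "z h * (1 - y h) \<le> 1 * (1 - y h)" using z y by (intro mult_right_mono) auto
  then show "y h \<le> 0.803" using zh by simp
  have "z h * (1 - y h) \<le> z h * 1" using z y by (intro mult_left_mono) auto
  then show "z h \<ge> 0.197" using zh by simp
qed

lemma y_le: "0 \<le> t \<Longrightarrow> t \<le> 1 \<Longrightarrow> y t \<le> 0.803"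
  using y[of t h] yh[of t] yh_le h by (cases "t \<le> h") auto

text \<open>The potentials \<open>V3\<close>, \<open>V2\<close>, \<open>V1\<close> are chained at z
  = 0.27 and z = 0.197, where each is at most its predecessor. Since z is still at least 0.197 at h,
  \<open>V1\<close> is in force only after h, where \<open>Sh\<close> is available.\<close>

theorem others_bound: "F 1 \<le> 1"
proof -
  obtain s where s: "h \<le> s" "s \<le> 1" "z s = 0.197" using hit_after[of h "0.197"] h yh_le by auto
  obtain r where r: "0 \<le> r" "r \<le> s" "z r = 0.27" using hit_before[of s "0.27"] s h by auto
  have "F r + g r * V3 (z r) \<le> F 0 + g 0 * V3 (z 0)"
  proof (rule pot_std)
    fix x assume "z r \<le> x" "x \<le> z 0"
    then have x: "0.27 \<le> x" "x \<le> 1" using r z0 by auto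
    have A: "AA Gb x > 0" using x by (intro AA_pos) auto
    show "(V3 has_real_derivative Gb / AA Gb x) (at x)" using x by (intro V3_deriv) auto
    show "0 \<le> Gb / AA Gb x" using A by simp
    fix \<eta> assume "y 0 \<le> \<eta>" "\<eta> \<le> y r"
    then have \<eta>: "0 \<le> \<eta>" using y01[of 0] by auto
    have "V3 x - qq Gb x / AA Gb x \<ge> 0" using V3_qq[OF x] A by (simp add: field_simps)
    then have "\<eta> * (Gb * (V3 x - qq Gb x / AA Gb x)) \<ge> 0" using \<eta>
      by (intro mult_nonneg_nonneg) auto
    then show "Gb * (1 - \<eta> * V3 x) \<le> Gb / AA Gb x * (aa Gb x + (1 - \<eta>) * qq Gb x)"
      using lin_cond[OF A, where \<eta> = \<eta> and U = "V3 x" and k = 0] by (simp only: mult_zero_left diff_zero add_0_right minus_zero)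
  qed (use r s in auto)
  then have 1: "F r + g r * V3 0.27 \<le> 1" by (simp add: F0 g0 z0 V3_def r)
  have 2: "F s + g s * V2 (z s) \<le> F r + g r * V2 (z r)"
  proof (rule pot_std[OF _ _ _ V2_deriv])
    fix x assume "z s \<le> x" "x \<le> z r"
    then have x: "0.197 \<le> x" "x \<le> 0.27" using s r by auto
    show "V2' x \<ge> 0" using V2_cond(1)[OF x, of 0] by simp
    fix \<eta> assume "y r \<le> \<eta>" "\<eta> \<le> y s"
    then have \<eta>: "0 \<le> \<eta>" "\<eta> \<le> 0.803" using y01[of r] y_le[of s] r s h by auto
    show "Gb * (1 - \<eta> * V2 x) \<le> V2' x * (aa Gb x + (1 - \<eta>) * qq Gb x)" by (rule V2_cond[OF x \<eta>])
  qed (use r s in auto)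
  have "V2 0.27 \<le> V3 0.27" using V3_27 by (simp add: V2_def power2_eq_square power3_eq_cube)
  then have "V2 (z r) \<le> V3 0.27" by (simp only: r(3))
  then have 3: "g r * V2 (z r) \<le> g r * V3 0.27" by (rule mult_left_mono) (use g[of r] r s h in auto)
  have 4: "F 1 + g 1 * V1 (z 1) \<le> F s + g s * V1 (z s)"
  proof (rule pot)
    show "(V1 has_real_derivative 1.9305 / (1 + 1.295 * x)^2) (at x)" if "z 1 \<le> x" for x
      using that z1 by (intro V1_deriv) auto
    fix t assume t: "s < t" "t < 1"
    have x: "0 \<le> z t" "z t \<le> 0.197" using z[of s t] z01[of t] s t h by auto
    define \<eta> where "\<eta> = y h"
    have \<eta>: "0 \<le> \<eta>" "\<eta> \<le> 0.803" using yh_le y01[of h] h by (auto simp: \<eta>_def)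
    \<comment> \<open>A tangent at 1 - \<eta> = 0.6 makes the bound for S affine in \<eta>, as
      \<open>V1_cond\<close> requires.\<close>
    have "ln (0.6 / (1 - \<eta>)) \<le> 0.6 / (1 - \<eta>) - 1" using \<eta> by (intro ln_le_minus_one) auto
    then have "(1 - \<eta>) * ln (0.6 / (1 - \<eta>)) \<le> (1 - \<eta>) * (0.6 / (1 - \<eta>) - 1)" using \<eta> by (intro mult_left_mono) auto
    also have "\<dots> = 0.6 - (1 - \<eta>)" using \<eta> by (simp add: field_simps)
    finally have l1: "(1 - \<eta>) * ln (0.6 / (1 - \<eta>)) \<le> 0.6 - (1 - \<eta>)" .
    have zz: "z h = 0.197 / (1 - \<eta>)" using zh \<eta> by (simp add: \<eta>_def field_simps)
    have l2: "- ln (z h) = - ln (0.197 / 0.6) - ln (0.6 / (1 - \<eta>))" 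
      unfolding zz by (rule ln_div_split) (use \<eta> in auto)
    have l3: "- ln (0.197 / 0.6) \<ge> (1.1137::real)"
      by (rule order_trans[OF _ ln_lower[of _ 10]]) (simp_all add: eval_nat_numeral)
    have "(1 - \<eta>) * (- ln (z h)) = (1 - \<eta>) * (- ln (0.197 / 0.6)) - (1 - \<eta>) * ln (0.6 / (1 - \<eta>))"
      unfolding l2 by (simp add: right_diff_distrib)
    also have "\<dots> \<ge> (1 - \<eta>) * 1.1137 - (0.6 - (1 - \<eta>))" using l1 l3 \<eta> by (intro diff_mono mult_left_mono) auto
    finally have "0.4 + (1 - \<eta>) * 1.1137 \<le> \<eta> + (1 - \<eta>) * - ln (z h)" by (simp add: algebra_simps)
    then have "z t * (0.4 + (1 - \<eta>) * 1.1137) \<le> z t * (\<eta> + (1 - \<eta>) * - ln (z h))" using x by (intro mult_left_mono) auto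
    then have "Gb * (z t * (0.4 + (1 - \<eta>) * 1.1137)) \<le> Gb * (z t * (\<eta> + (1 - \<eta>) * - ln (z h)))" by (rule mult_left_mono) simp
    then have S1: "0.392129 + Gb * z t * (0.4 + (1 - \<eta>) * 1.1137) \<le> 0.392129 + Gb * (z t * (\<eta> + (1 - \<eta>) * - ln (z h)))"
      unfolding mult.assoc by (rule add_left_mono)
    have e: "0.392129 + Gb * X = 1 - Gb + Gb * (0.197 + X)" for X :: real by (simp add: field_simps)
    have S2: "0.392129 + Gb * (z t * (\<eta> + (1 - \<eta>) * - ln (z h))) \<le> S t"
      unfolding e \<eta>_def by (rule Sh) (use s t in auto)
    from S1 S2 have S: "0.392129 + Gb * z t * (0.4 + (1 - \<eta>) * 1.1137) \<le> S t" by (rule order_trans)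
    have "Gb * (1 - \<eta> * V1 (z t)) \<le> 1.9305 / (1 + 1.295 * z t)^2 * (0.392129 + Gb * z t * (0.4 + (1 - \<eta>) * 1.1137))"
      by (rule V1_cond[OF x \<eta>])
    also have "\<dots> \<le> 1.9305 / (1 + 1.295 * z t)^2 * S t" by (rule mult_left_mono[OF S]) simp
    finally have fin: "Gb * (1 - \<eta> * V1 (z t)) \<le> 1.9305 / (1 + 1.295 * z t)^2 * S t" .
    have yt: "y t = \<eta>" using yh[of t] s t by (simp add: \<eta>_def)
    show "Gb * (1 - y t * V1 (z t)) \<le> 1.9305 / (1 + 1.295 * z t)^2 * S t" unfolding yt by (rule fin)
  qed (use s h in auto)
  have "V1 0.197 \<le> V2 0.197" by (simp add: V1_def V2_def)
  then have "V1 (z s) \<le> V2 (z s)" by (simp only: s(3))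
  then have 5: "g s * V1 (z s) \<le> g s * V2 (z s)" by (rule mult_left_mono) (use g[of s] s h in auto)
  have V10: "V1 (z 1) = 0" by (simp add: z1 V1_def)
  have "F 1 \<le> F s + g s * V1 (z s)" using 4 unfolding V10 by (simp only: mult_zero_right add_0_right)
  then show ?thesis using 1 2 3 5 by linarith
qed

end

section \<open>The design\<close>

text \<open>The right side is the chance that exactly one of several independent events occurs, and
  the product is the chance of none. Termwise p \<ge> - (1 - p) * ln (1 - p); many small events come
  close to equality.\<close>

lemma exactly_one_lower:
  fixes p :: "'a \<Rightarrow> real"
  assumes A: "finite A" and p: "\<And>l. l \<in> A \<Longrightarrow> 0 \<le> p l \<and> p l \<le> 1"
  shows "- ((\<Prod>l\<in>A. 1 - p l) * ln (\<Prod>l\<in>A. 1 - p l)) \<le> (\<Sum>l\<in>A. p l * (\<Prod>m\<in>A-{l}. 1 - p m))"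
proof (cases "(\<Prod>l\<in>A. 1 - p l) = 0")
  case True
  have "0 \<le> (\<Sum>l\<in>A. p l * (\<Prod>m\<in>A-{l}. 1 - p m))"
    using p by (intro sum_nonneg mult_nonneg_nonneg prod_nonneg) auto
  then show ?thesis using True by simp
next
  case False
  define Z where "Z = (\<Prod>l\<in>A. 1 - p l)"
  have lt: "p l < 1" if "l \<in> A" for l using False that p[OF that] A by (auto simp: less_le)
  then have ne: "l \<in> A \<Longrightarrow> p l \<noteq> 1" for l by force
  have Z: "Z \<ge> 0" unfolding Z_def using p by (intro prod_nonneg) auto
  have "- (Z * ln Z) = (\<Sum>l\<in>A. Z * (- ln (1 - p l)))"
    unfolding Z_def using lt ne by (subst ln_prod) (auto simp: A sum_distrib_left sum_negf)
  also have "\<dots> \<le> (\<Sum>l\<in>A. p l * (\<Prod>m\<in>A-{l}. 1 - p m))"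
  proof (rule sum_mono)
    fix l assume l: "l \<in> A"
    have "Z = (1 - p l) * (\<Prod>m\<in>A-{l}. 1 - p m)" unfolding Z_def by (rule prod.remove[OF A l])
    moreover have "(1 - p l) * (- ln (1 - p l)) \<le> p l"
    proof -
      have "ln (1 / (1 - p l)) \<le> 1 / (1 - p l) - 1" using lt[OF l] by (intro ln_le_minus_one) auto
      then have "(1 - p l) * ln (1 / (1 - p l)) \<le> (1 - p l) * (1 / (1 - p l) - 1)" 
        using lt[OF l] by (intro mult_left_mono) auto
      also have "(1 - p l) * (1 / (1 - p l) - 1) = p l" using lt[OF l] by (simp add: field_simps)
      finally show ?thesis using lt[OF l] by (simp add: ln_div)
    qed
    moreover have "(\<Prod>m\<in>A-{l}. 1 - p m) \<ge> 0" using p by (intro prod_nonneg) auto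
    ultimately show "Z * (- ln (1 - p l)) \<le> p l * (\<Prod>m\<in>A-{l}. 1 - p m)"
      using mult_right_mono[of "(1 - p l) * (- ln (1 - p l))" "p l" "\<Prod>m\<in>A-{l}. 1 - p m"] by (simp add: mult_ac)
  qed
  finally show ?thesis unfolding Z_def .
qed

locale qpath =
  fixes n :: nat and G :: real and q q' :: "nat \<Rightarrow> real \<Rightarrow> real"
  assumes G: "0 < G" "G < 1"
    and dq: "\<And>i t. i < n \<Longrightarrow> (q i has_real_derivative q' i t) (at t)"
    and cq': "\<And>i. i < n \<Longrightarrow> continuous_on UNIV (q' i)"
    and q'0: "\<And>i t. i < n \<Longrightarrow> 0 \<le> q' i t"
    and q01: "\<And>i t. i < n \<Longrightarrow> 0 \<le> q i t \<and> q i t \<le> 1"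
    and q0: "\<And>i. i < n \<Longrightarrow> q i 0 = 0"
begin

definition R where "R i t = (\<Prod>l\<in>{..<n}-{i}. 1 - q l t)"
definition R' where "R' i t = - (\<Sum>l\<in>{..<n}-{i}. q' l t * (\<Prod>m\<in>{..<n}-{i}-{l}. 1 - q m t))"
definition P0 where "P0 t = (\<Prod>l<n. 1 - q l t)"
text \<open>\<open>P0\<close> plus the sum is the chance of at most one value above level t, so S is
  1 - G times the chance of at least two.\<close>

definition S where "S t = 1 - G * (1 - P0 t - (\<Sum>i<n. q i t * R i t))"
text \<open>Chosen so that item i is offered to a market in which no other item is sold at the rate
  - G * \<open>R' i\<close>. Using the closed form of S avoids a system of differential equations in
  which the chance of no sale is itself unknown.\<close>

definition c where "c i t = G * (- R' i t) / S t"
definition g where "g i t = exp (- integral {0..t} (\<lambda>s. q i s * c i s))"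
definition f where "f i t = c i t * g i t"
definition F where "F i t = integral {0..t} (f i)"

lemma q_cont: "i < n \<Longrightarrow> continuous_on A (q i)"
  by (intro continuous_at_imp_continuous_on ballI DERIV_isCont[OF dq])

lemma q_mono: "i < n \<Longrightarrow> s \<le> t \<Longrightarrow> q i s \<le> q i t"
  by (rule DERIV_nonneg_imp_nondecreasing[where f = "q i"]) (auto intro: deriv_nonnegI[OF dq q'0])

lemma q'_cont: "i < n \<Longrightarrow> continuous_on A (q' i)" by (rule continuous_on_subset[OF cq']) auto

lemma prod_deriv: 
  assumes "A \<subseteq> {..<n}"
  shows "((\<lambda>t. \<Prod>l\<in>A. 1 - q l t) has_real_derivative - (\<Sum>l\<in>A. q' l t * (\<Prod>m\<in>A-{l}. 1 - q m t))) (at t)"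
proof -
  have "((\<lambda>t. \<Prod>l\<in>A. 1 - q l t) has_real_derivative (\<Sum>l\<in>A. (- q' l t) * (\<Prod>m\<in>A-{l}. 1 - q m t))) (at t)"
    by (rule has_field_derivative_prod) (use assms in \<open>auto intro!: derivative_eq_intros dq\<close>)
  then show ?thesis by (simp add: sum_negf)
qed

lemma R_deriv: "(R i has_real_derivative R' i t) (at t)"
  unfolding R_def[abs_def] R'_def by (rule prod_deriv) auto

lemma P0_deriv: "(P0 has_real_derivative - (\<Sum>i<n. q' i t * R i t)) (at t)"
  unfolding P0_def[abs_def] R_def by (rule prod_deriv) auto

lemma P0_eq: "i < n \<Longrightarrow> P0 t = (1 - q i t) * R i t"
  unfolding P0_def R_def by (subst prod.remove[of _ i]) auto

lemma R01: "0 \<le> R i t" "R i t \<le> 1"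
  unfolding R_def using q01 by (auto intro!: prod_nonneg prod_le_1)

lemma R'_le: "R' i t \<le> 0"
  unfolding R'_def using q01 q'0 by (auto intro!: sum_nonneg mult_nonneg_nonneg prod_nonneg)

lemma R_antimono: "s \<le> t \<Longrightarrow> R i t \<le> R i s"
  by (rule DERIV_nonpos_imp_nonincreasing[where f = "R i"]) (auto intro: exI[of _ "R' i _"] R_deriv R'_le)

lemma R'_cont: "continuous_on A (R' i)"
  unfolding R'_def[abs_def] by (intro continuous_intros q'_cont q_cont) auto

lemma R_cont: "continuous_on A (R i)"
  by (intro continuous_at_imp_continuous_on ballI DERIV_isCont[OF R_deriv])

lemma R_0: "R i 0 = 1" unfolding R_def using q0 by (auto intro!: prod.neutral)

lemma P0_0: "P0 0 = 1" unfolding P0_def using q0 by (auto intro!: prod.neutral)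

lemma P0_nonneg: "P0 t \<ge> 0" unfolding P0_def using q01 by (auto intro!: prod_nonneg)

lemma S_0: "S 0 = 1" by (simp add: S_def P0_0 q0)

lemma S_ge: "S t \<ge> 1 - G"
proof -
  have "0 \<le> P0 t + (\<Sum>i<n. q i t * R i t)"
    using q01 R01 P0_nonneg by (intro add_nonneg_nonneg sum_nonneg mult_nonneg_nonneg) auto
  then have "0 \<le> G * (P0 t + (\<Sum>i<n. q i t * R i t))" using G by simp
  then show ?thesis by (simp add: S_def algebra_simps)
qed

lemma S_pos: "S t > 0" using S_ge[of t] G by simp

lemma S_neq: "S t \<noteq> 0" using S_pos[of t] by simp

lemma S_deriv: "(S has_real_derivative G * (\<Sum>i<n. q i t * R' i t)) (at t)"
proof -
  have a: "((\<lambda>t. \<Sum>i<n. q i t * R i t) has_real_derivative (\<Sum>i<n. q i t * R' i t + q' i t * R i t)) (at t)"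
    by (intro DERIV_sum DERIV_mult' dq R_deriv) auto
  have "(S has_real_derivative 0 - G * (0 - - (\<Sum>i<n. q' i t * R i t) - (\<Sum>i<n. q i t * R' i t + q' i t * R i t))) (at t)"
    unfolding S_def[abs_def] by (intro DERIV_diff DERIV_const DERIV_cmult P0_deriv a)
  then show ?thesis by (rule DERIV_cong) (simp add: sum.distrib algebra_simps)
qed

lemma S_cont: "continuous_on A S"
  by (intro continuous_at_imp_continuous_on ballI DERIV_isCont[OF S_deriv])

lemma c_nonneg: "c i t \<ge> 0"
  unfolding c_def using G R'_le S_pos by (intro divide_nonneg_pos mult_nonneg_nonneg) auto

lemma c_cont: "continuous_on A (c i)"
  unfolding c_def[abs_def] by (intro continuous_intros R'_cont S_cont) (simp add: S_neq)

lemma c_S: "c i t * S t = - (G * R' i t)" unfolding c_def using S_pos[of t] by simp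

lemma int_deriv:
  fixes h :: "real \<Rightarrow> real"
  assumes "continuous_on UNIV h" "0 < t" "t < 1"
  shows "((\<lambda>u. integral {0..u} h) has_real_derivative h t) (at t)"
proof -
  have "((\<lambda>u. integral {0..u} h) has_real_derivative h t) (at t within {0..1})"
    by (rule integral_has_real_derivative) (use assms continuous_on_subset in auto)
  moreover have "at t within {0..1} = at t"
    by (rule at_within_interior) (use assms in \<open>auto simp: interior_atLeastAtMost_real\<close>)
  ultimately show ?thesis by simp
qed

lemma int_cont:
  fixes h :: "real \<Rightarrow> real"
  assumes "continuous_on UNIV h"
  shows "continuous_on {0..1} (\<lambda>u. integral {0..u} h)"
  by (rule indefinite_integral_continuous_1) 
     (use assms in \<open>auto intro!: integrable_continuous_interval intro: continuous_on_subset\<close>)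

lemma qc_cont: "i < n \<Longrightarrow> continuous_on A (\<lambda>s. q i s * c i s)"
  by (intro continuous_intros q_cont c_cont)

lemma g_pos: "g i t > 0" by (simp add: g_def)

lemma g_0: "g i 0 = 1" by (simp add: g_def)

lemma g_deriv: assumes "i < n" "0 < t" "t < 1" 
  shows "(g i has_real_derivative - (q i t * (c i t * g i t))) (at t)"
  unfolding g_def[abs_def]
  by (auto intro!: derivative_eq_intros int_deriv[OF qc_cont] assms)

lemma g_cont: "i < n \<Longrightarrow> continuous_on {0..1} (g i)"
  unfolding g_def[abs_def] by (intro continuous_intros int_cont qc_cont)

text \<open>Confirms that S is the chance of no sale: S' = G * \<Sum> q_i * R_i' = - S * \<Sum> q_i
  * c_i, so ln S and the exponents of the \<open>g i\<close> have the same derivative and agree at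
  0.\<close>

lemma prod_g: assumes t: "0 \<le> t" "t \<le> 1" shows "(\<Prod>i<n. g i t) = S t"
proof -
  let ?h = "\<lambda>t. ln (S t) + (\<Sum>i<n. integral {0..t} (\<lambda>s. q i s * c i s))"
  have "?h t = ?h 0"
  proof (cases "t = 0")
    case False
    then have "0 < t" using t by simp
    then show ?thesis
    proof (rule DERIV_isconst_end)
      have "continuous_on {0..t} (\<lambda>u. integral {0..u} (\<lambda>s. q i s * c i s))" if "i < n" for i
        using int_cont[OF qc_cont[OF that]] by (rule continuous_on_subset) (use t in auto)
      then show "continuous_on {0..t} ?h"
        by (intro continuous_intros S_cont) (auto simp: S_neq)
      fix r assume r: "0 < r" "r < t"
      have "(?h has_real_derivative (inverse (S r) * (G * (\<Sum>i<n. q i r * R' i r)) + (\<Sum>i<n. q i r * c i r))) (at r)"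
        using r t S_pos[of r]
        by (intro DERIV_add DERIV_sum int_deriv qc_cont DERIV_chain2[OF DERIV_ln S_deriv]) auto
      moreover have "(\<Sum>i<n. q i r * c i r) = - (inverse (S r) * (G * (\<Sum>i<n. q i r * R' i r)))"
        unfolding c_def by (simp add: sum_distrib_left sum_negf[symmetric] field_simps)
      ultimately show "(?h has_real_derivative 0) (at r)" by simp
    qed
  qed simp
  then have "ln (S t) = (\<Sum>i<n. - integral {0..t} (\<lambda>s. q i s * c i s))" by (simp add: S_0 sum_negf)
  then have "exp (ln (S t)) = (\<Prod>i<n. g i t)" by (simp add: exp_sum g_def)
  then show ?thesis using S_pos[of t] by simp
qed

lemma f_nonneg: "f i t \<ge> 0" unfolding f_def using c_nonneg g_pos by (simp add: less_imp_le)

lemma f_cont: "i < n \<Longrightarrow> continuous_on {0..1} (f i)"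
  unfolding f_def[abs_def] by (intro continuous_intros c_cont g_cont)

lemma f_prod: assumes "i < n" "0 \<le> t" "t \<le> 1" shows "f i t * (\<Prod>l\<in>{..<n}-{i}. g l t) = - (G * R' i t)"
proof -
  have "S t = g i t * (\<Prod>l\<in>{..<n}-{i}. g l t)" 
    using assms by (subst prod_g[symmetric]) (auto simp: prod.remove[of _ i])
  then show ?thesis using c_S[of i t] by (simp add: f_def mult_ac)
qed

lemma F_deriv: assumes "i < n" "0 < t" "t < 1" shows "(F i has_real_derivative c i t * g i t) (at t)"
proof -
  have "((\<lambda>u. integral {0..u} (f i)) has_real_derivative f i t) (at t within {0..1})"
    by (rule integral_has_real_derivative) (use assms f_cont in auto)
  moreover have "at t within {0..1} = at t"
    by (rule at_within_interior) (use assms in \<open>auto simp: interior_atLeastAtMost_real\<close>)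
  ultimately show ?thesis by (simp add: F_def[abs_def] f_def)
qed

lemma F_cont: "i < n \<Longrightarrow> continuous_on {0..1} (F i)"
  unfolding F_def[abs_def]
  by (rule indefinite_integral_continuous_1) (auto intro!: integrable_continuous_interval f_cont)

lemma g_eq: assumes i: "i < n" and t: "0 \<le> t" "t \<le> 1" shows "g i t = 1 - integral {0..t} (\<lambda>s. q i s * f i s)"
proof -
  have "((\<lambda>s. - (q i s * (c i s * g i s))) has_integral (g i t - g i 0)) {0..t}"
  proof (rule fundamental_theorem_of_calculus_interior)
    show "continuous_on {0..t} (g i)" using g_cont[OF i] by (rule continuous_on_subset) (use t in auto)
    show "(g i has_vector_derivative - (q i s * (c i s * g i s))) (at s)" if "s \<in> {0<..<t}" for s
      using g_deriv[OF i, of s] that t by (simp add: has_real_derivative_iff_has_vector_derivative)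
  qed (use t in auto)
  then have "((\<lambda>s. q i s * f i s) has_integral - (g i t - g i 0)) {0..t}"
    unfolding f_def by (drule_tac has_integral_neg) simp
  then show ?thesis by (simp add: integral_unique g_0)
qed

text \<open>At most one value above the level means that all the others are below, or that i is
  below and exactly one other value is above. The second chance is (1 - q_i) * X, and X is bounded
  by \<open>exactly_one_lower\<close>.\<close>

lemma S_lower: assumes i: "i < n" shows "aa G (R i t) + (1 - q i t) * qq G (R i t) \<le> S t"
proof -
  let ?A = "{..<n} - {i}"
  define X where "X = (\<Sum>l\<in>?A. q l t * (\<Prod>m\<in>?A-{l}. 1 - q m t))"
  have X: "- (R i t * ln (R i t)) \<le> X"
    unfolding X_def R_def by (rule exactly_one_lower) (use q01 in auto)
  have "(\<Sum>l\<in>?A. q l t * R l t) = (1 - q i t) * X"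
    unfolding X_def sum_distrib_left
  proof (rule sum.cong[OF refl])
    fix l assume l: "l \<in> ?A"
    have "R l t = (1 - q i t) * (\<Prod>m\<in>{..<n}-{l}-{i}. 1 - q m t)"
      unfolding R_def using i l by (subst prod.remove[of _ i]) auto
    also have "{..<n}-{l}-{i} = ?A-{l}" by auto
    finally show "q l t * R l t = (1 - q i t) * (q l t * (\<Prod>m\<in>?A-{l}. 1 - q m t))" by simp
  qed
  then have s: "(\<Sum>l<n. q l t * R l t) = q i t * R i t + (1 - q i t) * X"
    using i by (subst sum.remove[of _ i]) auto
  have "S t = 1 - G + G * R i t + G * ((1 - q i t) * X)"
    unfolding S_def s P0_eq[OF i] by (simp add: algebra_simps)
  moreover have "G * ((1 - q i t) * X) \<ge> G * ((1 - q i t) * - (R i t * ln (R i t)))"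
    using X q01[OF i] G by (intro mult_left_mono) auto
  ultimately show ?thesis by (simp add: aa_def qq_def algebra_simps)
qed

lemma item: assumes i: "i < n" and R1: "R i 1 = 0" shows "item_curve G (R i) (q i) S (c i) (F i) (g i)"
proof
  show "(R i has_real_derivative - (c i t * S t / G)) (at t)" for t
    using R_deriv[of i t] G by (simp add: c_S)
qed (use i G R_cont F_cont g_cont F_deriv g_deriv c_nonneg S_lower R_antimono q_mono q01 R_0 R1 g_0 g_pos
     in \<open>auto simp: F_def intro: less_imp_le\<close>)

text \<open>Offers up to level s sell with total probability G * Pr(at least two above s). Later
  offers of item i add G * q_i(s) * (R_i(s) - R_i(1)), that is G * Pr(exactly one above s) in total,
  up to the boundary term. Together they give G * Pr(at least one above s).\<close>

lemma level_identity: assumes s: "0 \<le> s" "s \<le> 1"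
  shows "(\<Sum>i<n. integral {0..1} (\<lambda>t. - (G * R' i t) * q i (min t s))) = G * (1 - P0 s) - G * (\<Sum>i<n. q i s * R i 1)"
proof -
  have c1: "continuous_on A (\<lambda>t. - R' i t * q i t)" if "i < n" for i A
    using that by (intro continuous_intros R'_cont q_cont)
  let ?h = "\<lambda>s. (\<Sum>i<n. integral {0..s} (\<lambda>t. - R' i t * q i t) + q i s * R i s) + P0 s"
  have "?h s = ?h 0"
  proof (cases "s = 0")
    case False
    then have "0 < s" using s by simp
    then show ?thesis
    proof (rule DERIV_isconst_end)
      have "continuous_on {0..s} (\<lambda>u. integral {0..u} (\<lambda>t. - R' i t * q i t))" if "i < n" for i
        using int_cont[OF c1[OF that]] by (rule continuous_on_subset) (use s in auto)
      moreover have "continuous_on {0..s} P0"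
        by (intro continuous_at_imp_continuous_on ballI DERIV_isCont[OF P0_deriv])
      ultimately show "continuous_on {0..s} ?h"
        by (intro continuous_intros R_cont q_cont) auto
      fix r assume r: "0 < r" "r < s"
      have "(?h has_real_derivative (\<Sum>i<n. - R' i r * q i r + (q i r * R' i r + q' i r * R i r)) + - (\<Sum>i<n. q' i r * R i r)) (at r)"
        using r s by (intro DERIV_add DERIV_sum int_deriv c1 DERIV_mult' dq R_deriv P0_deriv) auto
      then show "(?h has_real_derivative 0) (at r)" by (rule DERIV_cong) (simp add: mult.commute)
    qed
  qed simp
  then have h: "(\<Sum>i<n. integral {0..s} (\<lambda>t. - R' i t * q i t) + q i s * R i s) = 1 - P0 s"
    by (simp add: P0_0 q0)
  have "integral {0..1} (\<lambda>t. - (G * R' i t) * q i (min t s)) = G * (integral {0..s} (\<lambda>t. - R' i t * q i t) + q i s * R i s - q i s * R i 1)"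
    if i: "i < n" for i
  proof -
    have "((\<lambda>t. - R' i t * q i (min t s)) has_integral integral {0..s} (\<lambda>t. - R' i t * q i t)) {0..s}"
      by (rule has_integral_eq[OF _ integrable_integral]) 
         (use c1[OF i] in \<open>auto intro!: integrable_continuous_interval simp: min_def\<close>)
    moreover have "((\<lambda>t. R' i t) has_integral R i 1 - R i s) {s..1}"
      by (rule fundamental_theorem_of_calculus) 
         (use s R_deriv in \<open>auto simp: has_real_derivative_iff_has_vector_derivative intro: has_vector_derivative_at_within\<close>)
    then have "((\<lambda>t. R' i t * (- q i s)) has_integral (R i 1 - R i s) * (- q i s)) {s..1}"
      by (rule has_integral_mult_left)
    then have "((\<lambda>t. - R' i t * q i (min t s)) has_integral (R i 1 - R i s) * (- q i s)) {s..1}"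
      by (rule has_integral_eq[rotated]) (auto simp: min_def)
    ultimately have "((\<lambda>t. - R' i t * q i (min t s)) has_integral 
        (integral {0..s} (\<lambda>t. - R' i t * q i t) + (R i 1 - R i s) * (- q i s))) {0..1}"
      using s by (intro has_integral_combine) auto
    then have "((\<lambda>t. G * (- R' i t * q i (min t s))) has_integral 
        G * (integral {0..s} (\<lambda>t. - R' i t * q i t) + (R i 1 - R i s) * (- q i s))) {0..1}"
      by (rule has_integral_mult_right)
    then have "integral {0..1} (\<lambda>t. G * (- R' i t * q i (min t s))) = 
        G * (integral {0..s} (\<lambda>t. - R' i t * q i t) + (R i 1 - R i s) * (- q i s))"
      by (rule integral_unique)
    moreover have "(\<lambda>t. - (G * R' i t) * q i (min t s)) = (\<lambda>t. G * (- R' i t * q i (min t s)))" by auto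
    moreover define X where "X = integral {0..s} (\<lambda>t. - R' i t * q i t)"
    ultimately show ?thesis unfolding X_def[symmetric] by (simp only:) (simp add: algebra_simps)
  qed
  then have "(\<Sum>i<n. integral {0..1} (\<lambda>t. - (G * R' i t) * q i (min t s))) = 
    G * ((\<Sum>i<n. integral {0..s} (\<lambda>t. - R' i t * q i t) + q i s * R i s) - (\<Sum>i<n. q i s * R i 1))"
    by (simp add: sum_distrib_left sum_subtractf[symmetric])
  then show ?thesis unfolding h by (simp add: algebra_simps)
qed

end

text \<open>The event i is kept exact and the logarithmic bound is applied to the others
  only.\<close>

lemma exactly_one_split:
  fixes p :: "'a \<Rightarrow> real"
  assumes A: "finite A" "i \<in> A" and p: "\<And>l. l \<in> A \<Longrightarrow> 0 \<le> p l \<and> p l \<le> 1"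
  defines "Z \<equiv> \<Prod>l\<in>A-{i}. 1 - p l"
  shows "Z * (p i + (1 - p i) * - ln Z) \<le> (\<Sum>l\<in>A. p l * (\<Prod>m\<in>A-{l}. 1 - p m))"
proof -
  define X where "X = (\<Sum>l\<in>A-{i}. p l * (\<Prod>m\<in>A-{i}-{l}. 1 - p m))"
  have X: "- (Z * ln Z) \<le> X" unfolding X_def Z_def by (rule exactly_one_lower) (use A p in auto)
  have "(\<Sum>l\<in>A-{i}. p l * (\<Prod>m\<in>A-{l}. 1 - p m)) = (1 - p i) * X"
    unfolding X_def sum_distrib_left
  proof (rule sum.cong[OF refl])
    fix l assume l: "l \<in> A - {i}"
    have "(\<Prod>m\<in>A-{l}. 1 - p m) = (1 - p i) * (\<Prod>m\<in>A-{l}-{i}. 1 - p m)"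
      using A l by (intro prod.remove) auto
    moreover have "A-{l}-{i} = A-{i}-{l}" by auto
    ultimately show "p l * (\<Prod>m\<in>A-{l}. 1 - p m) = (1 - p i) * (p l * (\<Prod>m\<in>A-{i}-{l}. 1 - p m))" by simp
  qed
  then have "(\<Sum>l\<in>A. p l * (\<Prod>m\<in>A-{l}. 1 - p m)) = p i * Z + (1 - p i) * X"
    using A unfolding Z_def by (subst sum.remove[of A i]) auto
  moreover have "(1 - p i) * - (Z * ln Z) \<le> (1 - p i) * X" using X p[OF A(2)] by (intro mult_left_mono) auto
  ultimately show ?thesis by (simp add: algebra_simps)
qed

section \<open>The final inequality on three ranges of levels\<close>

text \<open>y is the q of the exceptional item at the level, v at its opening level, and w the
  product of 1 - q over the others. The two coefficients of y add up to just over 0.7258, and v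
  \<le> 0.057 keeps (1 - 0.54892 * v) * 0.757 above 0.7258.\<close>

lemma numeric_early:
  fixes w y v :: real
  assumes "0 \<le> y" "y \<le> v" "v \<le> 57/1000" "0 \<le> w" "w \<le> 1"
  shows "7258/10000 * (1 - (1 - y) * w)
    \<le> 54892/100000 * y + 45108/100000 * (392129/1000000) * y + (1 - 54892/100000 * v) * (757/1000 * (1 - w))"
proof -
  have "0 \<le> ((1 - 54892/100000 * v) * (757/1000) - 7258/10000) * (1 - w)"
  proof (intro mult_nonneg_nonneg)
    show "0 \<le> (1 - 54892/100000 * v) * (757/1000) - 7258/10000" using assms(3) by ((simp add: algebra_simps; fail) | (simp add: field_simps; fail) | (auto simp: algebra_simps; fail) | argo)
  qed (use assms in simp)
  moreover have "0 \<le> y * (1 - w)" using assms by (intro mult_nonneg_nonneg) auto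
  ultimately show ?thesis using assms(1) by ((simp add: algebra_simps; fail) | (simp add: field_simps; fail) | (auto simp: algebra_simps; fail) | argo)
qed

text \<open>Rearranged: (0.7258 * w - 0.17688) * y \<le> 0.0312 * (1 - w), with 0.0312 = 0.757 -
  0.7258 and 0.17688 equal to 0.45108 * 0.392129 rounded down. The left factor is positive only for
  w > 0.2437, where \<kappa> limits y.\<close>

lemma numeric_mid:
  fixes w y \<kappa> :: real
  assumes y: "0 \<le> y" and w: "w \<le> 1/2" and \<kappa>: "2437/10000 \<le> w \<Longrightarrow> y * \<kappa> < 2/1000" "2437/10000 \<le> w \<Longrightarrow> 0 < \<kappa>"
    and poly: "2437/10000 \<le> w \<Longrightarrow> 2/1000 * (7258/10000 * w - 17688/100000) \<le> 312/10000 * (1 - w) * \<kappa>"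
  shows "7258/10000 * (1 - (1 - y) * w) \<le> 757/1000 * (1 - w) + 45108/100000 * (392129/1000000) * y"
proof -
  define A where "A = 7258/10000 * w - 17688/100000"
  have "A * y \<le> 312/10000 * (1 - w)"
  proof (cases "A \<le> 0")
    case True
    then have "A * y \<le> 0" using y by (rule mult_nonpos_nonneg)
    also have "0 \<le> 312/10000 * (1 - w)" using w by simp
    finally show ?thesis .
  next
    case False
    then have A: "0 < A" by simp
    then have w': "2437/10000 \<le> w" unfolding A_def by ((simp add: algebra_simps; fail) | (simp add: field_simps; fail) | (auto simp: algebra_simps; fail) | argo)
    show ?thesis
    proof (rule ccontr)
      assume "\<not> ?thesis"
      then have "312/10000 * (1 - w) * \<kappa> < A * y * \<kappa>" using \<kappa>(2)[OF w'] by (intro mult_strict_right_mono) auto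
      also have "\<dots> = A * (y * \<kappa>)" by simp
      also have "\<dots> \<le> A * (2/1000)" using A \<kappa>(1)[OF w'] by (intro mult_left_mono) auto
      also have "\<dots> \<le> 312/10000 * (1 - w) * \<kappa>" using poly[OF w'] unfolding A_def by (simp only: mult.commute[of _ "2/1000"])
      finally show False by simp
    qed
  qed
  then show ?thesis using y unfolding A_def by ((simp add: algebra_simps; fail) | (simp add: field_simps; fail) | (auto simp: algebra_simps; fail) | argo)
qed

text \<open>0.607871 = 0.757 * 0.803 is what the others supply once they rest. It covers 0.7258 * (1
  - w) down to w = 0.1625; below, y has to make up the difference, and the staircase of lower bounds
  for y is fine enough for that.\<close>

lemma numeric_late:
  fixes w y :: real
  assumes y: "0 \<le> y" and w: "0 \<le> w" "w \<le> 197/1000"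
    and 1: "w \<le> 1625/10000 \<Longrightarrow> 635/10000 \<le> y" and 2: "w \<le> 157/1000 \<Longrightarrow> 2175/10000 \<le> y"
    and 3: "w \<le> 14/100 \<Longrightarrow> 345/1000 \<le> y" and 4: "w \<le> 12/100 \<Longrightarrow> 68/100 \<le> y"
  shows "7258/10000 * (1 - (1 - y) * w) \<le> 607871/1000000 + 45108/100000 * (392129/1000000) * y"
proof -
  define A where "A = 17688/100000 - 7258/10000 * w"
  have A: "0 \<le> A" unfolding A_def using w by ((simp add: algebra_simps; fail) | (simp add: field_simps; fail) | (auto simp: algebra_simps; fail) | argo)
  have *: "7258/10000 * (1 - w) - 607871/1000000 \<le> y * A"
    if "\<eta> \<le> y" "7258/10000 * (1 - w) - 607871/1000000 \<le> \<eta> * A" for \<eta>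
    using mult_right_mono[OF that(1) A] that(2) by linarith
  have "7258/10000 * (1 - w) - 607871/1000000 \<le> y * A"
  proof -
    consider "1625/10000 \<le> w" | "157/1000 \<le> w" "w \<le> 1625/10000" | "14/100 \<le> w" "w \<le> 157/1000" | "12/100 \<le> w" "w \<le> 14/100" | "w \<le> 12/100"
      by linarith
    then show ?thesis
    proof cases
      case 1
      have "7258/10000 * (1 - w) - 607871/1000000 \<le> 0 * A" using 1 by simp
      then show ?thesis by (rule *[OF y])
    next
      case 2
      show ?thesis by (rule *[OF assms(4)[OF 2(2)]]) (use 2 in \<open>unfold A_def, ((simp add: algebra_simps; fail) | (simp add: field_simps; fail) | (auto simp: algebra_simps; fail) | argo)\<close>)
    next
      case 3
      show ?thesis by (rule *[OF assms(5)[OF 3(2)]]) (use 3 in \<open>unfold A_def, ((simp add: algebra_simps; fail) | (simp add: field_simps; fail) | (auto simp: algebra_simps; fail) | argo)\<close>)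
    next
      case 4
      show ?thesis by (rule *[OF assms(6)[OF 4(2)]]) (use 4 in \<open>unfold A_def, ((simp add: algebra_simps; fail) | (simp add: field_simps; fail) | (auto simp: algebra_simps; fail) | argo)\<close>)
    next
      case 5
      show ?thesis by (rule *[OF assms(7)[OF 5]]) (use 5 w in \<open>unfold A_def, ((simp add: algebra_simps; fail) | (simp add: field_simps; fail) | (auto simp: algebra_simps; fail) | argo)\<close>)
    qed
  qed
  then show ?thesis using y unfolding A_def by ((simp add: algebra_simps; fail) | (simp add: field_simps; fail) | (auto simp: algebra_simps; fail) | argo)
qed

text \<open>The polynomial \<open>kk\<close>, restated outside the locale since it does not depend
  on the curve.\<close>

definition kq :: "real \<Rightarrow> real" where "kq x = 0.56 * (x - 0.2105)^2 - 0.4667 * (x - 0.2105)^3"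

lemma kk_poly:
  fixes w :: real
  assumes "2437/10000 \<le> w" "w \<le> 1/2"
  shows "2/1000 * (7258/10000 * w - 17688/100000) \<le> 312/10000 * (1 - w) * kq w" and "0 < kq w"
proof -
  define u where "u = w - 0.2105"
  have u: "0.03 \<le> u" "u \<le> 0.2895" using assms by (simp_all add: u_def)
  have w: "w = 0.2105 + u" "1 - w = 0.7895 - u" by (simp_all add: u_def)
  have k: "kq w = 0.56 * u^2 - 0.4667 * u^3" by (simp add: kq_def u_def)
  have "0 \<le> 0.0312 * (0.7895 - u) * (0.56 * u^2 - 0.4667 * u^3) - 0.002 * (0.7258 * (0.2105 + u) - 0.17688)"
  proof -
    consider "u \<le> 0.065" | "0.065 \<le> u" "u \<le> 0.0895" | "0.0895 \<le> u" by argo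
    then show ?thesis using u by cases (simp_all only: upper_poly0 upper_poly1 upper_poly2)
  qed
  then have "0.002 * (0.7258 * w - 0.17688) \<le> 0.0312 * (1 - w) * kq w"
    unfolding k w(2) unfolding w(1) by (simp only: diff_ge_0_iff_ge)
  then show "2/1000 * (7258/10000 * w - 17688/100000) \<le> 312/10000 * (1 - w) * kq w" by simp
  have "0 < u^2 * (0.56 - 0.4667 * u)" using u by (intro mult_pos_pos) auto
  then show "0 < kq w" unfolding k by (simp add: power2_eq_square power3_eq_cube algebra_simps)
qed

locale full_path =
  fixes ga gb :: real and n :: nat and q q' :: "nat \<Rightarrow> real \<Rightarrow> real"
  assumes ga: "ga = 0.7258" and gb: "gb = 0.757" and n: "1 < n"
    and dq: "\<And>i t. i < n \<Longrightarrow> (q i has_real_derivative q' i t) (at t)"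
    and cq': "\<And>i. i < n \<Longrightarrow> continuous_on UNIV (q' i)"
    and q'0: "\<And>i t. i < n \<Longrightarrow> 0 \<le> q' i t"
    and q01: "\<And>i t. i < n \<Longrightarrow> 0 \<le> q i t \<and> q i t \<le> 1"
    and q0: "\<And>i. i < n \<Longrightarrow> q i 0 = 0" and q1: "\<And>i. i < n \<Longrightarrow> q i 1 = 1"
begin

sublocale A: qpath n ga q q'
  by (rule qpath.intro) (simp add: ga, simp add: ga, (rule dq cq' q'0 q01 q0, assumption)+)

lemma R_1: "A.R i 1 = 0"
proof -
  have "\<exists>l\<in>{..<n}-{i}. 1 - q l 1 = 0"
    using n q1[of 0] q1[of 1] by (cases "i = 0") (auto intro: bexI[of _ 0] bexI[of _ 1])
  then show ?thesis unfolding A.R_def by (intro prod_zero) auto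
qed

text \<open>If every mass fits, no atoms are used and the clock is the level itself.
  \<open>level_identity\<close> then gives equality: its boundary term vanishes because each item
  has another one whose q is 1 at level 1.\<close>

lemma plain_design:
  assumes F: "\<And>i. i < n \<Longrightarrow> A.F i 1 \<le> 1"
  shows "\<exists>c f d \<sigma> a. fluid_design n c f d \<sigma> a \<and>
    (\<forall>s. 0 \<le> s \<longrightarrow> s \<le> 1 \<longrightarrow> ga * (1 - (\<Prod>i<n. 1 - q i s)) \<le> fluid_reward n q c f d \<sigma> a s)"
proof -
  have "fluid_design n (\<lambda>_. 0) A.f (\<lambda>_. 0) (\<lambda>t. t) 0"
    unfolding fluid_design_def using F[unfolded A.F_def] A.f_cont A.f_nonneg by (simp add: continuous_on_id)
  moreover have "ga * (1 - (\<Prod>i<n. 1 - q i s)) \<le> fluid_reward n q (\<lambda>_. 0) A.f (\<lambda>_. 0) (\<lambda>t. t) 0 s"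
    if s: "0 \<le> s" "s \<le> 1" for s
  proof -
    have "integral {0..1} (\<lambda>t. A.f i t * (q i (min t s) * (\<Prod>l\<in>{..<n}-{i}. 1 - integral {0..t} (\<lambda>x. q l x * A.f l x))))
      = integral {0..1} (\<lambda>t. - (ga * A.R' i t) * q i (min t s))" if i: "i < n" for i
    proof (rule integral_cong)
      fix t :: real assume t: "t \<in> {0..1}"
      have "(\<Prod>l\<in>{..<n}-{i}. 1 - integral {0..t} (\<lambda>x. q l x * A.f l x)) = (\<Prod>l\<in>{..<n}-{i}. A.g l t)"
        using t by (intro prod.cong) (simp_all add: A.g_eq)
      then show "A.f i t * (q i (min t s) * (\<Prod>l\<in>{..<n}-{i}. 1 - integral {0..t} (\<lambda>x. q l x * A.f l x)))
        = - (ga * A.R' i t) * q i (min t s)"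
        using A.f_prod[OF i, of t] t by (simp only: atLeastAtMost_iff mult_ac)
    qed
    then have "fluid_reward n q (\<lambda>_. 0) A.f (\<lambda>_. 0) (\<lambda>t. t) 0 s = (\<Sum>i<n. integral {0..1} (\<lambda>t. - (ga * A.R' i t) * q i (min t s)))"
      unfolding fluid_reward_def by simp
    also have "\<dots> = ga * (1 - A.P0 s)" using A.level_identity[OF s] by (simp only: R_1 mult_zero_right sum.neutral_const diff_zero)
    finally show ?thesis by (simp only: A.P0_def order_refl)
  qed
  ultimately show ?thesis by blast
qed

text \<open>A mass above 1 is turned into information: by the structure lemmas q_j is small while w
  is large and large once w is small. Two offers at fixed levels therefore exploit item j well
  enough, and the others can be scheduled without regard to it.\<close>

lemma big_item_design:
  assumes j: "j < n" and big: "1 < A.F j 1"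
  shows "\<exists>c f d \<sigma> a. fluid_design n c f d \<sigma> a \<and>
    (\<forall>s. 0 \<le> s \<longrightarrow> s \<le> 1 \<longrightarrow> ga * (1 - (\<Prod>i<n. 1 - q i s)) \<le> fluid_reward n q c f d \<sigma> a s)"
proof -
  define w where "w = A.R j"
  have J0: "item_curve ga w (q j) A.S (A.c j) (A.F j) (A.g j)" unfolding w_def by (rule A.item[OF j R_1])
  then have J1: "item_curve_a w (q j) A.S (A.c j) (A.F j) (A.g j)" unfolding item_curve_a_def by (simp only: ga)
  have nF: "\<not> A.F j 1 \<le> 1" using big by simp
  \<comment> \<open>Contrapositive of \<open>upper_structure\<close>.\<close>
  have U: "q j t * kq (w t) < 0.002" if "0 \<le> t" "t \<le> 1" "0.214 \<le> w t" "w t \<le> 0.5" for t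
  proof (rule ccontr)
    assume "\<not> q j t * kq (w t) < 0.002"
    then have "q j t * item_curve_a.kk (w t) \<ge> 0.002" unfolding item_curve_a.kk_def[OF J1] kq_def by (simp only: not_less)
    from item_curve_a.upper_structure[OF J1 that this] show False using nF by blast
  qed
  have w01: "w 0 = 1" "w 1 = 0" by (simp_all add: w_def A.R_0 R_1)
  have w_range: "0 \<le> w t" "w t \<le> 1" for t by (simp_all add: w_def A.R01)
  have w_anti: "s \<le> t \<Longrightarrow> w t \<le> w s" for s t unfolding w_def by (rule A.R_antimono)
  have hit: "\<exists>s. 0 \<le> s \<and> s \<le> 1 \<and> w s = v" if "0 \<le> v" "v \<le> 1" for v
    by (rule item_curve.hit_before[OF J0, of 1 v]) (use that w01 in auto)
  \<comment> \<open>Contrapositive of \<open>lower_structure\<close>, moved from the time when w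
    equals v to any later time by monotonicity of q_j.\<close>
  have yL: "\<eta> \<le> q j t" if t: "0 \<le> t" "t \<le> 1" "w t \<le> v" and v: "0.12 \<le> v" "v \<le> 0.2105" and \<eta>: "0 \<le> \<eta>" "\<eta> \<le> 1"
    and C: "Ga * \<eta> * ((1 - \<eta>) * 0.925 * (0.2105 - v)^2) \<le> 0.36 * \<tau>" "0.00173 \<le> (1 - \<eta>) * 0.925 * (0.2105 - v)^2 - \<tau> * (0.2105 - v)" for t v \<eta> \<tau>
  proof (rule ccontr)
    assume "\<not> \<eta> \<le> q j t"
    obtain s where s: "0 \<le> s" "s \<le> t" "w s = v"
      by (rule item_curve.hit_before[OF J0, of t v]) (use t v in auto)
    have "q j s \<le> \<eta>" using A.q_mono[OF j s(2)] \<open>\<not> \<eta> \<le> q j t\<close> by simp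
    moreover have "s \<le> 1" using s t by simp
    moreover have "0.12 \<le> w s" "w s \<le> 0.2105" unfolding s(3) by (rule v)+
    moreover have "Ga * \<eta> * ((1 - \<eta>) * 0.925 * (0.2105 - w s)^2) \<le> 0.36 * \<tau>" unfolding s(3) by (rule C)
    moreover have "0.00173 \<le> (1 - \<eta>) * 0.925 * (0.2105 - w s)^2 - \<tau> * (0.2105 - w s)" unfolding s(3) by (rule C)
    ultimately have "A.F j 1 \<le> 1" using item_curve_a.lower_structure[OF J1 s(1)] \<eta>(2) by blast
    then show False using nF by simp
  qed
  \<comment> \<open>a is the level of the opening offer of item j; there \<open>kq\<close> is large
    enough to force q_j \<le> 0.057. At level b the others come to rest.\<close>
  obtain a where a: "0 \<le> a" "a \<le> 1" "w a = 1/2" using hit[of "1/2"] by auto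
  obtain b where b: "0 \<le> b" "b \<le> 1" "w b = 0.197" using hit[of "0.197"] by auto
  have ab: "a \<le> b" using w_anti[of b a] a b by (cases "a \<le> b") auto
  have b0: "0 < b" using b w01 by (cases "b = 0") auto
  have ya: "q j a \<le> 57/1000"
  proof -
    have "q j a * kq (1/2) < 2/1000" using U[of a] a by simp
    moreover have "kq (1/2) \<ge> 356/10000" by (simp add: kq_def power2_eq_square power3_eq_cube)
    then have "q j a * (356/10000) \<le> q j a * kq (1/2)" using q01[OF j] by (intro mult_left_mono) auto
    ultimately show ?thesis by linarith
  qed
  \<comment> \<open>A fictitious path. The others run from level 0 to b in the first half and rest
    in the second; item j is absent in the first half and rises from 0 to 1 in the second. The real
    item j does not follow it: the fictitious rise only drives the products of the others to 0, so
    that their boundary terms in \<open>level_identity\<close> vanish.\<close>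
  define qt where "qt l t = (if l = j then smooth (2 * t - 1) else q l (b * smooth (2 * t)))" for l t
  define qt' where "qt' l t = (if l = j then smooth' (2 * t - 1) * 2 else q' l (b * smooth (2 * t)) * (b * (smooth' (2 * t) * 2)))" for l t
  have dqt: "(qt i has_real_derivative qt' i t) (at t)" if i: "i < n" for i t
  proof (cases "i = j")
    case True
    have "((\<lambda>t. 2 * t - 1) has_real_derivative 2) (at t)" by (auto intro!: derivative_eq_intros)
    from DERIV_chain2[where f = smooth and g = "\<lambda>t. 2 * t - 1", OF smooth_deriv this] show ?thesis
      by (simp add: qt_def[abs_def] qt'_def True)
  next
    case False
    have "((\<lambda>t. 2 * t) has_real_derivative 2) (at t)" by (auto intro!: derivative_eq_intros)
    from DERIV_cmult[OF DERIV_chain2[where f = smooth and g = "\<lambda>t. 2 * t", OF smooth_deriv this], of b]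
    have "((\<lambda>t. b * smooth (2 * t)) has_real_derivative b * (smooth' (2 * t) * 2)) (at t)" .
    from DERIV_chain2[where f = "q i" and g = "\<lambda>t. b * smooth (2 * t)", OF dq[OF i] this] show ?thesis
      by (simp add: qt_def[abs_def] qt'_def False)
  qed
  have cqt': "continuous_on UNIV (qt' i)" if i: "i < n" for i
    unfolding qt'_def[abs_def] using i
    by (cases "i = j")
       (auto intro!: continuous_intros continuous_on_compose2[OF smooth'_cont[of UNIV]] continuous_on_compose2[OF cq'[OF i]] continuous_on_compose2[OF smooth_cont[of UNIV]])
  interpret B: qpath n gb qt qt'
  proof (rule qpath.intro)
    show "0 \<le> qt' i t" if "i < n" for i t
      unfolding qt'_def using smooth'_nonneg q'0[OF that] b(1) by (auto intro!: mult_nonneg_nonneg)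
    show "0 \<le> qt i t \<and> qt i t \<le> 1" if "i < n" for i t
      unfolding qt_def using smooth01 q01[OF that] by auto
    show "qt i 0 = 0" if "i < n" for i unfolding qt_def using q0[OF that] by simp
  qed (simp add: gb, simp add: gb, rule dqt, assumption, rule cqt', assumption)
  have qtj: "qt j t = smooth (2 * t - 1)" for t by (simp add: qt_def)
  have qtj0: "qt j t = 0" if "t \<le> 1/2" for t using that by (simp add: qt_def)
  have qtj1: "qt j 1 = 1" by (simp add: qt_def)
  have qto: "qt l t = q l b" if "l \<noteq> j" "1/2 \<le> t" for l t using that by (simp add: qt_def)
  have BR1: "B.R i 1 = 0" if "i \<noteq> j" for i
  proof -
    have "\<exists>l\<in>{..<n}-{i}. 1 - qt l 1 = 0" using that j qtj1 by (intro bexI[of _ j]) auto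
    then show ?thesis unfolding B.R_def by (intro prod_zero) auto
  qed
  have BRj: "B.R j t = 0.197" if "1/2 \<le> t" for t
  proof -
    have "B.R j t = w b" unfolding B.R_def w_def A.R_def using that by (intro prod.cong) (auto simp: qto)
    then show ?thesis using b by simp
  qed
  have BRi: "B.R i t = (1 - qt j t) * (\<Prod>m\<in>{..<n}-{j}-{i}. 1 - q m b)" if "i \<noteq> j" "1/2 \<le> t" for i t
  proof -
    have "B.R i t = (1 - qt j t) * (\<Prod>m\<in>{..<n}-{i}-{j}. 1 - qt m t)"
      unfolding B.R_def using that j by (intro prod.remove) auto
    also have "(\<Prod>m\<in>{..<n}-{i}-{j}. 1 - qt m t) = (\<Prod>m\<in>{..<n}-{j}-{i}. 1 - q m b)"
      using that by (intro prod.cong) (auto simp: qto)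
    finally show ?thesis .
  qed
  have BF: "B.F i 1 \<le> 1" if i: "i < n" "i \<noteq> j" for i
  proof -
    define Z where "Z = (\<Prod>m\<in>{..<n}-{j}-{i}. 1 - q m b)"
    have Zh: "B.R i (1/2) = Z" using BRi[OF i(2), of "1/2"] qtj0[of "1/2"] by (simp add: Z_def)
    have P0h: "B.P0 (1/2) = 0.197" using B.P0_eq[OF j, of "1/2"] qtj0[of "1/2"] BRj[of "1/2"] by simp
    \<comment> \<open>In the second half only \<theta> = \<open>qt j t\<close> moves, and both
      \<open>P0\<close> and every product of another item carry the factor 1 - \<theta>.\<close>
    have ax: "item_curve_b_axioms (B.R i) (qt i) B.S (1/2)"
    proof (rule item_curve_b_axioms.intro)
      show "qt i t = qt i (1/2)" if "1/2 \<le> t" "t \<le> 1" for t using that i by (simp add: qto)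
      show "B.R i (1/2) * (1 - qt i (1/2)) = 0.197" using P0h B.P0_eq[OF i(1), of "1/2"] by (simp only: mult.commute)
      show "1 - Gb + Gb * (0.197 + B.R i t * (qt i (1/2) + (1 - qt i (1/2)) * - ln (B.R i (1/2)))) \<le> B.S t"
        if t: "1/2 \<le> t" "t \<le> 1" for t
      proof -
        define \<theta> where "\<theta> = qt j t"
        have \<theta>: "\<theta> \<le> 1" unfolding \<theta>_def by (simp add: qtj smooth01)
        define X where "X = (\<Sum>l\<in>{..<n}-{j}. q l b * (\<Prod>m\<in>{..<n}-{j}-{l}. 1 - q m b))"
        have X: "Z * (q i b + (1 - q i b) * - ln Z) \<le> X"
          unfolding X_def Z_def by (rule exactly_one_split) (use i q01 in auto)
        have "(\<Sum>l\<in>{..<n}-{j}. qt l t * B.R l t) = (\<Sum>l\<in>{..<n}-{j}. (1 - \<theta>) * (q l b * (\<Prod>m\<in>{..<n}-{j}-{l}. 1 - q m b)))"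
          using t by (intro sum.cong) (auto simp: BRi qto \<theta>_def)
        then have "(\<Sum>l<n. qt l t * B.R l t) = \<theta> * 0.197 + (1 - \<theta>) * X"
          using j BRj[OF t(1)] by (subst sum.remove[of _ j]) (simp_all add: \<theta>_def X_def sum_distrib_left)
        moreover have "B.P0 t = (1 - \<theta>) * 0.197" using B.P0_eq[OF j, of t] BRj[OF t(1)] by (simp add: \<theta>_def)
        ultimately have "B.S t = 1 - gb + gb * (0.197 + (1 - \<theta>) * X)" unfolding B.S_def by algebra
        moreover have "(1 - \<theta>) * (Z * (q i b + (1 - q i b) * - ln Z)) \<le> (1 - \<theta>) * X"
          using X \<theta> by (intro mult_left_mono) auto
        moreover have "B.R i t = (1 - \<theta>) * Z" using BRi[OF i(2) t(1)] by (simp add: \<theta>_def Z_def)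
        moreover have "qt i (1/2) = q i b" using i by (simp add: qto)
        moreover have "gb * ((1 - \<theta>) * (Z * (q i b + (1 - q i b) * - ln Z))) \<le> gb * ((1 - \<theta>) * X)"
          using calculation(2) by (rule mult_left_mono) (simp add: gb)
        ultimately have "1 - gb + gb * (0.197 + B.R i t * (qt i (1/2) + (1 - qt i (1/2)) * - ln (B.R i (1/2)))) \<le> B.S t"
          unfolding Zh by (simp only: mult.assoc distrib_left)
        then show ?thesis by (simp only: gb)
      qed
    qed simp_all
    have "item_curve Gb (B.R i) (qt i) B.S (B.c i) (B.F i) (B.g i)"
      using B.item[OF i(1) BR1[OF i(2)]] by (simp only: gb)
    then show ?thesis by (rule item_curve_b.others_bound[OF item_curve_b.intro[OF _ ax]])
  qed
  \<comment> \<open>0.54892 is the solution of c + (1 - c) * 0.392129 = 0.7258 rounded up; the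
    remaining mass of item j goes to the closing offer.\<close>
  define c where "c l = (if l = j then 0.54892 else (0::real))" for l
  define d where "d l = (if l = j then 0.45108 else (0::real))" for l
  define f where "f l = (if l = j then (\<lambda>_. 0) else B.f l)" for l
  \<comment> \<open>The real clock stops at level b at time 1/2, while the others keep arriving at
    that level until time 1.\<close>
  define \<sigma> where "\<sigma> t = b * smooth (2 * t)" for t
  have \<sigma>_mono: "\<sigma> s \<le> \<sigma> t" if "s \<le> t" for s t
    unfolding \<sigma>_def using that b by (intro mult_left_mono smooth_mono) auto
  have \<sigma>b: "0 \<le> \<sigma> t" "\<sigma> t \<le> b" for t
    unfolding \<sigma>_def using smooth01[of "2 * t"] b by (auto intro: mult_left_le)
  have \<sigma>c: "continuous_on A \<sigma>" for A
    unfolding \<sigma>_def[abs_def] by (intro continuous_intros continuous_on_compose2[OF smooth_cont[of UNIV]]) auto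
  have des: "fluid_design n c f d \<sigma> a"
    unfolding fluid_design_def
  proof (intro conjI allI impI)
    fix i assume i: "i < n"
    show "0 \<le> c i" "0 \<le> d i" by (simp_all add: c_def d_def)
    show "continuous_on {0..1} (f i)" using B.f_cont[OF i] by (simp add: f_def)
    show "0 \<le> f i t" for t by (simp add: f_def B.f_nonneg)
    show "c i + integral {0..1} (f i) + d i \<le> 1"
      using BF[OF i] by (cases "i = j") (simp_all add: c_def d_def f_def B.F_def)
  next
    show "\<sigma> t \<le> 1" for t using \<sigma>b(2)[of t] b by simp
  qed (use \<sigma>c \<sigma>_mono \<sigma>b(1) a in simp_all)
  have g01: "B.g l t \<le> 1" if "l < n" "0 \<le> t" "t \<le> 1" for l t
  proof -
    have "0 \<le> integral {0..t} (\<lambda>s. qt l s * B.f l s)"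
      using B.f_nonneg B.q01[OF that(1)] by (intro integral_nonneg integrable_continuous_interval continuous_intros B.q_cont continuous_on_subset[OF B.f_cont] that) (use that in auto)
    then show ?thesis using B.g_eq[OF that] by simp
  qed
  have psi: "1 - c l * q l a - integral {0..t} (\<lambda>x. q l (\<sigma> x) * f l x) = B.g l t"
    if l: "l < n" "l \<noteq> j" and t: "0 \<le> t" "t \<le> 1" for l t
  proof -
    have "(\<lambda>x. q l (\<sigma> x) * f l x) = (\<lambda>x. qt l x * B.f l x)" using l by (simp add: f_def qt_def \<sigma>_def)
    then show ?thesis using l B.g_eq[OF l(1) t] by (simp add: c_def)
  qed
  have psij: "1 - c j * q j a - integral {0..t} (\<lambda>x. q j (\<sigma> x) * f j x) = 1 - 0.54892 * q j a" for t
    by (simp add: f_def c_def)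
  \<comment> \<open>The chance that the opening offer does not sell item j.\<close>
  define m where "m = 1 - 0.54892 * q j a"
  have m0: "0 \<le> m" using ya q01[OF j, of a] by (simp add: m_def)
  define T where "T i s = c i * q i (min a s) * (\<Prod>l\<in>{..<n}-{i}. 1 - c l * q l a)
     + integral {0..1} (\<lambda>t. f i t * (q i (min (\<sigma> t) s)
         * (\<Prod>l\<in>{..<n}-{i}. 1 - c l * q l a - integral {0..t} (\<lambda>x. q l (\<sigma> x) * f l x))))
     + d i * q i s * (\<Prod>l\<in>{..<n}-{i}. 1 - c l * q l a - integral {0..1} (\<lambda>x. q l (\<sigma> x) * f l x) - d l * q l 1)" for i s
  have Tj: "0.54892 * q j (min a s) + 0.45108 * 0.392129 * q j s \<le> T j s" for s
  proof -
    \<comment> \<open>The product of all fictitious g, including that of j, which is at most 1. It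
      is thus a lower bound for the chance that no other item is sold before the closing
      offer.\<close>
    have S1: "B.S 1 = 0.392129"
    proof -
      have "(\<Sum>l<n. qt l 1 * B.R l 1) = 0.197"
        using j BRj[of 1] BR1 qtj1 by (subst sum.remove[of _ j]) auto
      moreover have "B.P0 1 = 0" using B.P0_eq[OF j, of 1] qtj1 by simp
      ultimately show ?thesis unfolding B.S_def by (simp add: gb)
    qed
    have "B.S 1 = B.g j 1 * (\<Prod>l\<in>{..<n}-{j}. B.g l 1)"
      using j B.prod_g[of 1] by (simp add: prod.remove[of "{..<n}" j])
    also have "\<dots> \<le> 1 * (\<Prod>l\<in>{..<n}-{j}. B.g l 1)"
      using g01[OF j, of 1] by (intro mult_right_mono prod_nonneg) (auto intro: less_imp_le[OF B.g_pos])
    finally have G: "0.392129 \<le> (\<Prod>l\<in>{..<n}-{j}. B.g l 1)" using S1 by simp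
    have 1: "(\<Prod>l\<in>{..<n}-{j}. 1 - c l * q l a) = 1" by (rule prod.neutral) (simp add: c_def)
    have 2: "(\<Prod>l\<in>{..<n}-{j}. 1 - c l * q l a - integral {0..1} (\<lambda>x. q l (\<sigma> x) * f l x) - d l * q l 1) = (\<Prod>l\<in>{..<n}-{j}. B.g l 1)"
      by (rule prod.cong) (simp_all add: psi d_def)
    have "0.45108 * q j s * 0.392129 \<le> 0.45108 * q j s * (\<Prod>l\<in>{..<n}-{j}. B.g l 1)"
      using G q01[OF j, of s] by (intro mult_left_mono) auto
    moreover have "T j s = 0.54892 * q j (min a s) + 0.45108 * q j s * (\<Prod>l\<in>{..<n}-{j}. B.g l 1)"
      unfolding T_def 1 2 by (simp add: c_def d_def f_def)
    ultimately show ?thesis by (simp only: mult_ac)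
  qed
  \<comment> \<open>The fictitious factor g_j \<le> 1 is dropped and the real factor m takes its
    place; s' is the fictitious level that matches s for the others.\<close>
  have Ti: "m * integral {0..1} (\<lambda>t. - (gb * B.R' i t) * qt i (min t s')) \<le> T i s"
    if i: "i < n" "i \<noteq> j" and s': "\<And>t. 0 \<le> t \<Longrightarrow> t \<le> 1 \<Longrightarrow> q i (min (\<sigma> t) s) = qt i (min t s')" for i s s'
  proof -
    define E where "E t = B.f i t * (qt i (min t s') * (\<Prod>l\<in>{..<n}-{i}-{j}. B.g l t))" for t
    have jm: "j \<in> {..<n}-{i}" using i j by simp
    have "T i s = integral {0..1} (\<lambda>t. f i t * (q i (min (\<sigma> t) s)
         * (\<Prod>l\<in>{..<n}-{i}. 1 - c l * q l a - integral {0..t} (\<lambda>x. q l (\<sigma> x) * f l x))))"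
      unfolding T_def using i by (simp add: c_def d_def)
    also have "\<dots> = integral {0..1} (\<lambda>t. m * E t)"
    proof (rule integral_cong)
      fix t :: real assume t: "t \<in> {0..1}"
      have "(\<Prod>l\<in>{..<n}-{i}. 1 - c l * q l a - integral {0..t} (\<lambda>x. q l (\<sigma> x) * f l x))
        = m * (\<Prod>l\<in>{..<n}-{i}-{j}. 1 - c l * q l a - integral {0..t} (\<lambda>x. q l (\<sigma> x) * f l x))"
        unfolding m_def psij[of t, symmetric] by (rule prod.remove[OF _ jm]) simp
      also have "(\<Prod>l\<in>{..<n}-{i}-{j}. 1 - c l * q l a - integral {0..t} (\<lambda>x. q l (\<sigma> x) * f l x)) = (\<Prod>l\<in>{..<n}-{i}-{j}. B.g l t)"
        using t by (intro prod.cong) (simp_all add: psi)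
      finally have p: "(\<Prod>l\<in>{..<n}-{i}. 1 - c l * q l a - integral {0..t} (\<lambda>x. q l (\<sigma> x) * f l x)) = m * (\<Prod>l\<in>{..<n}-{i}-{j}. B.g l t)" .
      have fi: "f i t = B.f i t" using i by (simp add: f_def)
      have qi: "q i (min (\<sigma> t) s) = qt i (min t s')" using s' t by simp
      show "f i t * (q i (min (\<sigma> t) s) * (\<Prod>l\<in>{..<n}-{i}. 1 - c l * q l a - integral {0..t} (\<lambda>x. q l (\<sigma> x) * f l x))) = m * E t"
        unfolding p fi qi E_def by (simp only: mult_ac)
    qed
    also have "\<dots> = m * integral {0..1} E" by simp
    finally have TE: "T i s = m * integral {0..1} E" .
    have qc: "continuous_on {0..1} (\<lambda>t. qt i (min t s'))"
      by (rule continuous_on_compose2[OF B.q_cont[OF i(1), of UNIV]]) (auto intro!: continuous_intros)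
    have "integral {0..1} (\<lambda>t. - (gb * B.R' i t) * qt i (min t s')) \<le> integral {0..1} E"
    proof (rule integral_le)
      show "(\<lambda>t. - (gb * B.R' i t) * qt i (min t s')) integrable_on {0..1}"
        by (intro integrable_continuous_interval continuous_intros B.R'_cont qc)
      show "E integrable_on {0..1}" unfolding E_def
        by (intro integrable_continuous_interval continuous_intros B.f_cont B.g_cont qc i) auto
      fix t :: real assume t: "t \<in> {0..1}"
      define Pg where "Pg = (\<Prod>l\<in>{..<n}-{i}-{j}. B.g l t)"
      have Pg: "0 \<le> Pg" unfolding Pg_def by (intro prod_nonneg) (auto intro: less_imp_le[OF B.g_pos])
      have "- (gb * B.R' i t) = B.f i t * (B.g j t * Pg)"
        using B.f_prod[OF i(1), of t] t prod.remove[OF _ jm, of "\<lambda>l. B.g l t"] by (simp add: Pg_def)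
      also have "\<dots> \<le> B.f i t * (1 * Pg)"
        using g01[OF j, of t] t Pg by (intro mult_left_mono mult_right_mono B.f_nonneg) auto
      finally have "- (gb * B.R' i t) * qt i (min t s') \<le> B.f i t * (1 * Pg) * qt i (min t s')"
        using B.q01[OF i(1)] by (intro mult_right_mono) auto
      then show "- (gb * B.R' i t) * qt i (min t s') \<le> E t" unfolding E_def Pg_def by (simp only: mult_ac mult_1_left)
    qed
    then show ?thesis unfolding TE using m0 by (rule mult_left_mono)
  qed
  have others: "m * (gb * (1 - w (min s b))) \<le> (\<Sum>i\<in>{..<n}-{j}. T i s)" if s: "0 \<le> s" "s \<le> 1" for s
  proof -
    \<comment> \<open>The matching level lies in the first half, where item j is absent, so the
      fictitious \<open>P0\<close> at it is w (min s b).\<close>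
    have "\<exists>x. 0 \<le> x \<and> x \<le> 1/2 \<and> \<sigma> x = min s b"
      using s b \<sigma>c[of "{0..1/2}"] by (intro IVT') (auto simp: \<sigma>_def)
    then obtain s' where s': "0 \<le> s'" "s' \<le> 1/2" "\<sigma> s' = min s b" by blast
    have eq: "q i (min (\<sigma> t) s) = qt i (min t s')" if i: "i \<noteq> j" for i t
    proof -
      have "min (\<sigma> t) s = \<sigma> (min t s')"
      proof (cases "t \<le> s'")
        case True
        then show ?thesis using \<sigma>_mono[OF True] s'(3) by (simp add: min_def split: if_splits)
      next
        case False
        then show ?thesis using \<sigma>_mono[of s' t] \<sigma>b(2)[of t] s'(3) by (simp add: min_def split: if_splits)
      qed
      then show ?thesis using i by (simp add: qt_def \<sigma>_def)
    qed
    have "B.P0 s' = B.R j s'" using B.P0_eq[OF j, of s'] qtj0[OF s'(2)] by simp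
    also have "\<dots> = w (min s b)"
      unfolding B.R_def w_def A.R_def s'(3)[symmetric] by (rule prod.cong) (auto simp: qt_def \<sigma>_def)
    finally have P0: "B.P0 s' = w (min s b)" .
    have z: "(\<Sum>i<n. qt i s' * B.R i 1) = 0"
    proof (rule sum.neutral, rule ballI)
      show "qt i s' * B.R i 1 = 0" for i using BR1[of i] qtj0[OF s'(2)] by (cases "i = j") auto
    qed
    have "integral {0..1} (\<lambda>t. - (gb * B.R' j t) * qt j (min t s')) = 0"
      using s' by (intro integral_eq_0_iff[THEN iffD2] | simp add: qtj0 min_le_iff_disj)+
    then have "(\<Sum>i\<in>{..<n}-{j}. integral {0..1} (\<lambda>t. - (gb * B.R' i t) * qt i (min t s'))) = gb * (1 - w (min s b))"
      using B.level_identity[of s'] s' z P0 sum.remove[of "{..<n}" j "\<lambda>i. integral {0..1} (\<lambda>t. - (gb * B.R' i t) * qt i (min t s'))"] j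
      by simp
    then have "m * (gb * (1 - w (min s b))) = (\<Sum>i\<in>{..<n}-{j}. m * integral {0..1} (\<lambda>t. - (gb * B.R' i t) * qt i (min t s')))"
      by (simp only: sum_distrib_left[symmetric])
    also have "\<dots> \<le> (\<Sum>i\<in>{..<n}-{j}. T i s)"
      by (intro sum_mono Ti eq) auto
    finally show ?thesis .
  qed
  have reward: "0.54892 * q j (min a s) + 0.45108 * 0.392129 * q j s + m * (gb * (1 - w (min s b))) \<le> fluid_reward n q c f d \<sigma> a s"
    if s: "0 \<le> s" "s \<le> 1" for s
  proof -
    have "fluid_reward n q c f d \<sigma> a s = T j s + (\<Sum>i\<in>{..<n}-{j}. T i s)"
      unfolding fluid_reward_def T_def[symmetric] using j by (intro sum.remove) auto
    then show ?thesis using Tj[of s] others[OF s] by linarith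
  qed
  have "ga * (1 - (\<Prod>i<n. 1 - q i s)) \<le> fluid_reward n q c f d \<sigma> a s" if s: "0 \<le> s" "s \<le> 1" for s
  proof -
    have P0: "(\<Prod>i<n. 1 - q i s) = (1 - q j s) * w s" using A.P0_eq[OF j, of s] by (simp add: A.P0_def w_def)
    have y0: "0 \<le> q j s" "0 \<le> q j a" using q01[OF j] by auto
    have r: "54892/100000 * q j (min a s) + 45108/100000 * (392129/1000000) * q j s + (1 - 54892/100000 * q j a) * (757/1000 * (1 - w (min s b))) \<le> fluid_reward n q c f d \<sigma> a s"
      using reward[OF s] by (simp add: m_def gb)
    have rest: "757/1000 * (1 - w (min s b)) + 45108/100000 * (392129/1000000) * q j s \<le> fluid_reward n q c f d \<sigma> a s" if "a \<le> s"
    proof -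
      \<comment> \<open>A sale of item j at the opening is worth at least what it takes from the
        others: U + (1 - U) * W \<ge> W.\<close>
      have gen: "W + Z \<le> X" if "U + Z + (1 - U) * W \<le> X" "0 \<le> U * (1 - W)" for U W Z X :: real
        using that by (simp add: algebra_simps)
      have mas: "min a s = a" using that by simp
      show ?thesis
      proof (rule gen)
        show "54892/100000 * q j a + 45108/100000 * (392129/1000000) * q j s + (1 - 54892/100000 * q j a) * (757/1000 * (1 - w (min s b))) \<le> fluid_reward n q c f d \<sigma> a s"
          using r unfolding mas .
        show "0 \<le> 54892/100000 * q j a * (1 - 757/1000 * (1 - w (min s b)))"
          using y0 w_range[of "min s b"] by (intro mult_nonneg_nonneg) auto
      qed
    qed
    consider "s \<le> a" | "a \<le> s" "s \<le> b" | "b \<le> s" by linarith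
    then have "7258/10000 * (1 - (1 - q j s) * w s) \<le> fluid_reward n q c f d \<sigma> a s"
    proof cases
      case 1
      then have e: "min a s = s" "min s b = s" using ab by auto
      show ?thesis
        by (rule order_trans[OF numeric_early[OF y0(1) A.q_mono[OF j 1] ya w_range[of s]] r[unfolded e]])
    next
      case 2
      have ws: "w s \<le> 1/2" using w_anti[OF 2(1)] a by simp
      have "7258/10000 * (1 - (1 - q j s) * w s) \<le> 757/1000 * (1 - w s) + 45108/100000 * (392129/1000000) * q j s"
      proof (rule numeric_mid[OF y0(1) ws])
        assume w': "2437/10000 \<le> w s"
        show "q j s * kq (w s) < 2/1000" using U[OF s] w' ws by simp
        show "0 < kq (w s)" "2/1000 * (7258/10000 * w s - 17688/100000) \<le> 312/10000 * (1 - w s) * kq (w s)"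
          by (rule kk_poly[OF w' ws])+
      qed
      moreover have e: "min s b = s" using 2 by simp
      ultimately show ?thesis using rest[OF 2(1), unfolded e] by (meson order_trans)
    next
      case 3
      have ws: "w s \<le> 197/1000" using w_anti[OF 3] b by simp
      have "7258/10000 * (1 - (1 - q j s) * w s) \<le> 607871/1000000 + 45108/100000 * (392129/1000000) * q j s"
      proof (rule numeric_late[OF y0(1) w_range(1) ws])
        \<comment> \<open>In each of the four cases \<tau> is rounded up from the bound for Ga *
          \<eta> * \<open>dlt\<close> divided by 0.36.\<close>
        show "635/10000 \<le> q j s" if "w s \<le> 1625/10000"
          by (rule yL[OF s that, where \<tau> = "3/10000"]) (simp_all add: power2_eq_square)
        show "2175/10000 \<le> q j s" if "w s \<le> 157/1000"
          by (rule yL[OF s that, where \<tau> = "1/1000"]) (simp_all add: power2_eq_square)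
        show "345/1000 \<le> q j s" if "w s \<le> 14/100"
          by (rule yL[OF s that, where \<tau> = "22/10000"]) (simp_all add: power2_eq_square)
        show "68/100 \<le> q j s" if "w s \<le> 12/100"
          by (rule yL[OF s that, where \<tau> = "34/10000"]) (simp_all add: power2_eq_square)
      qed
      moreover have e: "757/1000 * (1 - w (min s b)) = 607871/1000000" using 3 b by (simp add: min_absorb2)
      moreover have "a \<le> s" using ab 3 by simp
      ultimately show ?thesis using rest[unfolded e] by (meson order_trans)
    qed
    then show ?thesis unfolding P0 ga by simp
  qed
  then show ?thesis using des by blast
qed

theorem design:
  "\<exists>c f d \<sigma> a. fluid_design n c f d \<sigma> a \<and>
    (\<forall>s. 0 \<le> s \<longrightarrow> s \<le> 1 \<longrightarrow> ga * (1 - (\<Prod>i<n. 1 - q i s)) \<le> fluid_reward n q c f d \<sigma> a s)"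
proof (cases "\<forall>i<n. A.F i 1 \<le> 1")
  case True
  then show ?thesis by (intro plain_design) blast
next
  case False
  then obtain j where "j < n" "1 < A.F j 1" by (auto simp: not_le)
  then show ?thesis by (rule big_item_design)
qed

end

theorem theorem1:
  "\<exists>A. os_algorithm A \<and> competitive 0.7258 A"
proof (rule competitive_from_design)
  fix n :: nat and q q' :: "nat \<Rightarrow> real \<Rightarrow> real"
  assume "1 < n" "\<And>i t. i < n \<Longrightarrow> (q i has_real_derivative q' i t) (at t)"
    "\<And>i. i < n \<Longrightarrow> continuous_on UNIV (q' i)" "\<And>i t. i < n \<Longrightarrow> 0 \<le> q' i t"
    "\<And>i t. i < n \<Longrightarrow> 0 \<le> q i t \<and> q i t \<le> 1" "\<And>i. i < n \<Longrightarrow> q i 0 = 0" "\<And>i. i < n \<Longrightarrow> q i 1 = 1"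
  then have "full_path Ga Gb n q q'" by (intro full_path.intro refl)
  then show "\<exists>c f d \<sigma> a. fluid_design n c f d \<sigma> a \<and>
        (\<forall>s. 0 \<le> s \<longrightarrow> s \<le> 1 \<longrightarrow> 0.7258 * (1 - (\<Prod>i<n. 1 - q i s)) \<le> fluid_reward n q c f d \<sigma> a s)"
    by (rule full_path.design)
qed simp_all

end
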